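(* Let $K\ge1$, let $\mathbf a=(a_1,\dots,a_K)$ and $\mathbf b=(b_1,\dots,b_{K+1})$ be tuples of positive integers, and let \[ u_n=u_n(\mathbf a,\mathbf b)=\frac{(a_1n)!(a_2n)!\cdots(a_Kn)!}{(b_1n)!(b_2n)!\cdots(b_{K+1}n)!}. \] Suppose that $a_k\ne b_l$ for all $k,l$, that $\sum_{k=1}^K a_k=\sum_{l=1}^{K+1} b_l$, and that $\gcd(a_1,\dots,a_K,b_1,\dots,b_{K+1})=1$. Then $u_n(\mathbf a,\mathbf b)$ is an integer for all $n\in\mathbb N$ if and only if one of the following holds. (i) There are positive integers $a,b$ such that $u_n$ takes one of the following forms (for all $n$): (1) $u_n=\dfrac{[(a+b)n]!}{(an)!(bn)!}$ with $\gcd(a,b)=1$; (2) $u_n=\dfrac{(2an)!(bn)!}{(an)!(2bn)![(a-b)n]!}$ with $\gcd(a,b)=1$ and $a>b$; (3) $u_n=\dfrac{(2an)!(2bn)!}{(an)!(bn)![(a+b)n]!}$ with $\gcd(a,b)=1$. (ii) Up to permuting the entries of $\mathbf a$ and permuting the entries of $\mathbf b$, $(\mathbf a,\mathbf b)$ is one of the $52$ sporadic parameter sets listed in the context.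
   Context: The list of $52$ sporadic parameter sets, each written $[\mathbf a]/[\mathbf b]$: 1: $[12,1]/[6,4,3]$; 2: $[12,3,2]/[6,6,4,1]$; 3: $[12,1]/[8,3,2]$; 4: $[12,3]/[8,6,1]$; 5: $[12,3]/[6,5,4]$; 6: $[12,5]/[10,4,3]$; 7: $[18,1]/[9,6,4]$; 8: $[9,2]/[6,4,1]$; 9: $[9,4]/[8,3,2]$; 10: $[18,4,3]/[9,8,6,2]$; 11: $[9,1]/[5,3,2]$; 12: $[18,5,3]/[10,9,6,1]$; 13: $[18,4]/[12,9,1]$; 14: $[12,2]/[9,4,1]$; 15: $[18,2]/[9,6,5]$; 16: $[10,6]/[9,5,2]$; 17: $[14,3]/[9,7,1]$; 18: $[18,3,2]/[9,7,6,1]$; 19: $[12,2]/[7,4,3]$; 20: $[14,6,4]/[12,7,3,2]$; 21: $[14,1]/[7,5,3]$; 22: $[10,6,1]/[7,5,3,2]$; 23: $[15,1]/[9,5,2]$; 24: $[30,9,5]/[18,15,10,1]$; 25: $[15,4]/[12,5,2]$; 26: $[30,5,4]/[15,12,10,2]$; 27: $[15,4]/[8,6,5]$; 28: $[30,5,4]/[15,10,8,6]$; 29: $[15,2]/[10,4,3]$; 30: $[30,3,2]/[15,10,6,4]$; 31: $[30,1]/[15,10,6]$; 32: $[15,2]/[10,6,1]$; 33: $[15,7]/[14,5,3]$; 34: $[30,5,3]/[15,10,7,6]$; 35: $[30,5,3]/[15,12,10,1]$; 36: $[15,6,1]/[12,5,3,2]$; 37: $[15,1]/[8,5,3]$; 38: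 $[30,5,3,2]/[15,10,8,6,1]$; 39: $[20,3]/[12,10,1]$; 40: $[20,6,1]/[12,10,3,2]$; 41: $[20,1]/[10,8,3]$; 42: $[20,3,2]/[10,8,6,1]$; 43: $[20,1]/[10,7,4]$; 44: $[20,7,2]/[14,10,4,1]$; 45: $[20,3]/[10,9,4]$; 46: $[20,9,6]/[18,10,4,3]$; 47: $[24,1]/[12,8,5]$; 48: $[24,5,2]/[12,10,8,1]$; 49: $[24,4,1]/[12,8,7,2]$; 50: $[24,7,4]/[14,12,8,1]$; 51: $[24,4,3]/[12,9,8,2]$; 52: $[24,9,6,4]/[18,12,8,3,2]$. *)

theory Defs
  imports Complex_Main "HOL-Library.Multiset"
begin

definition factorial_ratio :: "nat list \<Rightarrow> nat list \<Rightarrow> nat \<Rightarrow> rat" where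
  "factorial_ratio as bs n =
     (\<Prod>a\<leftarrow>as. fact (a * n)) / (\<Prod>b\<leftarrow>bs. fact (b * n))"

definition sporadic_parameters :: "(nat list \<times> nat list) set" where
  "sporadic_parameters =
    {([12, 1], [6, 4, 3]),
     ([12, 3, 2], [6, 6, 4, 1]),
     ([12, 1], [8, 3, 2]),
     ([12, 3], [8, 6, 1]),
     ([12, 3], [6, 5, 4]),
     ([12, 5], [10, 4, 3]),
     ([18, 1], [9, 6, 4]),
     ([9, 2], [6, 4, 1]),
     ([9, 4], [8, 3, 2]),
     ([18, 4, 3], [9, 8, 6, 2]),
     ([9, 1], [5, 3, 2]),
     ([18, 5, 3], [10, 9, 6, 1]),
     ([18, 4], [12, 9, 1]),
     ([12, 2], [9, 4, 1]),
     ([18, 2], [9, 6, 5]),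
     ([10, 6], [9, 5, 2]),
     ([14, 3], [9, 7, 1]),
     ([18, 3, 2], [9, 7, 6, 1]),
     ([12, 2], [7, 4, 3]),
     ([14, 6, 4], [12, 7, 3, 2]),
     ([14, 1], [7, 5, 3]),
     ([10, 6, 1], [7, 5, 3, 2]),
     ([15, 1], [9, 5, 2]),
     ([30, 9, 5], [18, 15, 10, 1]),
     ([15, 4], [12, 5, 2]),
     ([30, 5, 4], [15, 12, 10, 2]),
     ([15, 4], [8, 6, 5]),
     ([30, 5, 4], [15, 10, 8, 6]),
     ([15, 2], [10, 4, 3]),
     ([30, 3, 2], [15, 10, 6, 4]),
     ([30, 1], [15, 10, 6]),
     ([15, 2], [10, 6, 1]),
     ([15, 7], [14, 5, 3]),
     ([30, 5, 3], [15, 10, 7, 6]),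
     ([30, 5, 3], [15, 12, 10, 1]),
     ([15, 6, 1], [12, 5, 3, 2]),
     ([15, 1], [8, 5, 3]),
     ([30, 5, 3, 2], [15, 10, 8, 6, 1]),
     ([20, 3], [12, 10, 1]),
     ([20, 6, 1], [12, 10, 3, 2]),
     ([20, 1], [10, 8, 3]),
     ([20, 3, 2], [10, 8, 6, 1]),
     ([20, 1], [10, 7, 4]),
     ([20, 7, 2], [14, 10, 4, 1]),
     ([20, 3], [10, 9, 4]),
     ([20, 9, 6], [18, 10, 4, 3]),
     ([24, 1], [12, 8, 5]),
     ([24, 5, 2], [12, 10, 8, 1]),
     ([24, 4, 1], [12, 8, 7, 2]),
     ([24, 7, 4], [14, 12, 8, 1]),
     ([24, 4, 3], [12, 9, 8, 2]),
     ([24, 9, 6, 4], [18, 12, 8, 3, 2])}"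

end

theory Submission
  imports Defs "HOL-Analysis.Analysis" "HOL-Computational_Algebra.Polynomial_FPS"
    "HOL-Number_Theory.Totient"
begin

text \<open>By Landau's criterion, integrality says that two sets of roots of unity interlace on the unit
  circle. The partial fraction weights of the quotient of \<open>\<Prod>(1 - X^b)\<close> by \<open>\<Prod>(1 - X^a)\<close> are
  then positive, so its power series coefficients, with the constant term doubled, form a positive
  definite sequence \<open>h\<close> of integers, and \<open>h k\<close> is the inner product of \<open>v\<close> and \<open>g^k v\<close> for an isometry \<open>g\<close>. The
  vectors \<open>\<plusminus>g^k v\<close> are roots of an irreducible root lattice. If its rank is at least 9, the lattice
  is of type A or D, where \<open>g\<close> acts as a signed permutation; its cycle type determines the quotient and
  yields the three families. If the rank is at most 8, only cyclotomic factors of order \<open>d\<close> with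
  totient at most 8 occur, which leaves a finite search.\<close>

section \<open>Finite sets of roots in a Euclidean space\<close>

text \<open>The rank is the number of poles of the reduced quotient, that is, of upward jumps of
  Landau's step function. The bound 8 is the rank of E_8: above it an irreducible root lattice has
  type A or D. No classification of root systems is presupposed. A largest orthonormal family of at
  least four vectors with all \<plusminus>e_i \<plusminus> e_j among the roots either accounts for
  every root or confines them to dimension 8; if not even a D_4 occurs, a largest regular simplex
  takes its place. The constant term is doubled because the polynomial part of the partial fraction
  expansion is -1: adding 1 removes it, and 1 + 1 = 2 is the norm of a root. The condition gcd = 1
  enters through irreducibility: if h were supported on the multiples of some d > 1, every parameter
  would be divisible by d. In low rank the exceptional lattices mix with small cases of A and D, so
  no structure is used there: each cyclotomic exponent is -1, 0 or 1, a candidate is a pair of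
  disjoint sets of orders, and the alternation of Landau's function at a few rational points leaves
  only tabulated pairs.\<close>

definition orthonormal :: "(nat \<Rightarrow> 'a::real_inner) \<Rightarrow> nat \<Rightarrow> bool" where
  "orthonormal e r \<longleftrightarrow> (\<forall>i<r. \<forall>j<r. e i \<bullet> e j = (if i = j then 1 else 0))"

lemma orthonormal_inner_sum:
  assumes "orthonormal e r" "j < r"
  shows "(\<Sum>i<r. c i *\<^sub>R e i) \<bullet> e j = c j"
proof -
  have "(\<Sum>i<r. c i *\<^sub>R e i) \<bullet> e j = (\<Sum>i<r. if i = j then c i else 0)"
    unfolding inner_sum_left using assms by (intro sum.cong) (auto simp: orthonormal_def)
  then show ?thesis using assms(2) by simp
qed

text \<open>The remainder in Bessel's inequality is kept explicit, so that the inequality and its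
  equality case, which puts \<open>x\<close> into the span, both follow from it.\<close>

lemma orthonormal_Bessel:
  assumes "orthonormal e r"
  shows "x \<bullet> x = (\<Sum>i<r. (x \<bullet> e i)\<^sup>2)
    + (x - (\<Sum>i<r. (x \<bullet> e i) *\<^sub>R e i)) \<bullet> (x - (\<Sum>i<r. (x \<bullet> e i) *\<^sub>R e i))"
proof -
  define p where "p = (\<Sum>i<r. (x \<bullet> e i) *\<^sub>R e i)"
  have xp: "x \<bullet> p = (\<Sum>i<r. (x \<bullet> e i)\<^sup>2)"
    by (simp add: p_def inner_sum_right power2_eq_square)
  have "p \<bullet> p = (\<Sum>i<r. (x \<bullet> e i) * (p \<bullet> e i))"
    by (subst (2) p_def) (simp add: inner_sum_right)
  also have "\<dots> = (\<Sum>i<r. (x \<bullet> e i)\<^sup>2)"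
    using orthonormal_inner_sum[OF assms] by (intro sum.cong) (auto simp: p_def power2_eq_square)
  finally have "p \<bullet> p = (\<Sum>i<r. (x \<bullet> e i)\<^sup>2)" .
  then show ?thesis using xp unfolding p_def[symmetric]
    by (simp add: inner_diff_left inner_diff_right inner_commute[of p x])
qed

lemma orthonormal_Bessel_le:
  "orthonormal e r \<Longrightarrow> (\<Sum>i<r. (x \<bullet> e i)\<^sup>2) \<le> x \<bullet> x"
  using orthonormal_Bessel[of e r x] inner_ge_zero[of "x - (\<Sum>i<r. (x \<bullet> e i) *\<^sub>R e i)"] by linarith

lemma orthonormal_Bessel_eq:
  assumes "orthonormal e r" "x \<bullet> x = (\<Sum>i<r. (x \<bullet> e i)\<^sup>2)"
  shows "x = (\<Sum>i<r. (x \<bullet> e i) *\<^sub>R e i)"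
  using orthonormal_Bessel[OF assms(1), of x] assms(2) by simp

lemma inner_zero_on_span:
  assumes "\<And>y. y \<in> S \<Longrightarrow> x \<bullet> y = 0" "w \<in> span S"
  shows "x \<bullet> w = 0"
  using assms(2) by (induction rule: span_induct_alt) (auto simp: inner_add_right assms(1))

lemma Ints_abs_ge_1: "x \<in> \<int> \<Longrightarrow> x \<noteq> 0 \<Longrightarrow> 1 \<le> \<bar>x::real\<bar>"
  by (rule Ints_nonzero_abs_ge1)

lemma Ints_abs_less_2:
  assumes "x \<in> \<int>" "\<bar>x::real\<bar> < 2" shows "x = -1 \<or> x = 0 \<or> x = 1"
proof -
  obtain k where k: "x = of_int k" using assms(1) by (auto elim: Ints_cases)
  then have "\<bar>k\<bar> < 2" using assms(2) by linarith
  then have "k = -1 \<or> k = 0 \<or> k = 1" by linarith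
  then show ?thesis using k by auto
qed

text \<open>Irreducible simply laced root systems. The reflection of \<open>x\<close> in
  \<open>y\<close> is \<open>x - (x \<bullet> y) y\<close>; since inner products are integers of
  absolute value at most 2, closure under reflections comes down to \<open>root_minus\<close> and
  \<open>root_diff\<close>. Irreducibility is \<open>root_connected\<close>: no subspace separates
  the roots into those inside it and those orthogonal to it.\<close>

locale root_set =
  fixes R :: "'a::real_inner set"
  assumes root_norm: "x \<in> R \<Longrightarrow> x \<bullet> x = 2"
    and root_minus: "x \<in> R \<Longrightarrow> - x \<in> R"
    and root_Ints: "x \<in> R \<Longrightarrow> y \<in> R \<Longrightarrow> x \<bullet> y \<in> \<int>"
    and root_diff: "x \<in> R \<Longrightarrow> y \<in> R \<Longrightarrow> x \<bullet> y = 1 \<Longrightarrow> x - y \<in> R"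
    and root_connected: "subspace W \<Longrightarrow> (\<And>x. x \<in> R \<Longrightarrow> x \<in> W \<or> (\<forall>w\<in>W. x \<bullet> w = 0)) \<Longrightarrow>
           R \<inter> W \<noteq> {} \<Longrightarrow> R \<subseteq> W"
begin

lemma root_add: "x \<in> R \<Longrightarrow> y \<in> R \<Longrightarrow> x \<bullet> y = -1 \<Longrightarrow> x + y \<in> R"
  using root_diff[of x "- y"] root_minus[of y] by simp

lemma root_inner_le: "x \<in> R \<Longrightarrow> y \<in> R \<Longrightarrow> \<bar>x \<bullet> y\<bar> \<le> 2"
  using Cauchy_Schwarz_ineq[of x y] root_norm[of x] root_norm[of y]
  by (auto simp: abs_le_square_iff[of _ 2, simplified])

lemma root_eqI: "x \<in> R \<Longrightarrow> y \<in> R \<Longrightarrow> x \<bullet> y = 2 \<Longrightarrow> x = y"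
proof -
  assume "x \<in> R" "y \<in> R" "x \<bullet> y = 2"
  then have "(x - y) \<bullet> (x - y) = 0"
    using root_norm[of x] root_norm[of y] by (simp add: inner_diff_left inner_diff_right inner_commute)
  then show "x = y" by simp
qed

lemma root_inner_cases:
  assumes "x \<in> R" "y \<in> R"
  obtains "x = y" | "x = - y" | "x \<bullet> y \<in> {-1, 0, 1}"
proof -
  consider "x \<bullet> y = 2" | "x \<bullet> y = -2" | "\<bar>x \<bullet> y\<bar> < 2"
    using root_inner_le[OF assms] by linarith
  then show ?thesis
  proof cases
    case 1 then show ?thesis using root_eqI[OF assms] that by simp
  next
    case 2 then show ?thesis using root_eqI[OF assms(1) root_minus[OF assms(2)]] that by simp
  next
    case 3 then show ?thesis using Ints_abs_less_2[OF root_Ints[OF assms]] that by auto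
  qed
qed

section \<open>Frames: coordinates for subsystems of type D\<close>

text \<open>The roots \<plusminus>e_i \<plusminus> e_j form D_r. The vectors \<open>e i\<close> have
  norm 1, so they are not roots themselves and only supply coordinates.\<close>

definition frame :: "(nat \<Rightarrow> 'a) \<Rightarrow> nat \<Rightarrow> bool" where
  "frame e r \<longleftrightarrow> orthonormal e r \<and> (\<forall>i<r. \<forall>j<r. i \<noteq> j \<longrightarrow> e i + e j \<in> R \<and> e i - e j \<in> R)"

lemma frame_inner: "frame e r \<Longrightarrow> i < r \<Longrightarrow> j < r \<Longrightarrow> e i \<bullet> e j = (if i = j then 1 else 0)"
  by (auto simp: frame_def orthonormal_def)

lemma frame_root:
  assumes "frame e r" "i < r" "j < r" "i \<noteq> j" "\<epsilon> \<in> {1, -1}" "\<delta> \<in> {1, -1}"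
  shows "\<epsilon> *\<^sub>R e i + \<delta> *\<^sub>R e j \<in> R"
proof -
  have "e i + e j \<in> R" "e i - e j \<in> R" "- (e i + e j) \<in> R" "- (e i - e j) \<in> R"
    using assms root_minus by (auto simp only: frame_def)
  moreover have "- (e i + e j) = - e i - e j" "- (e i - e j) = e j - e i" by auto
  ultimately show ?thesis using assms(5,6) by auto
qed

lemma frame_coord_le:
  assumes "frame e r" "i < r" "x \<in> R" shows "(x \<bullet> e i)\<^sup>2 \<le> 2"
  using Cauchy_Schwarz_ineq[of x "e i"] frame_inner[OF assms(1,2,2)] root_norm[OF assms(3)] by simp

text \<open>Adding the integers \<open>x \<bullet> (e i + e j)\<close> and
  \<open>x \<bullet> (e i - e j)\<close> shows that twice a coordinate is an integer, and one
  integral coordinate forces all the others to be integral. Otherwise every doubled coordinate is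
  odd with square at most 8, hence 1 or -1.\<close>

lemma frame_coords:
  assumes "frame e r" "2 \<le> r" "x \<in> R"
  shows "(\<forall>i<r. x \<bullet> e i \<in> \<int>) \<or> (\<forall>i<r. \<bar>x \<bullet> e i\<bar> = 1/2)"
proof (cases "\<exists>i<r. x \<bullet> e i \<in> \<int>")
  case True
  then obtain i where i: "i < r" "x \<bullet> e i \<in> \<int>" by auto
  have "x \<bullet> e j \<in> \<int>" if "j < r" for j
  proof (cases "j = i")
    case False
    then have "x \<bullet> (e j + e i) \<in> \<int>"
      using assms that i root_Ints by (auto simp: frame_def)
    then have "x \<bullet> (e j + e i) - x \<bullet> e i \<in> \<int>" using i(2) by (rule Ints_diff)
    then show ?thesis by (simp add: inner_add_right)
  qed (use i in simp)
  then show ?thesis by simp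
next
  case False
  have "\<bar>x \<bullet> e i\<bar> = 1/2" if "i < r" for i
  proof -
    obtain j where j: "j < r" "j \<noteq> i"
      using assms(2) that by (cases "i = 0") (auto intro: that[of 0] that[of 1])
    have "x \<bullet> (e i + e j) \<in> \<int>" "x \<bullet> (e i - e j) \<in> \<int>"
      using assms that j root_Ints by (auto simp: frame_def)
    then have "x \<bullet> (e i + e j) + x \<bullet> (e i - e j) \<in> \<int>" by (rule Ints_add)
    then have "2 * (x \<bullet> e i) \<in> \<int>" by (simp add: inner_add_right inner_diff_right)
    then obtain k where k: "2 * (x \<bullet> e i) = of_int k" by (auto elim: Ints_cases)
    have "(2 * (x \<bullet> e i))\<^sup>2 \<le> 8"
      using frame_coord_le[OF assms(1) that assms(3)] by (simp add: power_mult_distrib)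
    then have "real_of_int (k\<^sup>2) \<le> of_int 8" unfolding k by simp
    then have "k\<^sup>2 \<le> 8" by (simp only: of_int_le_iff)
    have "\<bar>k\<bar> < 3"
    proof (rule ccontr)
      assume "\<not> \<bar>k\<bar> < 3"
      then have "3\<^sup>2 \<le> \<bar>k\<bar>\<^sup>2" by (intro power_mono) auto
      with \<open>k\<^sup>2 \<le> 8\<close> show False by simp
    qed
    moreover have "k \<noteq> 2 * m" for m
    proof
      assume "k = 2 * m"
      then have "x \<bullet> e i = of_int m" using k by simp
      then show False using False that by auto
    qed
    from this[of "-1"] this[of 0] this[of 1] have "k \<noteq> -2" "k \<noteq> 0" "k \<noteq> 2" by auto
    ultimately have "k = 1 \<or> k = -1" by linarith
    then show ?thesis using k by auto
  qed
  then show ?thesis by simp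
qed

text \<open>Integral coordinates are 0, 1 or -1. Two non-zero ones already use up the norm 2: the
  root of the frame with the same two coordinates has inner product 2 with \<open>x\<close> and so
  equals it.\<close>

lemma frame_coords_Ints_cases:
  assumes f: "frame e r" and x: "x \<in> R" and int: "\<forall>i<r. x \<bullet> e i \<in> \<int>"
  obtains "\<forall>i<r. x \<bullet> e i = 0"
  | i where "i < r" "x \<bullet> e i \<in> {1, -1}" "\<forall>j<r. j \<noteq> i \<longrightarrow> x \<bullet> e j = 0"
  | i j \<epsilon> \<delta> where "i < r" "j < r" "i \<noteq> j" "\<epsilon> \<in> {1, -1}" "\<delta> \<in> {1, -1}" "x = \<epsilon> *\<^sub>R e i + \<delta> *\<^sub>R e j"
proof -
  have one: "x \<bullet> e i \<in> {1, -1}" if "i < r" "x \<bullet> e i \<noteq> 0" for i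
  proof -
    have "\<bar>x \<bullet> e i\<bar> < 2"
    proof (rule ccontr)
      assume "\<not> \<bar>x \<bullet> e i\<bar> < 2"
      then have "2\<^sup>2 \<le> \<bar>x \<bullet> e i\<bar>\<^sup>2" by (intro power_mono) auto
      with frame_coord_le[OF f that(1) x] show False by simp
    qed
    then show ?thesis using Ints_abs_less_2[of "x \<bullet> e i"] int that by auto
  qed
  consider "\<forall>i<r. x \<bullet> e i = 0" | i where "i < r" "x \<bullet> e i \<noteq> 0" by blast
  then show ?thesis
  proof cases
    case 1 then show ?thesis by (rule that)
  next
    case (2 i)
    show ?thesis
    proof (cases "\<forall>j<r. j \<noteq> i \<longrightarrow> x \<bullet> e j = 0")
      case True
      then show ?thesis using that(2)[of i] one[of i] 2 by blast
    next
      case False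
      then obtain j where j: "j < r" "j \<noteq> i" "x \<bullet> e j \<noteq> 0" by blast
      define y where "y = (x \<bullet> e i) *\<^sub>R e i + (x \<bullet> e j) *\<^sub>R e j"
      have y: "y \<in> R" unfolding y_def
        using frame_root[OF f 2(1) j(1)] one[OF 2] one[OF j(1,3)] j(2) by metis
      have "x \<bullet> y = (x \<bullet> e i)\<^sup>2 + (x \<bullet> e j)\<^sup>2"
        by (simp add: y_def inner_add_right power2_eq_square)
      also have "\<dots> = 2" using one[OF 2] one[OF j(1,3)] by auto
      finally have "x = y" using root_eqI[OF x y] by simp
      then show ?thesis
        using that(3)[of i j "x \<bullet> e i" "x \<bullet> e j"] 2 j one[OF 2] one[OF j(1,3)] y_def by metis
    qed
  qed
qed

lemma frame_sign:
  assumes "frame e r" "\<And>i. i < r \<Longrightarrow> s i \<in> {1, -1}"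
  shows "frame (\<lambda>i. s i *\<^sub>R e i) r"
  unfolding frame_def orthonormal_def
proof (intro conjI allI impI)
  fix i j assume ij: "i < r" "j < r"
  have "s i * s i = 1" using assms(2)[OF ij(1)] by auto
  then show "s i *\<^sub>R e i \<bullet> s j *\<^sub>R e j = (if i = j then 1 else 0)"
    using frame_inner[OF assms(1) ij] by auto
  assume "i \<noteq> j"
  then show "s i *\<^sub>R e i + s j *\<^sub>R e j \<in> R"
    using frame_root[OF assms(1) ij _ assms(2)[OF ij(1)] assms(2)[OF ij(2)]] by simp
  have "- s j \<in> {1, -1}" using assms(2)[OF ij(2)] by auto
  from frame_root[OF assms(1) ij \<open>i \<noteq> j\<close> assms(2)[OF ij(1)] this]
  show "s i *\<^sub>R e i - s j *\<^sub>R e j \<in> R" by simp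
qed

text \<open>Such a root is \<open>e i + u\<close> for a new unit vector \<open>u\<close> orthogonal
  to the frame. Subtracting the roots of the frame that involve \<open>e i\<close> from
  \<open>x\<close> produces the roots that combine \<open>u\<close> with the other basis
  vectors.\<close>

lemma frame_extend_pos:
  assumes f: "frame e r" and r: "3 \<le> r" and x: "x \<in> R" and i: "i < r" "x \<bullet> e i = 1"
    and z: "\<forall>j<r. j \<noteq> i \<longrightarrow> x \<bullet> e j = 0"
  shows "frame (e(r := x - e i)) (Suc r)"
proof -
  define u where "u = x - e i"
  have ue: "u \<bullet> e j = 0" if "j < r" for j
    using z i that frame_inner[OF f i(1) that] by (auto simp: u_def inner_diff_left)
  then have ue': "e j \<bullet> u = 0" if "j < r" for j using that by (simp add: inner_commute)
  have uu: "u \<bullet> u = 1"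
    using root_norm[OF x] i frame_inner[OF f i(1) i(1)]
    by (simp add: u_def inner_diff_left inner_diff_right inner_commute)
  have pm: "e j + u \<in> R" "e j - u \<in> R" if j: "j < r" "j \<noteq> i" for j
  proof -
    have *: "e i - e j \<in> R" "e i + e j \<in> R" using f j i by (auto simp: frame_def)
    have "x \<bullet> (e i - e j) = 1" "x \<bullet> (e i + e j) = 1"
      using z i j by (auto simp: inner_diff_right inner_add_right)
    then have 1: "x - (e i - e j) \<in> R" and 2: "- (x - (e i + e j)) \<in> R"
      using root_diff[OF x *(1)] root_minus[OF root_diff[OF x *(2)]] by blast+
    have "e j + u = x - (e i - e j)" by (simp add: u_def)
    then show "e j + u \<in> R" using 1 by (simp only:)
    have "e j - u = - (x - (e i + e j))" by (simp add: u_def)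
    then show "e j - u \<in> R" using 2 by (simp only:)
  qed
  obtain j where j: "j < r" "j \<noteq> i"
    using r by (cases "i = 0") (auto intro: that[of 0] that[of 1])
  have ei: "e i + u \<in> R" "e i - u \<in> R"
  proof -
    show "e i + u \<in> R" using x by (simp add: u_def)
    have *: "e j - e i \<in> R" using f j i by (auto simp: frame_def)
    \<comment> \<open>The root \<open>e i - u\<close> is not a difference of \<open>x\<close> and a
      root of the frame; it is reached through a third index as
      \<open>(e j - u) - (e j - e i)\<close>.\<close>
    have "(e j - u) \<bullet> (e j - e i) = 1"
      using ue[OF j(1)] ue[OF i(1)] frame_inner[OF f j(1) j(1)] frame_inner[OF f j(1) i(1)] j
      by (simp add: inner_diff_left inner_diff_right inner_commute)
    from root_diff[OF pm(2)[OF j] * this] show "e i - u \<in> R" by (simp add: algebra_simps)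
  qed
  have all: "e j + u \<in> R" "e j - u \<in> R" if "j < r" for j
    using pm[OF that] ei by (cases "j = i"; auto)+
  have all': "u + e j \<in> R" "u - e j \<in> R" if "j < r" for j
    using all[OF that] root_minus[of "e j - u"] by (auto simp: add.commute)
  show ?thesis
    unfolding frame_def orthonormal_def u_def[symmetric]
  proof (intro conjI allI impI)
    fix k l assume kl: "k < Suc r" "l < Suc r"
    show "(e(r := u)) k \<bullet> (e(r := u)) l = (if k = l then 1 else 0)"
      using kl uu ue ue' frame_inner[OF f, of k l] by (auto simp: less_Suc_eq)
    assume "k \<noteq> l"
    then show "(e(r := u)) k + (e(r := u)) l \<in> R" "(e(r := u)) k - (e(r := u)) l \<in> R"
      using kl all all' f by (auto simp: less_Suc_eq frame_def)
  qed
qed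

lemma frame_extend:
  assumes f: "frame e r" and r: "3 \<le> r" and x: "x \<in> R" and i: "i < r" "x \<bullet> e i \<in> {1, -1}"
    and z: "\<forall>j<r. j \<noteq> i \<longrightarrow> x \<bullet> e j = 0"
  shows "\<exists>e'. frame e' (Suc r)"
proof (cases "x \<bullet> e i = 1")
  case True
  then show ?thesis using frame_extend_pos[OF f r x i(1) _ z] by blast
next
  case False
  then have "(- x) \<bullet> e i = 1" using i by auto
  then show ?thesis using frame_extend_pos[OF f r root_minus[OF x] i(1)] z by auto
qed

text \<open>Adding \<open>e i + e j\<close> to a root with coordinates -1/2 at \<open>i\<close> and
  \<open>j\<close> gives a root with 1/2 there, so minus signs disappear in pairs and only their
  parity survives. The change stays in the span of the frame.\<close>

lemma frame_flip:
  assumes f: "frame e r" and y: "y \<in> R" "\<forall>i<r. \<bar>y \<bullet> e i\<bar> = 1/2"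
  shows "\<exists>y'\<in>R. y' - y \<in> span (e ` {..<r}) \<and>
     (if even (card {i. i < r \<and> y \<bullet> e i < 0}) then \<forall>i<r. y' \<bullet> e i = 1/2
      else \<exists>k<r. y' \<bullet> e k = -1/2 \<and> (\<forall>i<r. i \<noteq> k \<longrightarrow> y' \<bullet> e i = 1/2))"
  using y
proof (induction "card {i. i < r \<and> y \<bullet> e i < 0}" arbitrary: y rule: less_induct)
  case less
  let ?N = "\<lambda>y. {i. i < r \<and> y \<bullet> e i < 0}"
  have fin: "finite (?N y)" by simp
  consider "card (?N y) = 0" | "card (?N y) = 1" | "2 \<le> card (?N y)" by linarith
  then show ?case
  proof cases
    case 1
    then have "\<not> y \<bullet> e i < 0" if "i < r" for i using fin that by auto
    then have "\<forall>i<r. y \<bullet> e i = 1/2" using less.prems(2) by force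
    moreover have ev: "even (card (?N y))" unfolding 1 by simp
    ultimately show ?thesis unfolding if_P[OF ev]
      by (intro bexI[of _ y] conjI less.prems(1)) (auto simp: span_zero)
  next
    case 2
    then obtain k where k: "?N y = {k}" by (auto simp: card_1_singleton_iff)
    have "k < r" "y \<bullet> e k < 0" using k by auto
    then have "k < r" "y \<bullet> e k = -1/2" using less.prems(2) by (auto simp: abs_if)
    moreover have "y \<bullet> e i = 1/2" if "i < r" "i \<noteq> k" for i
    proof -
      have "\<not> y \<bullet> e i < 0" using k that by auto
      then show ?thesis using less.prems(2) that by force
    qed
    ultimately have "\<exists>k<r. y \<bullet> e k = -1/2 \<and> (\<forall>i<r. i \<noteq> k \<longrightarrow> y \<bullet> e i = 1/2)" by blast
    moreover have od: "odd (card (?N y))" unfolding 2 by simp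
    ultimately show ?thesis unfolding if_not_P[OF od]
      by (intro bexI[of _ y] conjI less.prems(1)) (auto simp: span_zero)
  next
    case 3
    then obtain T where "T \<subseteq> ?N y" "card T = 2" by (meson obtain_subset_with_card_n)
    then obtain i j where ij: "i \<noteq> j" "i < r" "j < r" "y \<bullet> e i < 0" "y \<bullet> e j < 0"
      by (auto simp: card_2_iff)
    have h: "y \<bullet> e i = -1/2" "y \<bullet> e j = -1/2" using ij less.prems(2) by (auto simp: abs_if)
    define z where "z = y + (e i + e j)"
    have z: "z \<in> R" unfolding z_def
      using f ij h less.prems(1) by (intro root_add[of y "e i + e j"]) (auto simp: frame_def inner_add_right)
    have zk: "z \<bullet> e k = (if k = i \<or> k = j then 1/2 else y \<bullet> e k)" if "k < r" for k
      using ij h that frame_inner[OF f ij(2) that] frame_inner[OF f ij(3) that]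
      by (auto simp: z_def inner_add_left)
    have Nz: "?N z = ?N y - {i, j}"
    proof (intro set_eqI)
      fix k show "k \<in> ?N z \<longleftrightarrow> k \<in> ?N y - {i, j}"
        using zk[of k] ij(2,3) by (cases "k = i \<or> k = j") auto
    qed
    have card: "card (?N y) = card (?N z) + 2"
    proof -
      have "card (?N y - {i, j}) = card (?N y) - card {i, j}"
        using ij by (intro card_Diff_subset) auto
      then show ?thesis unfolding Nz using 3 ij(1) by simp
    qed
    then have lt: "card (?N z) < card (?N y)" by linarith
    have "\<forall>i<r. \<bar>z \<bullet> e i\<bar> = 1/2"
    proof (intro allI impI)
      fix k assume "k < r"
      then show "\<bar>z \<bullet> e k\<bar> = 1/2" using less.prems(2) zk[of k] by (cases "k = i \<or> k = j") auto
    qed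
    from less.hyps[OF lt z this] obtain y' where y': "y' \<in> R" "y' - z \<in> span (e ` {..<r})"
      "if even (card (?N z)) then \<forall>i<r. y' \<bullet> e i = 1/2
      else \<exists>k<r. y' \<bullet> e k = -1/2 \<and> (\<forall>i<r. i \<noteq> k \<longrightarrow> y' \<bullet> e i = 1/2)" by blast
    have "(y' - z) + (e i + e j) \<in> span (e ` {..<r})"
      using y'(2) ij by (intro span_add) (auto intro: span_base)
    then have sp: "y' - y \<in> span (e ` {..<r})" by (simp add: z_def algebra_simps)
    have ev: "even (card (?N y)) \<longleftrightarrow> even (card (?N z))" unfolding card by simp
    show ?thesis unfolding ev by (intro bexI[of _ y'] conjI y' sp)
  qed
qed

end

context root_set begin

lemma frame_in_span:
  assumes "frame e r" "2 \<le> r" "i < r" shows "e i \<in> span R"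
proof -
  obtain j where j: "j < r" "j \<noteq> i"
    using assms(2) by (cases "i = 0") (auto intro: that[of 0] that[of 1])
  have "e i + e j \<in> R" "e i - e j \<in> R" using assms j by (auto simp: frame_def)
  then have "(1/2) *\<^sub>R ((e i + e j) + (e i - e j)) \<in> span R"
    by (intro span_scale span_add span_base)
  then show ?thesis by (simp add: scaleR_2[symmetric])
qed

text \<open>Bounds the size of a frame, so that a largest one can be chosen.\<close>

lemma frame_card_le:
  assumes "frame e r" "2 \<le> r" "R \<subseteq> span T" "finite T"
  shows "r \<le> card T"
proof -
  have inj: "inj_on e {..<r}"
  proof (rule inj_onI)
    fix i j assume ij: "i \<in> {..<r}" "j \<in> {..<r}" "e i = e j"
    then have "e i \<bullet> e j = 1" using frame_inner[OF assms(1), of i i] by simp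
    then show "i = j" using frame_inner[OF assms(1), of i j] ij by (auto split: if_splits)
  qed
  have "0 \<notin> e ` {..<r}"
  proof
    assume "0 \<in> e ` {..<r}"
    then obtain i where "i < r" "e i = 0" by auto
    then show False using frame_inner[OF assms(1), of i i] by simp
  qed
  moreover have "pairwise orthogonal (e ` {..<r})"
    using frame_inner[OF assms(1)] by (auto simp: pairwise_def orthogonal_def)
  ultimately have "independent (e ` {..<r})" by (intro pairwise_orthogonal_independent)
  moreover have "e ` {..<r} \<subseteq> span T"
  proof -
    have "span R \<subseteq> span T" using assms(3) by (metis span_mono span_span)
    then show ?thesis using frame_in_span[OF assms(1,2)] by auto
  qed
  ultimately have "card (e ` {..<r}) \<le> card T" using independent_span_bound[OF assms(4)] by blast
  then show ?thesis using card_image[OF inj] by simp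
qed

lemma frame_half_normalize:
  assumes "frame e r" "\<forall>i<r. \<bar>x \<bullet> e i\<bar> = 1/2"
  obtains e' where "frame e' r" "\<forall>i<r. x \<bullet> e' i = 1/2"
proof (rule that[of "\<lambda>i. (2 * (x \<bullet> e i)) *\<^sub>R e i"])
  have c: "x \<bullet> e i = 1/2 \<or> x \<bullet> e i = -1/2" if "i < r" for i
    using assms(2) that by (auto simp: abs_if split: if_splits)
  show "frame (\<lambda>i. (2 * (x \<bullet> e i)) *\<^sub>R e i) r"
    using c by (intro frame_sign[OF assms(1)]) fastforce
  show "\<forall>i<r. x \<bullet> (2 * (x \<bullet> e i)) *\<^sub>R e i = 1/2"
  proof (intro allI impI)
    fix i assume "i < r"
    have "2 * t * t = 1/2" if "t = 1/2 \<or> t = -1/2" for t :: real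
      using that by (elim disjE) (hypsubst, simp)+
    from this[OF c[OF \<open>i < r\<close>]] show "x \<bullet> (2 * (x \<bullet> e i)) *\<^sub>R e i = 1/2"
      by simp
  qed
qed

lemma All_less_4: "(\<forall>i<4. P i) \<longleftrightarrow> P 0 \<and> P 1 \<and> P 2 \<and> P (3::nat)"
  by (auto simp: eval_nat_numeral less_Suc_eq)

text \<open>Triality: a half-integral root turns one frame of type $D_4$ into another one in which
  the root has integral coordinates.\<close>

lemma frame_4_extend:
  assumes f: "frame e 4" and x: "x \<in> R" "\<forall>i<4. \<bar>x \<bullet> e i\<bar> = 1/2"
  shows "\<exists>e'. frame e' 5"
proof -
  from frame_half_normalize[OF f x(2)] obtain e where f: "frame e 4" and xe: "\<forall>i<4. x \<bullet> e i = 1/2"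
    by metis
  have fi: "e i \<bullet> e j = (if i = j then 1 else 0)" if "i < 4" "j < 4" for i j
    using frame_inner[OF f] that by blast
  \<comment> \<open>\<open>h\<close> is the projection of \<open>x\<close> to the frame and a unit
    vector; each of \<open>f1\<close>, \<open>f2\<close>, \<open>f3\<close> flips two of its four
    signs. Sums and differences of these four vectors are again of the form \<plusminus>e_i
    \<plusminus> e_j, so they form a second frame for the same D_4.\<close>
  define h where "h = (1/2) *\<^sub>R (e 0 + e 1 + e 2 + e 3)"
  define f1 where "f1 = h - (e 2 + e 3)"
  define f2 where "f2 = h - (e 1 + e 3)"
  define f3 where "f3 = h - (e 1 + e 2)"
  have e0: "e 0 = h + h - e 1 - e 2 - e 3"
    by (simp add: h_def scaleR_add_left[symmetric])
  have R: "e i + e j \<in> R" "e i - e j \<in> R" if "i < 4" "j < 4" "i \<noteq> j" for i j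
    using f that by (auto simp: frame_def)
  have he: "h \<bullet> e i = 1/2" if "i < 4" for i
  proof -
    have "i \<in> {0, 1, 2, 3}" using that by auto
    then show ?thesis by (auto simp: h_def inner_add_left fi)
  qed
  then have eh: "e i \<bullet> h = 1/2" if "i < 4" for i
    using that by (simp add: inner_commute)
  have hh: "h \<bullet> h = 1"
    by (subst (2) h_def) (simp add: inner_add_right he)
  have xh: "x \<bullet> h = 1" by (simp add: h_def inner_add_right xe)
  define g where "g = (\<lambda>i::nat. if i = 0 then h else if i = 1 then f1 else if i = 2 then f2 else f3)"
  have o: "orthonormal g 4"
    by (simp add: orthonormal_def All_less_4 g_def f1_def f2_def f3_def inner_diff_left
      inner_diff_right inner_add_left inner_add_right he eh hh fi)
  have "h + f1 = e 0 + e 1" "h - f1 = e 2 + e 3" "h + f2 = e 0 + e 2" "h - f2 = e 1 + e 3"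
    "h + f3 = e 0 + e 3" "h - f3 = e 1 + e 2" "f1 + f2 = e 0 - e 3" "f1 - f2 = e 1 - e 2"
    "f1 + f3 = e 0 - e 2" "f1 - f3 = e 1 - e 3" "f2 + f3 = e 0 - e 1" "f2 - f3 = e 2 - e 3"
    by (simp_all add: e0 f1_def f2_def f3_def)
  then have A: "h + f1 \<in> R" "h - f1 \<in> R" "h + f2 \<in> R" "h - f2 \<in> R" "h + f3 \<in> R" "h - f3 \<in> R"
    "f1 + f2 \<in> R" "f1 - f2 \<in> R" "f1 + f3 \<in> R" "f1 - f3 \<in> R" "f2 + f3 \<in> R" "f2 - f3 \<in> R"
    using R[of 0 1] R[of 2 3] R[of 0 2] R[of 1 3] R[of 0 3] R[of 1 2] by simp_all
  have B: "f1 - h \<in> R" "f2 - h \<in> R" "f3 - h \<in> R" "f2 - f1 \<in> R" "f3 - f1 \<in> R" "f3 - f2 \<in> R"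
    using root_minus[OF A(2)] root_minus[OF A(4)] root_minus[OF A(6)] root_minus[OF A(8)]
      root_minus[OF A(10)] root_minus[OF A(12)] by simp_all
  have "frame g 4"
    using o A B by (simp add: frame_def All_less_4 g_def add.commute)
  \<comment> \<open>In the new frame \<open>x\<close> has the single non-zero coordinate 1, at
    \<open>h\<close>.\<close>
  from frame_extend_pos[OF this _ x(1), of 0]
  have "frame (g(4 := x - g 0)) (Suc 4)"
    by (simp add: All_less_4 g_def xh f1_def f2_def f3_def inner_diff_right inner_add_right xe)
  then show ?thesis by auto
qed

end

section \<open>Maximal frames with at most 8 vectors\<close>

context root_set begin

lemma frame_Ints_span:
  assumes f: "frame e r" "3 \<le> r" and max: "\<And>e. \<not> frame e (Suc r)"
    and x: "x \<in> R" "\<forall>i<r. x \<bullet> e i \<in> \<int>"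
  shows "(\<exists>i<r. \<exists>j<r. i \<noteq> j \<and> (\<exists>\<epsilon>\<in>{1, -1}. \<exists>\<delta>\<in>{1, -1}. x = \<epsilon> *\<^sub>R e i + \<delta> *\<^sub>R e j)) \<or>
    (\<forall>i<r. x \<bullet> e i = 0)"
proof (rule frame_coords_Ints_cases[OF f(1) x])
  assume "\<forall>i<r. x \<bullet> e i = 0" then show ?thesis by simp
next
  fix i assume "i < r" "x \<bullet> e i \<in> {1, -1}" "\<forall>j<r. j \<noteq> i \<longrightarrow> x \<bullet> e j = 0"
  then show ?thesis using frame_extend[OF f x(1)] max by blast
next
  fix i j \<epsilon> \<delta> assume "i < r" "j < r" "i \<noteq> j" "\<epsilon> \<in> {1, -1}" "\<delta> \<in> {1, -1}" "x = \<epsilon> *\<^sub>R e i + \<delta> *\<^sub>R e j"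
  then show ?thesis by blast
qed

lemma frame_Ints_span':
  assumes "frame e r" "3 \<le> r" "\<And>e. \<not> frame e (Suc r)" "x \<in> R" "\<forall>i<r. x \<bullet> e i \<in> \<int>"
  shows "x \<in> span (e ` {..<r}) \<or> (\<forall>i<r. x \<bullet> e i = 0)"
  using frame_Ints_span[OF assms]
proof (elim disjE exE conjE bexE)
  fix i j \<epsilon> \<delta> assume "i < r" "j < r" "x = \<epsilon> *\<^sub>R e i + \<delta> *\<^sub>R e j"
  then have "x \<in> span (e ` {..<r})" by (auto intro!: span_add span_scale intro: span_base)
  then show ?thesis ..
qed simp

text \<open>The dichotomy is the one in \<open>root_connected\<close> for the span of the frame,
  which contains the root \<open>e 0 + e 1\<close>.\<close>

lemma frame_spans:
  assumes f: "frame e r" "2 \<le> r"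
    and alt: "\<And>x. x \<in> R \<Longrightarrow> x \<in> span (e ` {..<r}) \<or> (\<forall>i<r. x \<bullet> e i = 0)"
  shows "R \<subseteq> span (e ` {..<r})"
proof (rule root_connected[OF subspace_span])
  fix x assume "x \<in> R"
  then show "x \<in> span (e ` {..<r}) \<or> (\<forall>w\<in>span (e ` {..<r}). x \<bullet> w = 0)"
    using alt[of x] inner_zero_on_span[of "e ` {..<r}" x] by auto
next
  have "e 0 + e 1 \<in> R" using f by (auto simp: frame_def)
  moreover have "e 0 + e 1 \<in> span (e ` {..<r})"
    using f(2) by (intro span_add span_base) auto
  ultimately show "R \<inter> span (e ` {..<r}) \<noteq> {}" by blast
qed

lemma frame_flip_even:
  assumes "frame e r" "y \<in> R" "\<forall>i<r. \<bar>y \<bullet> e i\<bar> = 1/2" "even (card {i. i < r \<and> y \<bullet> e i < 0})"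
  obtains y' where "y' \<in> R" "y' - y \<in> span (e ` {..<r})" "\<forall>i<r. y' \<bullet> e i = 1/2"
proof -
  have "\<exists>y'\<in>R. y' - y \<in> span (e ` {..<r}) \<and> (\<forall>i<r. y' \<bullet> e i = 1/2)"
    using frame_flip[OF assms(1-3)] unfolding if_P[OF assms(4)] .
  then show ?thesis using that by (elim bexE conjE)
qed

lemma frame_flip_odd:
  assumes "frame e r" "y \<in> R" "\<forall>i<r. \<bar>y \<bullet> e i\<bar> = 1/2" "odd (card {i. i < r \<and> y \<bullet> e i < 0})"
  obtains y' k where "y' \<in> R" "k < r" "y' \<bullet> e k = -1/2" "\<forall>i<r. i \<noteq> k \<longrightarrow> y' \<bullet> e i = 1/2"
proof -
  have "\<exists>y'\<in>R. y' - y \<in> span (e ` {..<r}) \<and>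
      (\<exists>k<r. y' \<bullet> e k = -1/2 \<and> (\<forall>i<r. i \<noteq> k \<longrightarrow> y' \<bullet> e i = 1/2))"
    using frame_flip[OF assms(1-3)] unfolding if_not_P[OF assms(4)] .
  then show ?thesis using that by (elim bexE conjE exE)
qed

lemma card_image_lessThan_le: "card (e ` {..<r::nat}) \<le> r"
  using card_image_le[of "{..<r}" e] by simp

text \<open>The situation of E_6 and E_7, whose largest frames have 5 and 6 vectors. One dimension
  beyond the frame suffices: with \<open>x = s + u\<close> split into its projection and an
  orthogonal part, the orthogonal part of every other half-integral root turns out to be a multiple
  of \<open>u\<close>.\<close>

lemma rank_le_8_aux:
  assumes f: "frame e r" and r: "5 \<le> r" "r \<le> 7" and max: "\<And>e. \<not> frame e (Suc r)"
    and x: "x \<in> R" "\<forall>i<r. x \<bullet> e i = 1/2"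
  shows "\<exists>T. finite T \<and> card T \<le> 8 \<and> R \<subseteq> span T"
proof -
  have fi: "e i \<bullet> e j = (if i = j then 1 else 0)" if "i < r" "j < r" for i j
    using frame_inner[OF f that] .
  define s where "s = (\<Sum>i<r. (1/2) *\<^sub>R e i)"
  define u where "u = x - s"
  define E where "E = e ` {..<r}"
  define W where "W = span (insert u E)"
  have o: "orthonormal e r" using f by (simp add: frame_def)
  have r2: "2 \<le> r" "3 \<le> r" using r by auto
  have se: "s \<bullet> e i = 1/2" if "i < r" for i
    unfolding s_def using orthonormal_inner_sum[OF o that, of "\<lambda>_. 1/2"] .
  have vs: "v \<bullet> s = (\<Sum>i<r. (v \<bullet> e i) / 2)" for v
    by (simp add: s_def inner_sum_right)
  have ss: "s \<bullet> s = real r / 4"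
  proof -
    have "(\<Sum>i<r. (s \<bullet> e i) / 2) = (\<Sum>i<r. (1/2) / 2)"
      using se by (intro sum.cong arg_cong2[of _ _ _ _ "(/)"]) blast+
    then show ?thesis unfolding vs[of s] by simp
  qed
  have xs: "x \<bullet> s = real r / 4"
  proof -
    have "(\<Sum>i<r. (x \<bullet> e i) / 2) = (\<Sum>i<r. (1/2) / 2)"
      using x(2) by (intro sum.cong arg_cong2[of _ _ _ _ "(/)"]) blast+
    then show ?thesis unfolding vs[of x] by simp
  qed
  have ue: "u \<bullet> e i = 0" if "i < r" for i
    unfolding u_def inner_diff_left se[OF that] using x(2) that by simp
  have uu: "u \<bullet> u = 2 - real r / 4"
    using xs ss root_norm[OF x(1)] by (simp add: u_def inner_diff_left inner_diff_right inner_commute)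
  have eW: "e i \<in> W" if "i < r" for i
    using that by (auto simp: W_def E_def intro: span_base)
  have EW: "span E \<subseteq> W" unfolding W_def by (rule span_mono) auto
  have uW: "u \<in> W" by (auto simp: W_def intro: span_base)
  have sW: "s \<in> W" unfolding s_def using eW by (auto simp: W_def intro!: span_sum span_scale)
  have xW: "x \<in> W" using span_add[of u "insert u E" s] uW sW by (simp add: u_def W_def)
  have Wadd: "a \<in> W \<Longrightarrow> b \<in> W \<Longrightarrow> a + b \<in> W" and Wdiff: "a \<in> W \<Longrightarrow> b \<in> W \<Longrightarrow> a - b \<in> W"
    and Wscale: "a \<in> W \<Longrightarrow> c *\<^sub>R a \<in> W" for a b c
    by (auto simp: W_def span_add span_diff span_scale)
  \<comment> \<open>By maximality of the frame, an integral root with a non-zero coordinate is one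
    of its own roots.\<close>
  have intW: "z \<in> W" if "z \<in> R" "\<forall>i<r. z \<bullet> e i \<in> \<int>" "k < r" "z \<bullet> e k \<noteq> 0" for z k
    using frame_Ints_span'[OF f r2(2) max that(1,2)] EW that(3,4) by (auto simp: E_def)
  have no1: False if "z \<in> R" "k < r" "z \<bullet> e k = 1" "\<forall>i<r. i \<noteq> k \<longrightarrow> z \<bullet> e i = 0" for z k
    using frame_extend[OF f r2(2) that(1,2)] that(3,4) max by blast
  have xe: "x \<bullet> e i = 1/2" if "i < r" for i using x(2) that by blast
  have xy_cases: "x \<bullet> y = 1 \<or> x = y" if "y \<in> R" "0 < x \<bullet> y" for y
    using x(1) that(1)
  proof (cases rule: root_inner_cases)
    case 2 then show ?thesis using that root_norm[OF that(1)] by simp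
  qed (use that(2) in auto)
  have even_W: "y \<in> W"
    if y: "y \<in> R" "\<forall>i<r. \<bar>y \<bullet> e i\<bar> = 1/2" and ev: "even (card {i. i < r \<and> y \<bullet> e i < 0})" for y
  proof -
    from frame_flip_even[OF f y ev]
    obtain y' where y': "y' \<in> R" "y' - y \<in> span E" "\<forall>i<r. y' \<bullet> e i = 1/2"
      unfolding E_def .
    have y'e: "y' \<bullet> e i = 1/2" if "i < r" for i using y'(3) that by blast
    have y's: "y' \<bullet> s = real r / 4"
    proof -
      have "(\<Sum>i<r. (y' \<bullet> e i) / 2) = (\<Sum>i<r. (1/2) / 2)"
        using y'(3) by (intro sum.cong arg_cong2[of _ _ _ _ "(/)"]) blast+
      then show ?thesis unfolding vs[of y'] by simp
    qed
    \<comment> \<open>Both \<open>x\<close> and \<open>y'\<close> project to \<open>s\<close>, so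
      this vector is the sum of their orthogonal parts. Its norm is non-negative, which makes
      \<open>x \<bullet> y'\<close> positive as soon as there are 5 coordinates.\<close>
    have "0 \<le> (x + y' - 2 *\<^sub>R s) \<bullet> (x + y' - 2 *\<^sub>R s)" by simp
    also have "\<dots> = 4 + 2 * (x \<bullet> y') - real r"
      using root_norm[OF x(1)] root_norm[OF y'(1)] xs ss y's
      by (simp add: inner_diff_left inner_diff_right inner_add_left inner_add_right inner_commute)
    finally have lower: "x \<bullet> y' \<ge> real r / 2 - 2" by simp
    have "y' \<in> W"
    proof (cases "x = y'")
      case False
      have "0 < x \<bullet> y'" using lower r by linarith
      with False have xy: "x \<bullet> y' = 1" using xy_cases[OF y'(1)] by blast
      then have "real r \<le> 6" using lower by linarith
      then have r6: "4 < r" "r \<le> 6" using r by linarith+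
      have e: "e 0 + e 1 \<in> R" "e 2 + e 3 \<in> R" using f r by (auto simp: frame_def)
      have a: "y' - (e 0 + e 1) \<in> R"
        using y'(1) r by (intro root_diff e) (simp_all add: inner_add_right y'e)
      have b: "y' - (e 0 + e 1) - (e 2 + e 3) \<in> R"
        using r6 by (intro root_diff e a) (simp_all add: inner_add_right inner_diff_left inner_add_left fi y'e)
      \<comment> \<open>All coordinates of \<open>x + y'\<close> are 1; the two subtracted roots
        cancel four of them. What remains is an integral root, hence in \<open>W\<close>, from which
        \<open>y'\<close> is recovered.\<close>
      define z where "z = x + (y' - (e 0 + e 1) - (e 2 + e 3))"
      have z: "z \<in> R" unfolding z_def
        using x(1) r xy by (intro root_add b) (simp_all add: inner_add_right inner_diff_right xe)
      have ze: "z \<bullet> e i = (if i < 4 then 0 else 1)" if "i < r" for i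
      proof -
        have "i = 0 \<or> i = 1 \<or> i = 2 \<or> i = 3 \<or> 4 \<le> i" by linarith
        then show ?thesis using that r
          by (elim disjE) (simp_all add: z_def inner_add_left inner_diff_left fi xe y'e)
      qed
      have "z \<in> W" using ze r6 by (intro intW[OF z, of 4]) auto
      moreover have "y' = z - x + (e 0 + e 1) + (e 2 + e 3)" by (simp add: z_def)
      ultimately show ?thesis using xW eW r by (auto intro!: Wadd Wdiff)
    qed (use xW in simp)
    moreover have "y = y' - (y' - y)" by simp
    ultimately show ?thesis using y'(2) EW by (metis Wdiff subsetD)
  qed
  have half_W: "y \<in> W" if y: "y \<in> R" "\<forall>i<r. \<bar>y \<bullet> e i\<bar> = 1/2" for y
  proof (cases "even (card {i. i < r \<and> y \<bullet> e i < 0})")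
    case True then show ?thesis using even_W[OF y] by simp
  next
    case odd: False
    show ?thesis
    proof (cases "r = 6")
      case True
      from frame_flip_odd[OF f y odd]
      obtain y' k where y': "y' \<in> R" "k < r" "y' \<bullet> e k = -1/2"
        "\<forall>i<r. i \<noteq> k \<longrightarrow> y' \<bullet> e i = 1/2" .
      have "y' \<bullet> s = (\<Sum>i<r. (if i = k then -1/4 else 1/4))"
        unfolding vs[of y'] using y' by (intro sum.cong) auto
      also have "\<dots> = (\<Sum>i<r. 1/4 + (if i = k then -1/2 else 0))"
        by (intro sum.cong) auto
      also have "\<dots> = (real r - 2) / 4"
        unfolding sum.distrib using y'(2) by (simp add: field_simps)
      finally have y's: "y' \<bullet> s = (real r - 2) / 4" .
      \<comment> \<open>Here \<open>y'\<close> projects to \<open>s - e k\<close>, so this is again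
        a sum of two orthogonal parts. The resulting inner product 1 would make
        \<open>x - y'\<close> a root with the single non-zero coordinate 1, which extends the
        frame.\<close>
      have "0 \<le> (x + y' - 2 *\<^sub>R s + e k) \<bullet> (x + y' - 2 *\<^sub>R s + e k)" by simp
      also have "\<dots> = 5 + 2 * (x \<bullet> y') - real r"
        using root_norm[OF x(1)] root_norm[OF y'(1)] xs ss y's x(2) y'(2,3) se[OF y'(2)] fi[OF y'(2,2)]
        by (simp add: inner_diff_left inner_diff_right inner_add_left inner_add_right inner_commute field_simps)
      finally have "0 < x \<bullet> y'" using True by simp
      moreover have "x \<noteq> y'" using x(2) y'(2,3) by auto
      ultimately have xy: "x \<bullet> y' = 1" using xy_cases[OF y'(1)] by blast
      have y'e: "y' \<bullet> e i = 1/2" if "i < r" "i \<noteq> k" for i using y'(4) that by blast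
      have False
      proof (rule no1[OF root_diff[OF x(1) y'(1) xy] y'(2)])
        show "(x - y') \<bullet> e k = 1" by (simp add: inner_diff_left xe y'(2,3))
        show "\<forall>i<r. i \<noteq> k \<longrightarrow> (x - y') \<bullet> e i = 0" by (simp add: inner_diff_left xe y'e)
      qed
      then show ?thesis ..
    next
      case False
      with r have "r = 5 \<or> r = 7" by linarith
      \<comment> \<open>For an odd number of coordinates, passing to \<open>- y\<close> makes the
        number of minus signs even.\<close>
      then have oddr: "odd r" by auto
      have ne: "y \<bullet> e i \<noteq> 0" if "i < r" for i using y(2) that by fastforce
      have "{i. i < r \<and> (- y) \<bullet> e i < 0} = {..<r} - {i. i < r \<and> y \<bullet> e i < 0}"
        by (auto simp: not_less order_le_less ne)
      then have "card {i. i < r \<and> (- y) \<bullet> e i < 0} = r - card {i. i < r \<and> y \<bullet> e i < 0}"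
        by (simp add: card_Diff_subset subset_eq)
      moreover have "card {i. i < r \<and> y \<bullet> e i < 0} \<le> card {..<r}"
        by (intro card_mono) auto
      ultimately have "even (card {i. i < r \<and> (- y) \<bullet> e i < 0})" using odd oddr by simp
      then have "- y \<in> W" using y root_minus by (intro even_W) auto
      then show ?thesis using Wscale[of "- y" "-1"] by simp
    qed
  qed
  have "R \<subseteq> W"
  proof (rule root_connected)
    show "subspace W" by (simp add: W_def)
    show "R \<inter> W \<noteq> {}" using x(1) xW by blast
    fix z assume z: "z \<in> R"
    show "z \<in> W \<or> (\<forall>w\<in>W. z \<bullet> w = 0)"
    proof (cases "(\<forall>i<r. z \<bullet> e i = 0) \<and> z \<bullet> u \<noteq> 0")
      case True
      then have zs: "z \<bullet> s = 0" unfolding vs[of z] by simp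
      then have zx: "z \<bullet> x = z \<bullet> u" "z \<bullet> x \<noteq> 0" using True by (auto simp: u_def inner_diff_right)
      \<comment> \<open>A root orthogonal to the frame but not to \<open>u\<close> shifts
        \<open>x\<close> to another half-integral root, to which \<open>half_W\<close>
        applies.\<close>
      have h: "\<bar>(x - z) \<bullet> e i\<bar> = 1/2" "\<bar>(x + z) \<bullet> e i\<bar> = 1/2" if "i < r" for i
        using True that by (auto simp: inner_diff_left inner_add_left xe)
      from z x(1) show ?thesis
      proof (cases rule: root_inner_cases)
        case 3
        then have "x \<bullet> z = 1 \<or> x \<bullet> z = -1" using zx by (auto simp: inner_commute)
        then show ?thesis
        proof
          assume "x \<bullet> z = 1"
          from half_W[OF root_diff[OF x(1) z this]] h(1) have "x - z \<in> W" by blast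
          from Wdiff[OF xW this] show ?thesis by simp
        next
          assume "x \<bullet> z = -1"
          from half_W[OF root_add[OF x(1) z this]] h(2) have "x + z \<in> W" by blast
          from Wdiff[OF this xW] show ?thesis by simp
        qed
      qed (use xW Wscale[OF xW, of "-1"] in auto)
    next
      case False
      show ?thesis
      proof (cases "\<forall>i<r. z \<bullet> e i = 0")
        case True
        then have "z \<bullet> u = 0" using False by blast
        then show ?thesis unfolding W_def
          using True inner_zero_on_span[of "insert u E" z] by (auto simp: E_def)
      next
        case False
        then obtain k where k: "k < r" "z \<bullet> e k \<noteq> 0" by blast
        from frame_coords[OF f r2(1) z] show ?thesis
          using intW[OF z _ k] half_W[OF z] by blast
      qed
    qed
  qed
  moreover have "card (insert u E) \<le> 8"
    using card_image_lessThan_le[of e r] r card_insert_le_m1[of 8 E u] by (simp add: E_def)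
  ultimately show ?thesis unfolding W_def by (intro exI[of _ "insert u E"]) (simp add: E_def)
qed

text \<open>A half-integral root extends a frame of 4 vectors by triality. For 5 to 7 vectors it
  adds one dimension. For 8 vectors, as in E_8, its coordinates already account for the norm 8/4 =
  2, so it adds none.\<close>

lemma rank_le_8:
  assumes f: "frame e r" and r: "4 \<le> r" "r \<le> 8" and max: "\<And>e. \<not> frame e (Suc r)"
  shows "\<exists>T. finite T \<and> card T \<le> 8 \<and> R \<subseteq> span T"
proof -
  have r2: "2 \<le> r" "3 \<le> r" using r by auto
  have span: ?thesis if "R \<subseteq> span (e ` {..<r})"
    using that card_image_lessThan_le[of e r] r by (intro exI[of _ "e ` {..<r}"]) auto
  show ?thesis
  proof (cases "\<exists>x\<in>R. \<forall>i<r. \<bar>x \<bullet> e i\<bar> = 1/2")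
    case False
    have "R \<subseteq> span (e ` {..<r})"
      using frame_coords[OF f r2(1)] False frame_Ints_span'[OF f r2(2) max]
      by (intro frame_spans[OF f r2(1)]) blast
    then show ?thesis by (rule span)
  next
    case True
    then obtain x where x: "x \<in> R" "\<forall>i<r. \<bar>x \<bullet> e i\<bar> = 1/2" by blast
    consider "r = 4" | "5 \<le> r" "r \<le> 7" | "r = 8" using r by linarith
    then show ?thesis
    proof cases
      case 1
      then show ?thesis using frame_4_extend[of e x] f x max by simp
    next
      case 2
      from frame_half_normalize[OF f x(2)] show ?thesis
        using rank_le_8_aux[OF _ 2 max x(1)] by metis
    next
      case 3
      have "y \<in> span (e ` {..<r})" if y: "y \<in> R" "\<forall>i<r. \<bar>y \<bullet> e i\<bar> = 1/2" for y
      proof -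
        have "(\<Sum>i<r. (y \<bullet> e i)\<^sup>2) = (\<Sum>i<r. 1/4)"
        proof (rule sum.cong)
          fix i assume "i \<in> {..<r}"
          then have "\<bar>y \<bullet> e i\<bar> = 1/2" using y(2) by simp
          then have "\<bar>y \<bullet> e i\<bar>\<^sup>2 = (1/2)\<^sup>2" by (simp only:)
          then show "(y \<bullet> e i)\<^sup>2 = 1/4" by (simp add: power2_eq_square)
        qed simp
        then have "y \<bullet> y = (\<Sum>i<r. (y \<bullet> e i)\<^sup>2)" using 3 root_norm[OF y(1)] by simp
        from orthonormal_Bessel_eq[OF _ this] f have "y = (\<Sum>i<r. (y \<bullet> e i) *\<^sub>R e i)"
          by (simp add: frame_def)
        moreover have "(\<Sum>i<r. (y \<bullet> e i) *\<^sub>R e i) \<in> span (e ` {..<r})"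
          by (intro span_sum span_scale span_base) auto
        ultimately show ?thesis by simp
      qed
      then have "R \<subseteq> span (e ` {..<r})"
        using frame_coords[OF f r2(1)] frame_Ints_span'[OF f r2(2) max]
        by (intro frame_spans[OF f r2(1)]) blast
      then show ?thesis by (rule span)
    qed
  qed
qed

end

section \<open>Simplices of type A, and the classification in rank above 8\<close>

context root_set begin

text \<open>A_3 coincides with D_3. If \<open>u + v\<close> and \<open>u - v\<close> both have norm
  2, then \<open>u\<close> and \<open>v\<close> are orthogonal with norms adding up to 2; three such
  pairs force all norms to be 1.\<close>

lemma frame_3I:
  assumes "a + b \<in> R" "a - b \<in> R" "a + c \<in> R" "a - c \<in> R" "b + c \<in> R" "b - c \<in> R"
  shows "frame (\<lambda>i. if i = 0 then a else if i = 1 then b else c) 3"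
proof -
  have A3: "(\<forall>i<3. P i) \<longleftrightarrow> P 0 \<and> P 1 \<and> P (2::nat)" for P
    by (auto simp: eval_nat_numeral less_Suc_eq)
  have n: "u \<bullet> u + v \<bullet> v = 2" "u \<bullet> v = 0" if "u + v \<in> R" "u - v \<in> R" for u v
    using root_norm[OF that(1)] root_norm[OF that(2)]
    by (simp_all add: inner_add_left inner_add_right inner_diff_left inner_diff_right inner_commute)
  note ab = n[OF assms(1,2)] and ac = n[OF assms(3,4)] and bc = n[OF assms(5,6)]
  have "a \<bullet> a = 1" "b \<bullet> b = 1" "c \<bullet> c = 1" using ab ac bc by linarith+
  moreover have "b \<bullet> a = 0" "c \<bullet> a = 0" "c \<bullet> b = 0" using ab ac bc by (simp_all add: inner_commute)
  moreover have "b - a \<in> R" "c - a \<in> R" "c - b \<in> R"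
    using root_minus[OF assms(2)] root_minus[OF assms(4)] root_minus[OF assms(6)] by simp_all
  ultimately show ?thesis using assms ab ac bc
    by (simp add: frame_def orthonormal_def A3 add.commute)
qed

text \<open>The vertices of a regular simplex, whose differences are the roots of type A_{m-1}. Only
  differences matter, so the simplex may be translated.\<close>

definition root_simplex :: "(nat \<Rightarrow> 'a) \<Rightarrow> nat \<Rightarrow> bool" where
  "root_simplex p m \<longleftrightarrow> (\<forall>i<m. \<forall>j<m. i \<noteq> j \<longrightarrow> p i - p j \<in> R)"

lemma root_simplexD: "root_simplex p m \<Longrightarrow> i < m \<Longrightarrow> j < m \<Longrightarrow> i \<noteq> j \<Longrightarrow> p i - p j \<in> R"
  by (simp add: root_simplex_def)

lemma root_simplex_inner:
  assumes "root_simplex p m" "i < m" "j < m" "k < m" "i \<noteq> k" "j \<noteq> k"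
  shows "(p i - p k) \<bullet> (p j - p k) = (if i = j then 2 else 1)"
proof (cases "i = j")
  case True then show ?thesis using root_norm[OF root_simplexD[OF assms(1,2,4,5)]] by simp
next
  case False
  have "(p i - p j) \<bullet> (p i - p j) =
    (p i - p k) \<bullet> (p i - p k) + (p j - p k) \<bullet> (p j - p k) - 2 * ((p i - p k) \<bullet> (p j - p k))"
    by (simp add: inner_diff_left inner_diff_right inner_commute)
  then show ?thesis
    using root_norm[OF root_simplexD[OF assms(1,2,3) False]] root_norm[OF root_simplexD[OF assms(1,2,4,5)]]
      root_norm[OF root_simplexD[OF assms(1,3,4,6)]] False by simp
qed

text \<open>Seen from \<open>p 0\<close>, the other vertices have the identity plus the all-ones
  matrix as Gram matrix, which is non-singular. The bound allows a largest simplex to be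
  chosen.\<close>

lemma root_simplex_card_le:
  assumes s: "root_simplex p m" and "R \<subseteq> span T" "finite T"
  shows "m \<le> card T + 1"
proof -
  define B where "B = (\<lambda>i. p i - p 0) ` {1..<m}"
  have ip: "y \<bullet> z = (if y = z then 2 else 1)" if yz: "y \<in> B" "z \<in> B" for y z
  proof -
    obtain i j where ij: "y = p i - p 0" "z = p j - p 0" "i \<in> {1..<m}" "j \<in> {1..<m}"
      using yz by (auto simp: B_def)
    have "p i \<noteq> p j" if "i \<noteq> j"
    proof
      assume "p i = p j"
      then have "0 \<in> R" using root_simplexD[OF s _ _ that] ij by auto
      then show False using root_norm[of 0] by simp
    qed
    then show ?thesis using root_simplex_inner[OF s, of i j 0] ij by auto
  qed
  have "inj_on (\<lambda>i. p i - p 0) {1..<m}"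
  proof (rule inj_onI, rule ccontr)
    fix i j assume ij: "i \<in> {1..<m}" "j \<in> {1..<m}" "p i - p 0 = p j - p 0" "i \<noteq> j"
    then have "0 \<in> R" using root_simplexD[OF s, of i j] by auto
    then show False using root_norm[of 0] by simp
  qed
  then have card: "card B = m - 1" by (simp add: B_def card_image)
  have finB: "finite B" by (simp add: B_def)
  have "independent B"
  proof (rule independent_if_scalars_zero[OF finB])
    fix f x assume 0: "(\<Sum>x\<in>B. f x *\<^sub>R x) = 0" and x: "x \<in> B"
    define S where "S = (\<Sum>y\<in>B. f y)"
    have fz: "f z = - S" if z: "z \<in> B" for z
    proof -
      have "0 = (\<Sum>y\<in>B. f y *\<^sub>R y) \<bullet> z" by (simp add: 0)
      also have "\<dots> = (\<Sum>y\<in>B. f y + (if y = z then f y else 0))"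
        unfolding inner_sum_left using ip z by (intro sum.cong) auto
      also have "\<dots> = S + f z" using z finB by (simp add: sum.distrib S_def)
      finally show ?thesis by simp
    qed
    have "(\<Sum>y\<in>B. f y) = (\<Sum>y\<in>B. - S)" using fz by (intro sum.cong) auto
    then have "S = (\<Sum>y\<in>B. - S)" by (simp only: S_def[symmetric])
    then have "S * (1 + real (card B)) = 0" by (simp add: algebra_simps)
    moreover have "1 + real (card B) > 0" by (simp add: add_pos_nonneg)
    ultimately have "S = 0" by simp
    then show "f x = 0" using fz[OF x] by simp
  qed
  moreover have "B \<subseteq> span T"
    using root_simplexD[OF s] assms(2) by (auto simp: B_def)
  ultimately have "card B \<le> card T" using independent_span_bound[OF assms(3)] by blast
  then show ?thesis using card by linarith
qed

lemma root_simplex_extend: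
  assumes s: "root_simplex p m" and q: "\<And>i. i < m \<Longrightarrow> p i - q \<in> R"
  shows "root_simplex (p(m := q)) (Suc m)"
proof -
  have "q - p i \<in> R" if "i < m" for i using root_minus[OF q[OF that]] by simp
  then show ?thesis using s q by (auto simp: root_simplex_def less_Suc_eq)
qed

text \<open>Otherwise the inner products of \<open>x\<close> with the vertices take exactly two
  values, differing by 1. A value taken at one vertex only yields a further vertex. If both are
  taken twice, four vertices form a D_3, which \<open>x\<close> extends to a frame of 4
  vectors.\<close>

lemma root_simplex_maximal:
  assumes s: "root_simplex p m" and m: "2 \<le> m" and max: "\<And>p. \<not> root_simplex p (Suc m)" and no4: "\<And>e. \<not> frame e 4"
    and x: "x \<in> R"
  shows "(\<exists>i<m. \<exists>j<m. i \<noteq> j \<and> x = p i - p j) \<or> (\<forall>i<m. \<forall>j<m. x \<bullet> (p i - p j) = 0)"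
proof (rule ccontr)
  assume contra: "\<not> ?thesis"
  define c where "c = (\<lambda>i. x \<bullet> p i)"
  have d: "c i - c j = -1 \<or> c i - c j = 0 \<or> c i - c j = 1" if ij: "i < m" "j < m" for i j
  proof (cases "i = j")
    case False
    have "x \<noteq> p i - p j" using contra that False by blast
    moreover have "x \<noteq> - (p i - p j)"
    proof
      assume "x = - (p i - p j)"
      then have "x = p j - p i" by simp
      then show False using contra that False by metis
    qed
    ultimately show ?thesis
      using root_inner_cases[OF x root_simplexD[OF s that False]] by (auto simp: c_def inner_diff_right)
  qed simp
  obtain i j where ij: "i < m" "j < m" "c i - c j = 1"
  proof -
    from contra obtain i j where *: "i < m" "j < m" "x \<bullet> (p i - p j) \<noteq> 0" by auto
    then have "c i - c j \<noteq> 0" by (simp add: c_def inner_diff_right)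
    with d[OF *(1,2)] have "c i - c j = 1 \<or> c j - c i = 1" by linarith
    then show ?thesis using that * by blast
  qed
  have two: "c k = c i \<or> c k = c j" if "k < m" for k
    using d[OF that ij(1)] d[OF that ij(2)] ij(3) by linarith
  have "\<exists>k<m. k \<noteq> i \<and> c k = c i"
  proof (rule ccontr)
    assume "\<not> ?thesis"
    then have others: "c k = c j" if "k < m" "k \<noteq> i" for k using two that by blast
    \<comment> \<open>The larger value occurs only at \<open>i\<close>, and \<open>p i - x\<close>
      becomes the new vertex.\<close>
    have "p k - (p i - x) \<in> R" if "k < m" for k
    proof (cases "k = i")
      case False
      have "x \<bullet> (p i - p k) = 1" using others[OF that False] ij(3) by (simp add: c_def inner_diff_right)
      then have "x - (p i - p k) \<in> R"
        using root_diff[OF x root_simplexD[OF s ij(1) that False[symmetric]]] by blast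
      then show ?thesis by (simp add: algebra_simps)
    qed (use x in simp)
    from root_simplex_extend[OF s this] max show False by blast
  qed
  then obtain k where k: "k < m" "k \<noteq> i" "c k = c i" by blast
  have "\<exists>l<m. l \<noteq> j \<and> c l = c j"
  proof (rule ccontr)
    assume "\<not> ?thesis"
    then have others: "c k = c i" if "k < m" "k \<noteq> j" for k using two that by blast
    \<comment> \<open>Dually, the smaller value occurs only at \<open>j\<close>, and
      \<open>p j + x\<close> becomes the new vertex.\<close>
    have "p k - (p j + x) \<in> R" if "k < m" for k
    proof (cases "k = j")
      case False
      have "x \<bullet> (p k - p j) = 1" using others[OF that False] ij(3) by (simp add: c_def inner_diff_right)
      then have "- (x - (p k - p j)) \<in> R"
        using root_minus[OF root_diff[OF x root_simplexD[OF s that ij(2) False]]] by blast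
      then show ?thesis by (simp add: algebra_simps)
    qed (use root_minus[OF x] in simp)
    from root_simplex_extend[OF s this] max show False by blast
  qed
  then obtain l where l: "l < m" "l \<noteq> j" "c l = c j" by blast
  have ne: "i \<noteq> j" "i \<noteq> l" "k \<noteq> j" "k \<noteq> l" using ij(3) k(3) l(3) by auto
  define qi qj qk ql where "qi = (1/2) *\<^sub>R p i" and "qj = (1/2) *\<^sub>R p j"
    and "qk = (1/2) *\<^sub>R p k" and "ql = (1/2) *\<^sub>R p l"
  have half: "p i = qi + qi" "p j = qj + qj" "p k = qk + qk" "p l = ql + ql"
    by (simp_all add: qi_def qj_def qk_def ql_def scaleR_add_left[symmetric])
  \<comment> \<open>The three segments joining midpoints of opposite edges of a regular tetrahedron
    are mutually orthogonal. Only the one from edge \<open>j l\<close> to edge \<open>i k\<close> is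
    seen by \<open>x\<close>.\<close>
  define a where "a = qi + qk - qj - ql"
  define b where "b = qi - qk + qj - ql"
  define d where "d = qi - qk - qj + ql"
  have eqs: "a + b = p i - p l" "a - b = p k - p j" "a + d = p i - p j" "a - d = p k - p l"
    "b + d = p i - p k" "b - d = p j - p l"
    unfolding a_def b_def d_def half by simp_all
  have "a + b \<in> R" "a - b \<in> R" "a + d \<in> R" "a - d \<in> R" "b + d \<in> R" "b - d \<in> R"
    unfolding eqs using ij(1,2) k(1,2) l(1,2) ne by (auto intro!: root_simplexD[OF s])
  from frame_3I[OF this] have f: "frame (\<lambda>i. if i = 0 then a else if i = 1 then b else d) 3" .
  have "x \<bullet> a = 1" "x \<bullet> b = 0" "x \<bullet> d = 0"
    using ij(3) k(3) l(3)
    by (simp_all add: a_def b_def d_def qi_def qj_def qk_def ql_def inner_add_right inner_diff_right c_def)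
  then have "frame ((\<lambda>i. if i = 0 then a else if i = 1 then b else d)
      (3 := x - (if (0::nat) = 0 then a else if (0::nat) = 1 then b else d))) (Suc 3)"
    by (intro frame_extend_pos[OF f _ x]) auto
  then show False using no4 by simp
qed

text \<open>The hypothesis \<open>big\<close> says that the rank exceeds 8. Then
  \<open>rank_le_8\<close> gives a largest frame at least 9 vectors, and a half-integral root would
  have norm at least 9/4, so all coordinates are integral. Without a frame of 4 vectors a largest
  simplex already contains all roots.\<close>

theorem root_classification:
  assumes T: "finite T" "R \<subseteq> span T" and "R \<noteq> {}"
    and big: "\<And>T. finite T \<Longrightarrow> R \<subseteq> span T \<Longrightarrow> 8 < card T"
  shows "(\<exists>e r. 9 \<le> r \<and> frame e r \<and> (\<forall>x\<in>R. \<exists>i<r. \<exists>j<r. i \<noteq> j \<and>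
            (\<exists>\<epsilon>\<in>{1, -1}. \<exists>\<delta>\<in>{1, -1}. x = \<epsilon> *\<^sub>R e i + \<delta> *\<^sub>R e j))) \<or>
    (\<exists>p m. 3 \<le> m \<and> root_simplex p m \<and> (\<forall>x\<in>R. \<exists>i<m. \<exists>j<m. i \<noteq> j \<and> x = p i - p j))"
proof (cases "\<exists>e. frame e 4")
  case True
  define P where "P = (\<lambda>r. 4 \<le> r \<and> (\<exists>e. frame e r))"
  have bound: "r \<le> card T" if "P r" for r
    using that frame_card_le[OF _ _ T(2,1)] by (auto simp: P_def)
  define r where "r = (GREATEST r. P r)"
  have "P 4" using True by (simp add: P_def)
  then have "P r" unfolding r_def using bound by (rule GreatestI_nat)
  then obtain e where r: "4 \<le> r" and f: "frame e r" by (auto simp: P_def)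
  have max: "\<not> frame e (Suc r)" for e
  proof
    assume "frame e (Suc r)"
    then have "P (Suc r)" using r by (auto simp: P_def)
    then have "Suc r \<le> r" unfolding r_def using bound by (rule Greatest_le_nat)
    then show False by simp
  qed
  have r9: "9 \<le> r"
  proof (rule ccontr)
    assume "\<not> 9 \<le> r"
    then have "\<exists>T. finite T \<and> card T \<le> 8 \<and> R \<subseteq> span T"
      by (intro rank_le_8[OF f r _ max]) simp
    then obtain T where "finite T" "card T \<le> 8" "R \<subseteq> span T" by blast
    then show False using big[of T] by simp
  qed
  have o: "orthonormal e r" using f by (simp add: frame_def)
  have int: "\<forall>i<r. x \<bullet> e i \<in> \<int>" if x: "x \<in> R" for x
  proof (rule ccontr)
    assume "\<not> ?thesis"
    then have h: "\<forall>i<r. \<bar>x \<bullet> e i\<bar> = 1/2" using frame_coords[OF f _ x] r by auto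
    have "(\<Sum>i<r. (x \<bullet> e i)\<^sup>2) = (\<Sum>i<r. 1/4)"
    proof (rule sum.cong)
      fix i assume "i \<in> {..<r}"
      then have "\<bar>x \<bullet> e i\<bar> = 1/2" using h by simp
      then have "\<bar>x \<bullet> e i\<bar>\<^sup>2 = (1/2)\<^sup>2" by (simp only:)
      then show "(x \<bullet> e i)\<^sup>2 = 1/4" by (simp add: power2_eq_square)
    qed simp
    then have "real r / 4 \<le> 2" using orthonormal_Bessel_le[OF o, of x] root_norm[OF x] by simp
    then show False using r9 by simp
  qed
  have r3: "3 \<le> r" "2 \<le> r" using r by auto
  have span: "R \<subseteq> span (e ` {..<r})"
    using frame_Ints_span'[OF f r3(1) max] int by (intro frame_spans[OF f r3(2)]) blast
  have all: "\<exists>i<r. \<exists>j<r. i \<noteq> j \<and> (\<exists>\<epsilon>\<in>{1, -1}. \<exists>\<delta>\<in>{1, -1}. x = \<epsilon> *\<^sub>R e i + \<delta> *\<^sub>R e j)" if x: "x \<in> R" for x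
  proof -
    have "\<not> (\<forall>i<r. x \<bullet> e i = 0)"
    proof
      assume 0: "\<forall>i<r. x \<bullet> e i = 0"
      have "x \<in> span (e ` {..<r})" using span x by blast
      then have "x \<bullet> x = 0" by (rule inner_zero_on_span[rotated]) (use 0 in auto)
      then show False using root_norm[OF x] by simp
    qed
    then show ?thesis using frame_Ints_span[OF f r3(1) max x int[OF x]] by blast
  qed
  show ?thesis
    by (rule disjI1, rule exI[of _ e], rule exI[of _ r], rule conjI[OF r9 conjI[OF f ballI[OF all]]])
next
  case False
  define P where "P = (\<lambda>m. 2 \<le> m \<and> (\<exists>p. root_simplex p m))"
  have bound: "m \<le> card T + 1" if "P m" for m
    using that root_simplex_card_le[OF _ T(2,1)] by (auto simp: P_def)
  define m where "m = (GREATEST m. P m)"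
  obtain x0 where x0: "x0 \<in> R" using assms(3) by blast
  then have "root_simplex (\<lambda>i. if i = 0 then 0 else x0) 2"
    using root_minus[OF x0] by (auto simp: root_simplex_def)
  then have "P 2" by (auto simp: P_def)
  then have "P m" unfolding m_def using bound by (rule GreatestI_nat)
  then obtain p where m: "2 \<le> m" and s: "root_simplex p m" by (auto simp: P_def)
  have max: "\<not> root_simplex p (Suc m)" for p
  proof
    assume "root_simplex p (Suc m)"
    then have "P (Suc m)" using m by (auto simp: P_def)
    then have "Suc m \<le> m" unfolding m_def using bound by (rule Greatest_le_nat)
    then show False by simp
  qed
  define B where "B = (\<lambda>i. p i - p 0) ` {1..<m}"
  have dB: "p i - p j \<in> span B" if "i < m" "j < m" for i j
  proof -
    have *: "p i - p 0 \<in> span B" if "i < m" for i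
      using that by (cases "i = 0") (auto simp: B_def span_zero intro: span_base)
    show ?thesis using span_diff[OF *[OF that(1)] *[OF that(2)]] by simp
  qed
  note alt = root_simplex_maximal[OF s m max]
  have no4: "\<not> frame e 4" for e using False by blast
  have perp: "\<forall>w\<in>span B. x \<bullet> w = 0" if "\<forall>i<m. \<forall>j<m. x \<bullet> (p i - p j) = 0" for x
  proof
    fix w assume "w \<in> span B"
    moreover have "x \<bullet> y = 0" if "y \<in> B" for y
      using that \<open>\<forall>i<m. _\<close> m by (auto simp: B_def)
    ultimately show "x \<bullet> w = 0" by (rule inner_zero_on_span[rotated])
  qed
  have span: "R \<subseteq> span B"
  proof (rule root_connected[OF subspace_span])
    show "x \<in> span B \<or> (\<forall>w\<in>span B. x \<bullet> w = 0)" if "x \<in> R" for x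
      using alt[OF no4 that] dB perp[of x] by blast
    have "p 1 - p 0 \<in> R" using root_simplexD[OF s] m by auto
    then show "R \<inter> span B \<noteq> {}" using dB[of 1 0] m by auto
  qed
  have all: "\<exists>i<m. \<exists>j<m. i \<noteq> j \<and> x = p i - p j" if x: "x \<in> R" for x
  proof (rule ccontr)
    assume "\<not> ?thesis"
    then have "x \<bullet> x = 0" using alt[OF no4 x] perp[of x] span x by blast
    then show False using root_norm[OF x] by simp
  qed
  have m3: "3 \<le> m"
  proof -
    have "8 < card B" using big[of B] span by (simp add: B_def)
    also have "card B \<le> m" using card_image_le[of "{1..<m}" "\<lambda>i. p i - p 0"] by (simp add: B_def)
    finally show ?thesis by simp
  qed
  show ?thesis
    by (rule disjI2, rule exI[of _ p], rule exI[of _ m], rule conjI[OF m3 conjI[OF s ballI[OF all]]])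
qed

end

section \<open>Isometries of a root set with a cyclic orbit\<close>

text \<open>The sequence repeats up to the factor \<epsilon> and has a single non-zero term per
  period, so multiplying by the denominator leaves just that term.\<close>

lemma fps_geometric_periodic:
  fixes f :: "nat \<Rightarrow> 'a::comm_ring_1"
  assumes "c < n" "\<And>k. k < n \<Longrightarrow> f k = (if k = c then a else 0)" "\<And>k. f (k + n) = \<epsilon> * f k"
  shows "(1 - fps_const \<epsilon> * fps_X ^ n) * Abs_fps f = fps_const a * fps_X ^ c"
proof (rule fps_ext)
  fix k
  have "fps_nth ((1 - fps_const \<epsilon> * fps_X ^ n) * Abs_fps f) k = f k - (if k < n then 0 else \<epsilon> * f (k - n))"
    by (simp add: left_diff_distrib mult.assoc fps_X_power_mult_nth)
  also have "\<dots> = fps_nth (fps_const a * fps_X ^ c) k"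
  proof (cases "k < n")
    case False
    then show ?thesis using assms(1) assms(3)[of "k - n"] by (auto simp: fps_X_power_iff)
  qed (use assms(2) in \<open>auto simp: fps_X_power_iff\<close>)
  finally show "fps_nth ((1 - fps_const \<epsilon> * fps_X ^ n) * Abs_fps f) k = fps_nth (fps_const a * fps_X ^ c) k" .
qed

text \<open>The generating function of the sequence $h_k$, where the value $h_0 = 2$ is halved.\<close>

definition gen :: "(nat \<Rightarrow> real) \<Rightarrow> real fps" where
  "gen h = Abs_fps (\<lambda>k. if k = 0 then 1 else h k)"

text \<open>The generating function for a sum of two orthogonal signed basis vectors lying in one
  cycle of a signed permutation: \<open>n\<close> is the length of the cycle, \<epsilon> the sign
  acquired in going round, \<open>c\<close> the distance between the two vectors and \<eta> their
  relative sign.\<close>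

definition one_cycle :: "real fps \<Rightarrow> bool" where
  "one_cycle H \<longleftrightarrow> (\<exists>n c. 0 < c \<and> c < n \<and> (\<exists>\<epsilon>\<in>{1, -1}. \<exists>\<eta>\<in>{1, -1}.
     (1 - fps_const \<epsilon> * fps_X ^ n) * H =
     (1 + fps_const \<eta> * fps_X ^ c) * (1 + fps_const (\<eta> * \<epsilon>) * fps_X ^ (n - c))))"

text \<open>The two basis vectors lie in different cycles: the function is 1/(1 - \<epsilon> X^n) +
  1/(1 - \<delta> X^m) - 1, multiplied out.\<close>

definition two_cycles :: "real fps \<Rightarrow> bool" where
  "two_cycles H \<longleftrightarrow> (\<exists>n m. 0 < n \<and> 0 < m \<and> (\<exists>\<epsilon>\<in>{1, -1}. \<exists>\<delta>\<in>{1, -1}.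
     (1 - fps_const \<epsilon> * fps_X ^ n) * (1 - fps_const \<delta> * fps_X ^ m) * H =
     1 - fps_const (\<epsilon> * \<delta>) * fps_X ^ (n + m)))"

lemma funpow_mult_period:
  assumes "\<And>x. (g ^^ n) x = x" shows "(g ^^ (n * k)) x = x"
  by (induction k) (simp_all add: funpow_add assms)

lemma factor_identity:
  fixes t e a b :: "'a::comm_ring_1"
  assumes "t * t = 1"
  shows "2 + t * (e * b) + t * a - (1 - e * (a * b)) = (1 + t * a) * (1 + t * e * b)"
proof -
  have "(1 + t * a) * (1 + t * e * b) = 1 + t * (e * b) + t * a + (t * t) * (e * (a * b))"
    by (simp add: algebra_simps)
  then show ?thesis by (simp add: assms)
qed

text \<open>Because of the finite order, the inverse of \<open>g\<close>, which is also its adjoint,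
  is available as the power \<open>g ^^ (N - 1)\<close>.\<close>

locale isometry =
  fixes g :: "'a::real_inner \<Rightarrow> 'a" and N :: nat
  assumes linear_g: "linear g" and inner_g: "g x \<bullet> g y = x \<bullet> y"
    and N_pos: "0 < N" and period: "(g ^^ N) x = x"
begin

lemma linear_pow: "linear (g ^^ k)"
  using linear_compose[OF _ linear_g] by (induction k) (auto simp: linear_id o_def)

lemma inner_pow: "(g ^^ k) x \<bullet> (g ^^ k) y = x \<bullet> y"
  by (induction k) (auto simp: inner_g)

lemma inner_pow_add: "(g ^^ k) x \<bullet> (g ^^ (k + l)) y = x \<bullet> (g ^^ l) y"
  by (simp add: funpow_add inner_pow)

lemma inner_pow_shift: "x \<bullet> (g ^^ k) y = (g ^^ (k * (N - 1))) x \<bullet> y"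
proof -
  have "k * (N - 1) + k = N * k" using N_pos by (cases N) (simp_all add: algebra_simps)
  then have "x \<bullet> (g ^^ k) y = (g ^^ (k * (N - 1))) x \<bullet> (g ^^ (N * k)) y"
    using inner_pow_add[of "k * (N - 1)" x k y] by simp
  then show ?thesis by (simp add: funpow_mult_period[OF period])
qed

end

text \<open>On \<open>B\<close> the map is a signed permutation. The correlations of
  \<open>p + q\<close> split into those of \<open>p\<close>, those of \<open>q\<close> and the cross
  terms; each part is periodic up to sign, and it vanishes or has one non-zero entry per
  period.\<close>

lemma (in isometry) signed_orbits:
  fixes B :: "'a set"
  assumes B1: "\<And>x. x \<in> B \<Longrightarrow> x \<bullet> x = 1"
    and B: "\<And>x y. x \<in> B \<Longrightarrow> y \<in> B \<Longrightarrow> x = y \<and> x \<bullet> y = 1 \<or> x = - y \<and> x \<bullet> y = -1 \<or> x \<bullet> y = 0"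
    and gB: "\<And>x. x \<in> B \<Longrightarrow> g x \<in> B" and p: "p \<in> B" and q: "q \<in> B" and pq: "p \<bullet> q = 0"
  shows "one_cycle (gen (\<lambda>k. (p + q) \<bullet> (g ^^ k) (p + q))) \<or> two_cycles (gen (\<lambda>k. (p + q) \<bullet> (g ^^ k) (p + q)))"
    (is "one_cycle ?H \<or> two_cycles ?H")
proof -
  have powB: "(g ^^ k) x \<in> B" if "x \<in> B" for x k
    by (induction k) (auto simp: that gB)
  have lin: "(g ^^ k) (x + y) = (g ^^ k) x + (g ^^ k) y" "(g ^^ k) (c *\<^sub>R x) = c *\<^sub>R (g ^^ k) x" for k x y c
    using linear_pow[of k] by (auto simp: linear_add linear_scale)
  have orbit: "\<exists>n \<epsilon>. 0 < n \<and> \<epsilon> \<in> {1, -1} \<and> (g ^^ n) x = \<epsilon> *\<^sub>R x \<and> (\<forall>k. 0 < k \<longrightarrow> k < n \<longrightarrow> x \<bullet> (g ^^ k) x = 0)"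
    if x: "x \<in> B" for x
  proof -
    \<comment> \<open>The least such \<open>n\<close> is the first return to the line of
      \<open>x\<close>; the sign of the return is recorded in \<epsilon>.\<close>
    define P where "P = (\<lambda>n. 0 < n \<and> x \<bullet> (g ^^ n) x \<noteq> 0)"
    have "P N" using N_pos period B1[OF x] by (simp add: P_def)
    then have "P (LEAST n. P n)" by (rule LeastI)
    moreover have "\<forall>k. 0 < k \<longrightarrow> k < (LEAST n. P n) \<longrightarrow> x \<bullet> (g ^^ k) x = 0"
      using not_less_Least[of _ P] by (auto simp: P_def)
    moreover have "\<exists>\<epsilon>\<in>{1, -1}. (g ^^ n) x = \<epsilon> *\<^sub>R x" if "P n" for n
      using B[OF x powB[OF x, of n]] that by (auto simp: P_def) (metis minus_minus)
    ultimately show ?thesis unfolding P_def by blast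
  qed
  obtain n \<epsilon> where n: "0 < n" "\<epsilon> \<in> {1, -1}" "(g ^^ n) p = \<epsilon> *\<^sub>R p"
    "\<And>k. 0 < k \<Longrightarrow> k < n \<Longrightarrow> p \<bullet> (g ^^ k) p = 0" using orbit[OF p] by blast
  define \<phi> where "\<phi> = (\<lambda>x k. x \<bullet> (g ^^ k) x)"
  have pp: "p \<bullet> p = 1" and qq: "q \<bullet> q = 1" using B1 p q by auto
  have geo: "(1 - fps_const \<epsilon> * fps_X ^ n) * Abs_fps (\<phi> x) = 1"
    if "0 < n" "(g ^^ n) x = \<epsilon> *\<^sub>R x" "\<And>k. 0 < k \<Longrightarrow> k < n \<Longrightarrow> x \<bullet> (g ^^ k) x = 0" "x \<bullet> x = 1" for x n \<epsilon>
  proof -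
    have "\<phi> x k = (if k = 0 then 1 else 0)" if "k < n" for k
      using that \<open>\<And>k. 0 < k \<Longrightarrow> k < n \<Longrightarrow> x \<bullet> (g ^^ k) x = 0\<close> \<open>x \<bullet> x = 1\<close> by (auto simp: \<phi>_def)
    moreover have "\<phi> x (k + n) = \<epsilon> * \<phi> x k" for k
      by (simp add: \<phi>_def funpow_add that(2) lin)
    ultimately show ?thesis using fps_geometric_periodic[of 0 n "\<phi> x" 1 \<epsilon>] that(1) by simp
  qed
  show ?thesis
  proof (cases "\<exists>k. q \<bullet> (g ^^ k) p \<noteq> 0")
    case False
    then have qp: "q \<bullet> (g ^^ k) p = 0" for k by blast
    then have pq': "p \<bullet> (g ^^ k) q = 0" for k
      by (simp add: inner_pow_shift[of p] inner_commute)
    obtain m \<delta> where m: "0 < m" "\<delta> \<in> {1, -1}" "(g ^^ m) q = \<delta> *\<^sub>R q"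
      "\<And>k. 0 < k \<Longrightarrow> k < m \<Longrightarrow> q \<bullet> (g ^^ k) q = 0" using orbit[OF q] by blast
    \<comment> \<open>Each of the two series has constant term 1, whereas \<open>gen\<close> keeps
      only half of their sum; hence the \<open>- 1\<close>.\<close>
    have H: "?H = Abs_fps (\<phi> p) + Abs_fps (\<phi> q) - 1"
      by (rule fps_ext) (auto simp: gen_def \<phi>_def lin inner_add_left inner_add_right qp pq' pp qq)
    define U V where "U = 1 - fps_const \<epsilon> * fps_X ^ n" and "V = 1 - fps_const \<delta> * fps_X ^ m"
    have UV: "U * Abs_fps (\<phi> p) = 1" "V * Abs_fps (\<phi> q) = 1"
      unfolding U_def V_def using geo[OF n(1,3,4) pp] geo[OF m(1,3,4) qq] by auto
    have "U * V * ?H = V * (U * Abs_fps (\<phi> p)) + U * (V * Abs_fps (\<phi> q)) - U * V"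
      unfolding H by (simp add: algebra_simps)
    also have "\<dots> = 1 - (1 - U) * (1 - V)" unfolding UV by (simp add: algebra_simps)
    also have "(1 - U) * (1 - V) = fps_const (\<epsilon> * \<delta>) * fps_X ^ (n + m)"
      by (simp add: U_def V_def power_add flip: fps_const_mult)
    finally have "two_cycles ?H" unfolding two_cycles_def U_def V_def using n(1,2) m(1,2) by blast
    then show ?thesis ..
  next
    case True
    then obtain k where k: "q \<bullet> (g ^^ k) p \<noteq> 0" by blast
    have per: "(g ^^ (k + n * j)) p = \<epsilon> ^ j *\<^sub>R (g ^^ k) p" for j k
    proof (induction j)
      case (Suc j)
      have "k + n * Suc j = (k + n * j) + n" by simp
      then have "(g ^^ (k + n * Suc j)) p = (g ^^ (k + n * j)) ((g ^^ n) p)"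
        by (simp only: funpow_add[of "k + n * j" n] o_apply)
      then show ?case by (simp add: n(3) lin Suc.IH)
    qed simp
    \<comment> \<open>Up to sign, every power of \<open>g\<close> applied to \<open>p\<close> occurs
      among the first \<open>n\<close>, so \<open>q\<close> is met at an exponent below
      \<open>n\<close>. It is not 0, since \<open>p\<close> and \<open>q\<close> are
      orthogonal.\<close>
    define c where "c = k mod n"
    have c: "c < n" using n(1) by (simp add: c_def)
    have "(g ^^ k) p = \<epsilon> ^ (k div n) *\<^sub>R (g ^^ c) p"
      using per[of c "k div n"] by (simp add: c_def)
    then have "q \<bullet> (g ^^ c) p \<noteq> 0" using k by auto
    then obtain \<eta> where \<eta>: "\<eta> \<in> {1, -1}" "q = \<eta> *\<^sub>R (g ^^ c) p"
      using B[OF q powB[OF p, of c]] by fastforce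
    have c0: "0 < c"
    proof (rule ccontr)
      assume "\<not> 0 < c"
      then have "q = \<eta> *\<^sub>R p" using \<eta> by simp
      then show False using pq pp \<eta>(1) by auto
    qed
    \<comment> \<open>Up to the sign \<eta>, these are the cross correlations of \<open>q\<close>
      with the orbit of \<open>p\<close> and of \<open>p\<close> with the orbit of
      \<open>q\<close>.\<close>
    define \<psi> where "\<psi> = (\<lambda>k. (g ^^ c) p \<bullet> (g ^^ k) p)"
    define \<theta> where "\<theta> = (\<lambda>k. p \<bullet> (g ^^ (k + c)) p)"
    have \<eta>2: "\<eta> * \<eta> = 1" using \<eta>(1) by auto
    have h: "(p + q) \<bullet> (g ^^ k) (p + q) = 2 * \<phi> p k + \<eta> * \<theta> k + \<eta> * \<psi> k" for k
    proof -
      have e: "(g ^^ k) ((g ^^ c) p) = (g ^^ (k + c)) p" by (simp add: funpow_add)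
      have "(g ^^ c) p \<bullet> (g ^^ (k + c)) p = p \<bullet> (g ^^ k) p"
        using inner_pow_add[of c p k p] by (simp add: add.commute)
      moreover have \<eta>\<eta>: "\<eta> * (\<eta> * t) = t" for t using \<eta>2 by (simp flip: mult.assoc)
      ultimately show ?thesis unfolding \<eta>(2)
        by (simp add: lin e \<eta>\<eta> distrib_left inner_add_left inner_add_right \<phi>_def \<psi>_def \<theta>_def)
    qed
    have H: "?H = fps_const 2 * Abs_fps (\<phi> p) + fps_const \<eta> * Abs_fps \<theta> + fps_const \<eta> * Abs_fps \<psi> - 1"
    proof (rule fps_ext)
      fix k
      have "(p + q) \<bullet> (p + q) = 2" using pp qq pq by (simp add: inner_add_left inner_add_right inner_commute)
      then show "fps_nth ?H k = fps_nth (fps_const 2 * Abs_fps (\<phi> p) + fps_const \<eta> * Abs_fps \<theta> + fps_const \<eta> * Abs_fps \<psi> - 1) k"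
        using h[of 0] by (simp add: gen_def h)
    qed
    define U where "U = 1 - fps_const \<epsilon> * fps_X ^ n"
    have U\<phi>: "U * Abs_fps (\<phi> p) = 1" unfolding U_def by (rule geo[OF n(1,3,4) pp])
    have U\<psi>: "U * Abs_fps \<psi> = fps_const 1 * fps_X ^ c" unfolding U_def
    proof (rule fps_geometric_periodic[OF c])
      show "\<psi> (k + n) = \<epsilon> * \<psi> k" for k by (simp add: \<psi>_def funpow_add n(3) lin)
      fix k assume "k < n"
      consider "k < c" | "k = c" | "c < k" by linarith
      then show "\<psi> k = (if k = c then 1 else 0)"
      proof cases
        case 1
        then have "\<psi> k = p \<bullet> (g ^^ (c - k)) p"
          using inner_pow_add[of k p "c - k" p] by (simp add: \<psi>_def inner_commute)
        then show ?thesis using n(4)[of "c - k"] 1 c by simp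
      next
        case 2
        then show ?thesis using inner_pow[of c p p] pp by (simp add: \<psi>_def)
      next
        case 3
        then have "\<psi> k = p \<bullet> (g ^^ (k - c)) p"
          using inner_pow_add[of c p "k - c" p] by (simp add: \<psi>_def)
        then show ?thesis using n(4)[of "k - c"] 3 \<open>k < n\<close> by simp
      qed
    qed
    have U\<theta>: "U * Abs_fps \<theta> = fps_const \<epsilon> * fps_X ^ (n - c)" unfolding U_def
    proof (rule fps_geometric_periodic)
      show "n - c < n" using c c0 by simp
      show "\<theta> (k + n) = \<epsilon> * \<theta> k" for k
        using per[of "k + c" 1] by (simp add: \<theta>_def add.commute add.left_commute)
      fix k assume "k < n"
      consider "k + c < n" | "k + c = n" | "n < k + c" by linarith
      then show "\<theta> k = (if k = n - c then \<epsilon> else 0)"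
      proof cases
        case 1 then show ?thesis using n(4)[of "k + c"] c0 by (simp add: \<theta>_def)
      next
        case 2
        then have "\<theta> k = \<epsilon>" using n(3) pp by (simp add: \<theta>_def)
        then show ?thesis using 2 by auto
      next
        case 3
        define j where "j = k + c - n"
        have j: "k + c = j + n * 1" "0 < j" "j < n" using 3 c \<open>k < n\<close> by (auto simp: j_def)
        have "\<theta> k = 0" using per[of j 1] n(4)[OF j(2,3)] unfolding \<theta>_def j(1) by simp
        moreover have "k \<noteq> n - c" using 3 c by linarith
        ultimately show ?thesis by simp
      qed
    qed
    have "U * ?H = fps_const 2 * (U * Abs_fps (\<phi> p)) + fps_const \<eta> * (U * Abs_fps \<theta>) + fps_const \<eta> * (U * Abs_fps \<psi>) - U"
      unfolding H by (simp add: algebra_simps)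
    also have "\<dots> = 2 + fps_const \<eta> * (fps_const \<epsilon> * fps_X ^ (n - c)) + fps_const \<eta> * fps_X ^ c
        - (1 - fps_const \<epsilon> * (fps_X ^ c * fps_X ^ (n - c)))"
    proof -
      have "fps_X ^ n = fps_X ^ c * (fps_X ^ (n - c) :: real fps)" using c by (simp flip: power_add)
      then show ?thesis unfolding U\<phi> U\<psi> U\<theta> unfolding U_def by (simp add: numeral_fps_const)
    qed
    also have "\<dots> = (1 + fps_const \<eta> * fps_X ^ c) * (1 + fps_const \<eta> * fps_const \<epsilon> * fps_X ^ (n - c))"
      by (rule factor_identity) (simp add: \<eta>2)
    also have "fps_const \<eta> * fps_const \<epsilon> = fps_const (\<eta> * \<epsilon>)" by simp
    finally have "one_cycle ?H" unfolding one_cycle_def U_def using n(2) \<eta>(1) c c0 by blast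
    then show ?thesis ..
  qed
qed

text \<open>A linear map sending the basis vectors into this set acts as a signed
  permutation.\<close>

definition signed_frame :: "(nat \<Rightarrow> 'a::real_inner) \<Rightarrow> nat \<Rightarrow> 'a set" where
  "signed_frame e r = {\<epsilon> *\<^sub>R e i | \<epsilon> i. i < r \<and> \<epsilon> \<in> {1, -1}}"

lemma signed_frameI: "i < r \<Longrightarrow> \<epsilon> \<in> {1, -1} \<Longrightarrow> \<epsilon> *\<^sub>R e i \<in> signed_frame e r"
  unfolding signed_frame_def by blast

lemma signed_frameE:
  assumes "x \<in> signed_frame e r"
  obtains i \<epsilon> where "i < r" "\<epsilon> \<in> {1, -1}" "x = \<epsilon> *\<^sub>R e i"
  using assms unfolding signed_frame_def by blast

lemma signed_frame_inner:
  assumes e: "orthonormal e r" and x: "x \<in> signed_frame e r" and y: "y \<in> signed_frame e r"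
  shows "x = y \<and> x \<bullet> y = 1 \<or> x = - y \<and> x \<bullet> y = -1 \<or> x \<bullet> y = 0"
proof -
  obtain i \<epsilon> where i: "i < r" "\<epsilon> \<in> {1, -1}" "x = \<epsilon> *\<^sub>R e i" using x by (rule signed_frameE)
  obtain j \<delta> where j: "j < r" "\<delta> \<in> {1, -1}" "y = \<delta> *\<^sub>R e j" using y by (rule signed_frameE)
  have "e i \<bullet> e j = (if i = j then 1 else 0)" using e i(1) j(1) by (simp add: orthonormal_def)
  then show ?thesis using i(2) j(2) unfolding i(3) j(3) by (cases "i = j") auto
qed

lemma signed_frame_norm:
  assumes e: "orthonormal e r" and x: "x \<in> signed_frame e r" shows "x \<bullet> x = 1"
proof -
  obtain i \<epsilon> where i: "i < r" "\<epsilon> \<in> {1, -1}" "x = \<epsilon> *\<^sub>R e i" using x by (rule signed_frameE)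
  have "e i \<bullet> e i = 1" using e i(1) by (simp add: orthonormal_def)
  then show ?thesis using i(2) unfolding i(3) by auto
qed

lemma signed_frame_linear:
  assumes g: "linear g" "\<And>i. i < r \<Longrightarrow> g (e i) \<in> signed_frame e r" and x: "x \<in> signed_frame e r"
  shows "g x \<in> signed_frame e r"
proof -
  obtain i \<epsilon> where i: "i < r" "\<epsilon> \<in> {1, -1}" "x = \<epsilon> *\<^sub>R e i" using x by (rule signed_frameE)
  obtain j \<delta> where j: "j < r" "\<delta> \<in> {1, -1}" "g (e i) = \<delta> *\<^sub>R e j" using g(2)[OF i(1)] by (rule signed_frameE)
  have "g x = (\<epsilon> * \<delta>) *\<^sub>R e j" using linear_scale[OF g(1), of \<epsilon> "e i"] i(3) j(3) by simp
  moreover have "\<epsilon> * \<delta> \<in> {1, -1}" using i(2) j(2) by auto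
  ultimately show ?thesis using signed_frameI[OF j(1)] by metis
qed

section \<open>The root system generated by one orbit\<close>

text \<open>\<open>primitive\<close> says that the exponents with non-zero correlation have no
  common divisor other than 1; it is the source of irreducibility. \<open>rank\<close> says that the
  orbit spans more than 8 dimensions.\<close>

locale cyclic_root = isometry +
  fixes v :: "'a::real_inner"
  assumes v_norm: "v \<bullet> v = 2" and v_Ints: "v \<bullet> (g ^^ k) v \<in> \<int>"
    and primitive: "(\<And>k. v \<bullet> (g ^^ k) v \<noteq> 0 \<Longrightarrow> d dvd k) \<Longrightarrow> d = 1"
    and rank: "finite T \<Longrightarrow> (\<And>k. (g ^^ k) v \<in> span T) \<Longrightarrow> 8 < card T"
begin

inductive_set L :: "'a set" where
  L_zero: "0 \<in> L"
| L_add: "x \<in> L \<Longrightarrow> x + (g ^^ k) v \<in> L"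
| L_diff: "x \<in> L \<Longrightarrow> x - (g ^^ k) v \<in> L"

lemma L_gen: "(g ^^ k) v \<in> L"
  using L_add[OF L_zero, of k] by simp

lemma L_plus: "y \<in> L \<Longrightarrow> x \<in> L \<Longrightarrow> x + y \<in> L"
proof (induction rule: L.induct)
  case (L_add y k)
  then show ?case using L.L_add[of "x + y" k] by (simp add: add.assoc)
next
  case (L_diff y k)
  then show ?case using L.L_diff[of "x + y" k] by (simp add: algebra_simps)
qed simp

lemma L_uminus: "y \<in> L \<Longrightarrow> - y \<in> L"
proof (induction rule: L.induct)
  case (L_add y k)
  then show ?case using L.L_diff[of "- y" k] by (simp add: algebra_simps)
next
  case (L_diff y k)
  then show ?case using L.L_add[of "- y" k] by (simp add: algebra_simps)
qed (simp add: L_zero)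

lemma L_minus: "x \<in> L \<Longrightarrow> y \<in> L \<Longrightarrow> x - y \<in> L"
  using L_plus[OF L_uminus, of y x] by simp

lemma pow_linear: "(g ^^ k) (x + y) = (g ^^ k) x + (g ^^ k) y" "(g ^^ k) (x - y) = (g ^^ k) x - (g ^^ k) y"
  "(g ^^ k) 0 = 0"
  using linear_pow[of k] by (auto simp: linear_add linear_diff linear_0)

lemma L_pow: "x \<in> L \<Longrightarrow> (g ^^ k) x \<in> L"
proof (induction rule: L.induct)
  case (L_add y l)
  then show ?case using L.L_add[of "(g ^^ k) y" "k + l"] by (simp add: pow_linear funpow_add)
next
  case (L_diff y l)
  then show ?case using L.L_diff[of "(g ^^ k) y" "k + l"] by (simp add: pow_linear funpow_add)
qed (simp add: L_zero pow_linear)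

lemma gen_Ints: "(g ^^ k) v \<bullet> (g ^^ l) v \<in> \<int>"
proof -
  have *: "(g ^^ k) v \<bullet> (g ^^ (k + m)) v \<in> \<int>" for k m by (simp add: inner_pow_add v_Ints)
  show ?thesis
  proof (cases "k \<le> l")
    case True then show ?thesis using *[of k "l - k"] by simp
  next
    case False then show ?thesis using *[of l "k - l"] by (simp add: inner_commute)
  qed
qed

lemma gen_L_Ints: "x \<in> L \<Longrightarrow> (g ^^ k) v \<bullet> x \<in> \<int>"
  by (induction rule: L.induct) (auto simp: inner_add_right inner_diff_right gen_Ints)

lemma L_Ints: "x \<in> L \<Longrightarrow> y \<in> L \<Longrightarrow> x \<bullet> y \<in> \<int>"
  by (induction rule: L.induct) (auto simp: inner_add_left inner_diff_left gen_L_Ints)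

lemma L_subspace:
  assumes "subspace W" "\<And>k. (g ^^ k) v \<in> W" shows "L \<subseteq> W"
proof
  fix x assume "x \<in> L"
  then show "x \<in> W"
    by (induction rule: L.induct) (auto simp: assms subspace_0 subspace_add subspace_diff)
qed

definition R :: "'a set" where "R = {x \<in> L. x \<bullet> x = 2}"

lemma R_gen: "(g ^^ k) v \<in> R"
  by (simp add: R_def L_gen inner_pow v_norm)

text \<open>Orbit vectors with non-zero inner product lie in \<open>W\<close> together. Hence every
  exponent with non-zero correlation belongs to the set \<open>D\<close> of shifts that preserve
  membership in \<open>W\<close>. The least positive element of \<open>D\<close> divides all of
  \<open>D\<close>, so \<open>primitive\<close> makes it 1 and the whole orbit lies in
  \<open>W\<close>.\<close>

lemma R_connected:
  assumes W: "subspace W" and alt: "\<And>x. x \<in> R \<Longrightarrow> x \<in> W \<or> (\<forall>w\<in>W. x \<bullet> w = 0)" and ne: "R \<inter> W \<noteq> {}"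
  shows "R \<subseteq> W"
proof -
  let ?v = "\<lambda>k. (g ^^ k) v"
  have per: "?v (k + N * j) = ?v k" for k j
    by (simp add: funpow_add funpow_mult_period[OF period])
  \<comment> \<open>Otherwise the entire lattice would be orthogonal to \<open>W\<close>, including
    the root that lies in \<open>W\<close>.\<close>
  have "\<exists>k. ?v k \<in> W"
  proof (rule ccontr)
    assume "\<not> ?thesis"
    then have perp: "\<forall>w\<in>W. ?v k \<bullet> w = 0" for k using alt[OF R_gen[of k]] by blast
    obtain x where x: "x \<in> R" "x \<in> W" using ne by blast
    have "y \<bullet> x = 0" if "y \<in> L" for y
      using that by (induction rule: L.induct) (auto simp: inner_add_left inner_diff_left perp x(2))
    then show False using x(1) by (auto simp: R_def)
  qed
  then obtain k0 where k0: "?v k0 \<in> W" by blast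
  define D where "D = {s. \<forall>k. ?v k \<in> W \<longrightarrow> ?v (k + s) \<in> W}"
  have D_add: "s + t \<in> D" if "s \<in> D" "t \<in> D" for s t
    using that by (auto simp: D_def simp flip: add.assoc)
  have D_N: "N * j \<in> D" for j by (auto simp: D_def per)
  have D_mult: "s * j \<in> D" if "s \<in> D" for s j
    by (induction j) (use that D_add D_N[of 0] in auto)
  have D_h: "s \<in> D" if "v \<bullet> ?v s \<noteq> 0" for s
    unfolding D_def
  proof (intro CollectI allI impI)
    fix k assume k: "?v k \<in> W"
    have "?v (k + s) \<bullet> ?v k \<noteq> 0" using inner_pow_add[of k v s v] that by (simp add: inner_commute)
    then show "?v (k + s) \<in> W" using alt[OF R_gen[of "k + s"]] k by blast
  qed
  define d where "d = (LEAST d. d \<in> D \<and> 0 < d)"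
  have "N \<in> D \<and> 0 < N" using D_N[of 1] N_pos by simp
  then have d: "d \<in> D \<and> 0 < d" unfolding d_def by (rule LeastI)
  have least: "\<not> (s \<in> D \<and> 0 < s)" if "s < d" for s using that not_less_Least unfolding d_def by blast
  have dvd: "d dvd s" if s: "s \<in> D" for s
  proof -
    have "s mod d \<in> D"
      unfolding D_def
    proof (intro CollectI allI impI)
      fix k assume k: "?v k \<in> W"
      \<comment> \<open>As \<open>N\<close> is a period, shifting by \<open>q * (N - 1)\<close>
        undoes a shift by \<open>q\<close>; this is how \<open>D\<close> becomes closed under
        subtraction.\<close>
      define q where "q = d * (s div d)"
      have q: "q * (N - 1) \<in> D" using D_mult[of d "s div d * (N - 1)"] d by (simp add: q_def mult.assoc)
      have "q * (N - 1) + q = N * q" using N_pos by (cases N) (simp_all add: algebra_simps)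
      moreover have "s mod d + q = s" by (simp add: q_def)
      ultimately have "k + (s + q * (N - 1)) = (k + s mod d) + N * q" by linarith
      then have "?v (k + (s + q * (N - 1))) = ?v (k + s mod d)" using per by metis
      then show "?v (k + s mod d) \<in> W" using D_add[OF s q] k unfolding D_def by auto
    qed
    then have "s mod d = 0" using least[of "s mod d"] d by auto
    then show ?thesis by auto
  qed
  have "d = 1" using dvd D_h by (intro primitive) blast
  then have D1: "j \<in> D" for j using D_mult[of 1 j] d by simp
  have "?v k \<in> W" for k
  proof -
    have "?v (k0 + (k + k0 * (N - 1))) \<in> W" using D1[of "k + k0 * (N - 1)"] k0 by (auto simp: D_def)
    moreover have "k0 + (k + k0 * (N - 1)) = k + N * k0" using N_pos by (cases N) (simp_all add: algebra_simps)
    ultimately show ?thesis using per by metis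
  qed
  then have "L \<subseteq> W" by (rule L_subspace[OF W])
  then show ?thesis by (auto simp: R_def)
qed

sublocale root_set R
proof
  show "x \<bullet> x = 2" if "x \<in> R" for x using that by (simp add: R_def)
  show "- x \<in> R" if "x \<in> R" for x using that by (simp add: R_def L_uminus)
  show "x \<bullet> y \<in> \<int>" if "x \<in> R" "y \<in> R" for x y using that by (simp add: R_def L_Ints)
  show "x - y \<in> R" if "x \<in> R" "y \<in> R" "x \<bullet> y = 1" for x y
    using that by (simp add: R_def L_minus inner_diff_left inner_diff_right inner_commute)
  show "R \<subseteq> W" if "subspace W" "\<And>x. x \<in> R \<Longrightarrow> x \<in> W \<or> (\<forall>w\<in>W. x \<bullet> w = 0)" "R \<inter> W \<noteq> {}" for W
    using R_connected[OF that] .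
qed

lemma pow_R: "x \<in> R \<Longrightarrow> (g ^^ k) x \<in> R"
  by (simp add: R_def L_pow inner_pow)

lemma g_adjoint: "g x \<bullet> y = x \<bullet> (g ^^ (N - 1)) y"
proof -
  have "(g ^^ (N - 1)) (g x) = x" using period[of x] N_pos by (cases N) (simp_all add: funpow_swap1)
  then show ?thesis using inner_pow[of "N - 1" "g x" y] by simp
qed

lemma g_span_R: "x \<in> span R \<Longrightarrow> g x \<in> span R"
proof -
  assume "x \<in> span R"
  then have "g x \<in> g ` span R" by blast
  also have "g ` span R = span (g ` R)" by (rule linear_span_image[OF linear_g, symmetric])
  also have "\<dots> \<subseteq> span R" using pow_R[of _ 1] by (intro span_mono) auto
  finally show ?thesis .
qed

abbreviation H :: "real fps" where "H \<equiv> gen (\<lambda>k. v \<bullet> (g ^^ k) v)"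

text \<open>The adjoint of \<open>g\<close> maps roots to roots, so \<open>g (e i)\<close> is a unit
  vector with integral inner products with all roots. Its coordinates are then all integral or all
  half-odd; the former makes it a signed basis vector.\<close>

lemma frame_cycles:
  assumes r: "9 \<le> r" and f: "frame e r"
    and all: "\<forall>x\<in>R. \<exists>i<r. \<exists>j<r. i \<noteq> j \<and> (\<exists>\<epsilon>\<in>{1, -1}. \<exists>\<delta>\<in>{1, -1}. x = \<epsilon> *\<^sub>R e i + \<delta> *\<^sub>R e j)"
  shows "one_cycle H \<or> two_cycles H"
proof -
  have o: "orthonormal e r" using f by (simp add: frame_def)
  have fi: "e i \<bullet> e j = (if i = j then 1 else 0)" if "i < r" "j < r" for i j
    using frame_inner[OF f that] .
  have span: "R \<subseteq> span (e ` {..<r})"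
  proof
    fix x assume "x \<in> R"
    with all obtain i j \<epsilon> \<delta> where "i < r" "j < r" "x = \<epsilon> *\<^sub>R e i + \<delta> *\<^sub>R e j" by blast
    then show "x \<in> span (e ` {..<r})" by (auto intro!: span_add span_scale intro: span_base)
  qed
  have ge: "g (e i) \<in> signed_frame e r" if i: "i < r" for i
  proof -
    define y where "y = g (e i)"
    have yy: "y \<bullet> y = 1" using fi[OF i i] by (simp add: y_def inner_g)
    have yR: "y \<bullet> z \<in> \<int>" if "z \<in> R" for z
    proof -
      have "(g ^^ (N - 1)) z \<in> R" using pow_R[OF that] .
      with all obtain a b \<epsilon> \<delta> where "a < r" "b < r" "\<epsilon> \<in> {1, -1}" "\<delta> \<in> {1, -1}"
        "(g ^^ (N - 1)) z = \<epsilon> *\<^sub>R e a + \<delta> *\<^sub>R e b" by blast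
      then show ?thesis by (auto simp: y_def g_adjoint inner_add_right fi i)
    qed
    have "y \<in> span R" unfolding y_def using frame_in_span[OF f _ i] r by (intro g_span_R) auto
    then have ys: "y \<in> span (e ` {..<r})" using span by (metis span_mono span_span subsetD)
    have ysum: "1 = (\<Sum>a<r. (y \<bullet> e a)\<^sup>2)"
    proof -
      define p where "p = (\<Sum>a<r. (y \<bullet> e a) *\<^sub>R e a)"
      have "y - p \<in> span (e ` {..<r})" unfolding p_def
        by (intro span_diff ys span_sum span_scale span_base) auto
      moreover have "(y - p) \<bullet> w = 0" if "w \<in> e ` {..<r}" for w
        using that orthonormal_inner_sum[OF o] by (auto simp: p_def inner_diff_left)
      ultimately have "(y - p) \<bullet> (y - p) = 0" using inner_zero_on_span by blast
      then show ?thesis using orthonormal_Bessel[OF o, of y] yy unfolding p_def by simp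
    qed
    have pm: "y \<bullet> e a + y \<bullet> e b \<in> \<int>" "y \<bullet> e a - y \<bullet> e b \<in> \<int>" if "a < r" "b < r" "a \<noteq> b" for a b
      using yR[of "e a + e b"] yR[of "e a - e b"] f that
      by (auto simp: frame_def inner_add_right inner_diff_right)
    have double: "2 * (y \<bullet> e a) \<in> \<int>" if a: "a < r" for a
    proof -
      define b :: nat where "b = (if a = 0 then 1 else 0)"
      have b: "b < r" "a \<noteq> b" using r by (auto simp: b_def)
      have "(y \<bullet> e a + y \<bullet> e b) + (y \<bullet> e a - y \<bullet> e b) \<in> \<int>" by (rule Ints_add[OF pm[OF a b]])
      then show ?thesis by simp
    qed
    have int: "y \<bullet> e a \<in> \<int>" if a: "a < r" for a
    proof (rule ccontr)
      assume na: "y \<bullet> e a \<notin> \<int>"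
      \<comment> \<open>Half-odd coordinates would give norm at least 9/4 instead of 1. With four
        basis vectors the bound would be 1 and not be violated, which is triality again.\<close>
      have "1/4 \<le> (y \<bullet> e b)\<^sup>2" if b: "b < r" for b
      proof -
        have "y \<bullet> e b \<noteq> 0"
        proof
          assume "y \<bullet> e b = 0"
          then show False using pm(1)[OF a b] na by (cases "a = b") auto
        qed
        then have "1 \<le> \<bar>2 * (y \<bullet> e b)\<bar>" using double[OF b] by (intro Ints_abs_ge_1) auto
        then have "(1/2)\<^sup>2 \<le> \<bar>y \<bullet> e b\<bar>\<^sup>2" by (intro power_mono) auto
        then show ?thesis by (simp add: power2_eq_square)
      qed
      then have "(\<Sum>b<r. 1/4) \<le> (\<Sum>a<r. (y \<bullet> e a)\<^sup>2)" by (intro sum_mono) auto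
      then show False using ysum r by simp
    qed
    obtain a where a: "a < r" "y \<bullet> e a \<noteq> 0"
    proof (rule ccontr)
      assume "\<not> thesis"
      then have "y \<bullet> e a = 0" if "a < r" for a using that \<open>\<not> thesis\<close> \<open>\<And>a. a < r \<Longrightarrow> y \<bullet> e a \<noteq> 0 \<Longrightarrow> thesis\<close> by blast
      then show False using ysum by simp
    qed
    have "1 \<le> \<bar>y \<bullet> e a\<bar>" using int[OF a(1)] a(2) by (rule Ints_abs_ge_1)
    moreover have "(y \<bullet> e a)\<^sup>2 \<le> 1"
      using orthonormal_Bessel_le[OF o, of y] member_le_sum[of a "{..<r}" "\<lambda>a. (y \<bullet> e a)\<^sup>2"] a(1) yy by simp
    then have "\<bar>y \<bullet> e a\<bar> \<le> 1" by (simp add: abs_square_le_1)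
    ultimately have \<epsilon>: "y \<bullet> e a = 1 \<or> y \<bullet> e a = -1" by linarith
    have "(y - (y \<bullet> e a) *\<^sub>R e a) \<bullet> (y - (y \<bullet> e a) *\<^sub>R e a) = 0"
      using \<epsilon> yy fi[OF a(1) a(1)] by (auto simp: inner_diff_left inner_diff_right inner_add_left inner_add_right inner_commute[of "e a" y])
    then have "y = (y \<bullet> e a) *\<^sub>R e a" by simp
    moreover have "(y \<bullet> e a) *\<^sub>R e a \<in> signed_frame e r" using \<epsilon> a(1) by (intro signed_frameI) auto
    ultimately show ?thesis unfolding y_def[symmetric] by simp
  qed
  have "v \<in> R" using R_gen[of 0] by simp
  from bspec[OF all this]
  obtain i j \<epsilon> \<delta> where v: "i < r" "j < r" "i \<noteq> j" "\<epsilon> \<in> {1, -1}" "\<delta> \<in> {1, -1}" "v = \<epsilon> *\<^sub>R e i + \<delta> *\<^sub>R e j"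
    by blast
  show ?thesis unfolding v(6)
  proof (rule signed_orbits[where B = "signed_frame e r"])
    show "\<epsilon> *\<^sub>R e i \<bullet> \<delta> *\<^sub>R e j = 0" using fi v(1-3) by simp
    show "\<epsilon> *\<^sub>R e i \<in> signed_frame e r" "\<delta> *\<^sub>R e j \<in> signed_frame e r" by (intro signed_frameI v)+
    show "g x \<in> signed_frame e r" if "x \<in> signed_frame e r" for x
      using linear_g ge that by (rule signed_frame_linear)
  qed (fact signed_frame_norm[OF o] signed_frame_inner[OF o])+
qed

end

context cyclic_root begin

text \<open>Up to a common sign, an isometry of A_{m-1} permutes the vertices of the simplex centred
  at the origin. These vertices are not orthogonal, but they become an orthonormal family once a
  constant real coordinate is appended.\<close>

lemma simplex_cycles:
  assumes m: "3 \<le> m" and s: "root_simplex p m"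
    and all: "\<forall>x\<in>R. \<exists>i<m. \<exists>j<m. i \<noteq> j \<and> x = p i - p j"
  shows "one_cycle H \<or> two_cycles H"
proof -
  define \<delta> where "\<delta> = (\<lambda>i j::nat. if i = j then 1 else 0 :: real)"
  have dist: "(p i - p j) \<bullet> (p i - p j) = 2 - 2 * \<delta> i j" if "i < m" "j < m" for i j
    using root_norm[OF root_simplexD[OF s that]] by (auto simp: \<delta>_def)
  have pp: "(p i - p j) \<bullet> (p a - p b) = \<delta> i a - \<delta> i b - \<delta> j a + \<delta> j b"
    if "i < m" "j < m" "a < m" "b < m" for i j a b
  proof -
    have "2 * ((p i - p j) \<bullet> (p a - p b)) = (p i - p b) \<bullet> (p i - p b) + (p j - p a) \<bullet> (p j - p a)
        - (p i - p a) \<bullet> (p i - p a) - (p j - p b) \<bullet> (p j - p b)"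
      by (simp add: inner_diff_left inner_diff_right inner_commute)
    then show ?thesis unfolding dist[OF that(1,4)] dist[OF that(2,3)] dist[OF that(1,3)] dist[OF that(2,4)]
      by simp
  qed
  define c where "c = (1 / real m) *\<^sub>R (\<Sum>k<m. p k)"
  define x where "x = (\<lambda>i. p i - c)"
  have m0: "real m \<noteq> 0" using m by simp
  have sum\<delta>: "(\<Sum>k<m. \<delta> k a) = 1" "(\<Sum>k<m. \<delta> a k) = 1" if "a < m" for a
    using that by (auto simp: \<delta>_def)
  have x_sum: "x i = (1 / real m) *\<^sub>R (\<Sum>k<m. p i - p k)" for i
    using m0 by (simp add: x_def c_def sum_subtractf scaleR_diff_right sum_constant_scaleR)
  have xd: "x i - x j = p i - p j" for i j by (simp add: x_def)
  have xp: "x i \<bullet> (p a - p b) = \<delta> i a - \<delta> i b" if "i < m" "a < m" "b < m" for i a b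
  proof -
    have "(\<Sum>k<m. p i - p k) \<bullet> (p a - p b) = (\<Sum>k<m. \<delta> i a - \<delta> i b - \<delta> k a + \<delta> k b)"
      unfolding inner_sum_left using that by (intro sum.cong) (auto simp: pp)
    also have "\<dots> = real m * (\<delta> i a - \<delta> i b)"
      using that by (simp add: sum.distrib sum_subtractf sum\<delta> algebra_simps)
    finally show ?thesis unfolding x_sum using m0 by simp
  qed
  have xx: "x i \<bullet> x j = \<delta> i j - 1 / real m" if "i < m" "j < m" for i j
  proof -
    have "x i \<bullet> (\<Sum>k<m. p j - p k) = (\<Sum>k<m. \<delta> i j - \<delta> i k)"
      unfolding inner_sum_right using that by (intro sum.cong) (auto simp: xp)
    also have "\<dots> = real m * \<delta> i j - 1" using that by (simp add: sum_subtractf sum\<delta>)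
    finally show ?thesis unfolding x_sum[of j] using m0 by (simp add: field_simps)
  qed
  have x_total: "(\<Sum>k<m. x k) = 0"
    using m0 by (simp add: x_def c_def sum_subtractf sum_constant_scaleR)
  have root: "p a - p b \<in> R" if "a < m" "b < m" "a \<noteq> b" for a b
    using root_simplexD[OF s that] .
  have dspan: "p a - p b \<in> span R" if "a < m" "b < m" for a b
    using root[OF that] by (cases "a = b") (auto simp: span_zero intro: span_base)
  have xspan: "x i \<in> span R" if "i < m" for i
    unfolding x_sum using that by (intro span_scale span_sum dspan) auto
  have zero: "w = 0" if w: "w \<in> span R" "\<And>a b. a < m \<Longrightarrow> b < m \<Longrightarrow> w \<bullet> (p a - p b) = 0" for w
  proof -
    have "w \<bullet> z = 0" if zR: "z \<in> R" for z
    proof -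
      from bspec[OF all zR] obtain a b where "a < m" "b < m" "z = p a - p b" by blast
      then show ?thesis using w(2) by simp
    qed
    then have "w \<bullet> w = 0" using inner_zero_on_span[OF _ w(1)] by blast
    then show ?thesis by simp
  qed
  have gx: "\<exists>a<m. \<exists>\<epsilon>\<in>{1, -1}. g (x i) = \<epsilon> *\<^sub>R x a" if i: "i < m" for i
  proof -
    define y where "y = g (x i)"
    have ys: "y \<in> span R" unfolding y_def using xspan[OF i] by (rule g_span_R)
    have yy: "y \<bullet> y = 1 - 1 / real m" using xx[OF i i] by (simp add: y_def inner_g \<delta>_def)
    have yd: "y \<bullet> p a - y \<bullet> p b \<in> {-1, 0, 1}" if ab: "a < m" "b < m" for a b
    proof (cases "a = b")
      case False
      have "(g ^^ (N - 1)) (p a - p b) \<in> R" using pow_R[OF root[OF ab False]] .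
      then obtain a' b' where "a' < m" "b' < m" "(g ^^ (N - 1)) (p a - p b) = p a' - p b'"
        using all by blast
      then have "y \<bullet> (p a - p b) = \<delta> i a' - \<delta> i b'" unfolding y_def g_adjoint using xp[OF i] by simp
      then show ?thesis by (auto simp: inner_diff_right \<delta>_def split: if_splits)
    qed simp
    \<comment> \<open>On the vertices \<open>y\<close> takes at most two values, differing by 1;
      \<open>S\<close> is where the larger one is taken.\<close>
    define M where "M = Max ((\<lambda>a. y \<bullet> p a) ` {..<m})"
    define S where "S = {a. a < m \<and> y \<bullet> p a = M}"
    have fin: "finite S" by (simp add: S_def)
    have M_ge: "y \<bullet> p a \<le> M" if "a < m" for a unfolding M_def using that by (intro Max_ge) auto
    have "M \<in> (\<lambda>a. y \<bullet> p a) ` {..<m}" unfolding M_def using m by (intro Max_in) (auto simp: lessThan_empty_iff)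
    then obtain a0 where a0: "a0 < m" "y \<bullet> p a0 = M" by auto
    have yS: "y \<bullet> p a = M - (if a \<in> S then 0 else 1)" if a: "a < m" for a
      using yd[OF a0(1) a] a0(2) M_ge[OF a] a by (auto simp: S_def)
    have \<delta>S: "(\<Sum>k\<in>S. \<delta> k a) = (if a \<in> S then 1 else 0)" for a
      using fin by (simp add: \<delta>_def)
    \<comment> \<open>Both sides lie in the span of the roots and have the same inner product with
      every difference of vertices.\<close>
    have y_eq: "y = (\<Sum>k\<in>S. x k)"
    proof -
      have "y - (\<Sum>k\<in>S. x k) = 0"
      proof (rule zero)
        show "y - (\<Sum>k\<in>S. x k) \<in> span R"
          by (intro span_diff ys span_sum xspan) (simp add: S_def)
        fix a b assume ab: "a < m" "b < m"
        have "(\<Sum>k\<in>S. x k) \<bullet> (p a - p b) = (\<Sum>k\<in>S. \<delta> k a - \<delta> k b)"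
          unfolding inner_sum_left using ab by (intro sum.cong) (auto simp: xp S_def)
        then show "(y - (\<Sum>k\<in>S. x k)) \<bullet> (p a - p b) = 0"
          using yS[OF ab(1)] yS[OF ab(2)] by (simp add: inner_diff_left inner_diff_right[of y] sum_subtractf \<delta>S)
      qed
      then show ?thesis by simp
    qed
    define t where "t = real (card S)"
    have "y \<bullet> y = (\<Sum>k\<in>S. \<Sum>l\<in>S. \<delta> l k - 1 / real m)"
      unfolding y_eq inner_sum_left inner_sum_right by (intro sum.cong) (auto simp: xx S_def)
    also have "\<dots> = (\<Sum>k\<in>S. 1 - t / real m)"
    proof (rule sum.cong)
      fix k assume "k \<in> S"
      then have "(\<Sum>l\<in>S. \<delta> l k) = 1" using \<delta>S by simp
      then show "(\<Sum>l\<in>S. \<delta> l k - 1 / real m) = 1 - t / real m" by (simp add: sum_subtractf t_def)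
    qed simp
    also have "\<dots> = t - t * t / real m" by (simp add: t_def algebra_simps)
    finally have "1 - 1 / real m = t - t * t / real m" using yy by simp
    \<comment> \<open>The norm of a sum of t centred vertices is t - t^2/m, and \<open>g\<close>
      preserves the norm 1 - 1/m of one vertex. For t = m - 1 the sum is minus the missing vertex,
      because all vertices add up to 0.\<close>
    then have "(t - 1) * (t - (real m - 1)) = 0" using m0 by (simp add: field_simps)
    then consider "card S = 1" | "card S = m - 1" using m unfolding t_def by force
    then show ?thesis
    proof cases
      case 1
      then obtain a where a: "S = {a}" by (auto simp: card_1_singleton_iff)
      then have "a \<in> S" by simp
      then have "a < m" by (simp add: S_def)
      moreover have "y = 1 *\<^sub>R x a" using y_eq a by simp
      ultimately show ?thesis unfolding y_def by blast
    next
      case 2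
      have "S \<subseteq> {..<m}" by (auto simp: S_def)
      then have "card ({..<m} - S) = 1" using 2 m fin by (simp add: card_Diff_subset)
      then obtain a where a: "{..<m} - S = {a}" by (auto simp: card_1_singleton_iff)
      have "(\<Sum>k<m. x k) = (\<Sum>k\<in>S. x k) + (\<Sum>k\<in>{..<m} - S. x k)"
        using \<open>S \<subseteq> {..<m}\<close> by (metis add.commute finite_lessThan sum.subset_diff)
      then have "y = -1 *\<^sub>R x a" using a x_total y_eq by (simp add: eq_neg_iff_add_eq_0)
      moreover have "a < m" using a by auto
      ultimately show ?thesis unfolding y_def by blast
    qed
  qed
  then obtain \<sigma> \<epsilon> where \<sigma>: "\<And>i. i < m \<Longrightarrow> \<sigma> i < m" "\<And>i. i < m \<Longrightarrow> \<epsilon> i \<in> {1, -1}"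
    "\<And>i. i < m \<Longrightarrow> g (x i) = \<epsilon> i *\<^sub>R x (\<sigma> i)" by metis
  have \<epsilon>_eq: "\<epsilon> i = \<epsilon> 0" if i: "i < m" for i
  proof (cases "i = 0")
    case False
    have 0: "0 < m" using m by simp
    have "x i \<bullet> x 0 = (\<epsilon> i * \<epsilon> 0) * (x (\<sigma> i) \<bullet> x (\<sigma> 0))"
      using inner_g[of "x i" "x 0"] \<sigma>(3)[OF i] \<sigma>(3)[OF 0] by (simp add: mult_ac)
    then have *: "- 1 / real m = (\<epsilon> i * \<epsilon> 0) * (\<delta> (\<sigma> i) (\<sigma> 0) - 1 / real m)"
      using xx[OF i 0] xx[OF \<sigma>(1)[OF i] \<sigma>(1)[OF 0]] False by (simp add: \<delta>_def)
    \<comment> \<open>Opposite signs are compatible with the inner products -1/m only if m = 2; this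
      is where at least three vertices are needed.\<close>
    have "\<epsilon> i * \<epsilon> 0 \<noteq> -1"
    proof
      assume neg: "\<epsilon> i * \<epsilon> 0 = -1"
      have "real m * \<delta> (\<sigma> i) (\<sigma> 0) = 2" using *[unfolded neg] m0 by (simp add: field_simps)
      then show False using m by (auto simp: \<delta>_def split: if_splits)
    qed
    then show ?thesis using \<sigma>(2)[OF i] \<sigma>(2)[OF 0] by auto
  qed simp
  define \<tau> where "\<tau> = \<epsilon> 0"
  have \<tau>: "\<tau> \<in> {1, -1}" using \<sigma>(2)[of 0] m by (simp add: \<tau>_def)
  \<comment> \<open>The appended coordinate must change sign along with the vertices. The period is
    doubled because \<open>\<tau> ^ N\<close> may be -1.\<close>
  define G where "G = (\<lambda>z :: 'a \<times> real. (g (fst z), \<tau> * snd z))"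
  have Gpow: "(G ^^ k) z = ((g ^^ k) (fst z), \<tau> ^ k * snd z)" for k z
    by (induction k) (simp_all add: G_def mult.assoc)
  interpret G: isometry G "2 * N"
  proof (rule isometry.intro)
    show "linear G" unfolding G_def using linear_g
      by (auto intro!: linearI simp: linear_add linear_scale algebra_simps)
    have "\<tau> * a * (\<tau> * b) = a * b" for a b using \<tau> by auto
    then show "G y \<bullet> G z = y \<bullet> z" for y z by (simp add: G_def inner_prod_def inner_g)
    show "0 < 2 * N" using N_pos by simp
    have "\<tau> ^ (2 * N) = 1" using \<tau> by (auto simp: power_mult)
    moreover have "(g ^^ (2 * N)) y = y" for y using funpow_mult_period[of N g 2 y] period by (simp add: mult.commute)
    ultimately show "(G ^^ (2 * N)) z = z" for z by (simp add: Gpow)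
  qed
  \<comment> \<open>The constant coordinate contributes 1/m to every inner product and so cancels
    the -1/m between centred vertices. It drops out of \<open>E i - E j\<close>, which is
    \<open>v\<close>.\<close>
  define E where "E = (\<lambda>i. (x i, 1 / sqrt (real m)))"
  have EE: "E i \<bullet> E j = \<delta> i j" if "i < m" "j < m" for i j
    using xx[OF that] m by (simp add: E_def inner_prod_def)
  have GE: "G (E i) = \<tau> *\<^sub>R E (\<sigma> i)" if "i < m" for i
    using \<sigma>(3)[OF that] \<epsilon>_eq[OF that] by (simp add: G_def E_def \<tau>_def scaleR_prod_def)
  have o: "orthonormal E m" using EE by (simp add: orthonormal_def \<delta>_def)
  have ge: "G (E i) \<in> signed_frame E m" if "i < m" for i
    unfolding GE[OF that] using \<sigma>(1)[OF that] \<tau> by (rule signed_frameI)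
  have vR: "v \<in> R" using R_gen[of 0] by simp
  from bspec[OF all vR] obtain i j where ij: "i < m" "j < m" "i \<noteq> j" "v = p i - p j" by blast
  have vE: "E i + (-1) *\<^sub>R E j = (v, 0)" by (simp add: E_def ij(4) xd)
  have "one_cycle (gen (\<lambda>k. (E i + (-1) *\<^sub>R E j) \<bullet> (G ^^ k) (E i + (-1) *\<^sub>R E j))) \<or>
    two_cycles (gen (\<lambda>k. (E i + (-1) *\<^sub>R E j) \<bullet> (G ^^ k) (E i + (-1) *\<^sub>R E j)))"
  proof (rule G.signed_orbits[where B = "signed_frame E m"])
    show "E i \<in> signed_frame E m" "(-1) *\<^sub>R E j \<in> signed_frame E m"
      using signed_frameI[of i m 1 E] signed_frameI[of j m "-1" E] ij by auto
    show "E i \<bullet> (-1) *\<^sub>R E j = 0" using EE ij by (simp add: \<delta>_def)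
    show "G z \<in> signed_frame E m" if "z \<in> signed_frame E m" for z
      using G.linear_g ge that by (rule signed_frame_linear)
  qed (fact signed_frame_norm[OF o] signed_frame_inner[OF o])+
  then show ?thesis unfolding vE by (simp add: Gpow inner_prod_def)
qed

theorem cycles: "one_cycle H \<or> two_cycles H"
proof -
  define T where "T = (\<lambda>k. (g ^^ k) v) ` {..<N}"
  have "(g ^^ k) v \<in> span T" for k
  proof -
    have "(g ^^ k) v = (g ^^ (k mod N)) v"
      using funpow_mult_period[of N g "k div N" v] period
      by (metis comp_apply funpow_add mod_mult_div_eq)
    also have "\<dots> \<in> span T" unfolding T_def using N_pos by (intro span_base) simp
    finally show ?thesis .
  qed
  then have "L \<subseteq> span T" by (rule L_subspace[OF subspace_span])
  then have "R \<subseteq> span T" by (auto simp: R_def)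
  moreover have "finite T" by (simp add: T_def)
  moreover have "R \<noteq> {}" using R_gen by blast
  moreover have "8 < card T" if "finite T" "R \<subseteq> span T" for T
    using that(2) R_gen by (intro rank that(1)) blast
  ultimately have "(\<exists>e r. 9 \<le> r \<and> frame e r \<and> (\<forall>x\<in>R. \<exists>i<r. \<exists>j<r. i \<noteq> j \<and>
            (\<exists>\<epsilon>\<in>{1, -1}. \<exists>\<delta>\<in>{1, -1}. x = \<epsilon> *\<^sub>R e i + \<delta> *\<^sub>R e j))) \<or>
    (\<exists>p m. 3 \<le> m \<and> root_simplex p m \<and> (\<forall>x\<in>R. \<exists>i<m. \<exists>j<m. i \<noteq> j \<and> x = p i - p j))"
    by (intro root_classification)
  then show ?thesis
    by (elim disjE exE conjE) (rule frame_cycles simplex_cycles; assumption)+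
qed

end

section \<open>Factorial ratios and interlacing\<close>

text \<open>With \<open>N\<close> a common multiple of all parameters, Landau's function jumps only
  at multiples of 1/N, and its values at j/N carry all information.\<close>

locale ratio =
  fixes as bs :: "nat list" and N :: nat
  assumes N_pos: "0 < N"
    and as_dvd: "a \<in> set as \<Longrightarrow> a dvd N" and bs_dvd: "b \<in> set bs \<Longrightarrow> b dvd N"
    and len: "length bs = Suc (length as)"
    and sums: "sum_list as = sum_list bs"
    and Landau: "j < N \<Longrightarrow> (\<Sum>b\<leftarrow>bs. b * j div N) \<le> (\<Sum>a\<leftarrow>as. a * j div N)"
begin

lemma as_pos: "a \<in> set as \<Longrightarrow> 0 < a" and bs_pos: "b \<in> set bs \<Longrightarrow> 0 < b"
  using as_dvd bs_dvd N_pos by (metis dvd_0_left_iff gr0I not_gr_zero)+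

text \<open>The multiplicity of exp(2 pi i j / N) as a zero of the product of the 1 - X^x.\<close>

definition ord_at :: "nat list \<Rightarrow> nat \<Rightarrow> nat" where
  "ord_at xs j = length (filter (\<lambda>x. N dvd x * j) xs)"

definition jump :: "nat \<Rightarrow> int" where
  "jump j = int (ord_at as j) - int (ord_at bs j)"

text \<open>Landau's function at j/N, which is its value on the whole interval from j/N up to, but
  not including, (j+1)/N.\<close>

definition step :: "nat \<Rightarrow> int" where
  "step j = int (\<Sum>a\<leftarrow>as. a * j div N) - int (\<Sum>b\<leftarrow>bs. b * j div N)"

lemma div_Suc_dvd:
  assumes "a dvd N" shows "a * Suc j div N = a * j div N + (if N dvd a * Suc j then 1 else 0)"
proof -
  obtain M where M: "N = a * M" using assms by blast
  have "0 < a" "0 < M" using M N_pos by auto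
  then have "a * k div N = k div M" "N dvd a * k \<longleftrightarrow> M dvd k" for k by (auto simp: M)
  then show ?thesis by (simp add: div_Suc mod_eq_0_iff_dvd del: mult_Suc_right)
qed

lemma ord_at_step:
  assumes "\<And>x. x \<in> set xs \<Longrightarrow> x dvd N"
  shows "(\<Sum>x\<leftarrow>xs. x * Suc j div N) = (\<Sum>x\<leftarrow>xs. x * j div N) + ord_at xs (Suc j)"
  using assms
proof (induction xs)
  case (Cons x xs)
  then show ?case using div_Suc_dvd[of x j] by (simp add: ord_at_def)
qed (simp add: ord_at_def)

lemma step_Suc: "step (Suc j) = step j + jump (Suc j)"
  using ord_at_step[of as j] ord_at_step[of bs j] as_dvd bs_dvd by (simp add: step_def jump_def)

lemma step_0: "step 0 = 0" by (simp add: step_def)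

lemma jump_0: "jump 0 = -1" by (simp add: jump_def ord_at_def len)

lemma ord_at_N: "ord_at xs N = length xs" by (simp add: ord_at_def)

lemma step_N: "step N = 0"
proof -
  have "(\<Sum>x\<leftarrow>xs. x * N div N) = sum_list xs" for xs using N_pos by (induction xs) auto
  then show ?thesis by (simp add: step_def sums)
qed

lemma step_last: "step (N - 1) = 1"
proof -
  obtain M where M: "N = Suc M" using N_pos gr0_implies_Suc by blast
  have "jump (Suc M) = -1" using len by (simp add: jump_def ord_at_N flip: M)
  then show ?thesis using step_Suc[of M] step_N unfolding M by simp
qed

lemma jump_sym: "j \<le> N \<Longrightarrow> jump (N - j) = jump j"
proof -
  assume j: "j \<le> N"
  have "N dvd x * (N - j) \<longleftrightarrow> N dvd x * j" for x
  proof -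
    have "x * (N - j) + x * j = x * N" using j by (simp flip: distrib_left)
    then show ?thesis by (metis dvd_add_left_iff dvd_add_right_iff dvd_triv_right)
  qed
  then show ?thesis by (simp add: jump_def ord_at_def)
qed

text \<open>The reflection x -> 1 - x exchanges the intervals between consecutive multiples of 1/N,
  which explains the shift by 1. The jump of -1 at 0 is responsible for the value
  \<open>1 - step j\<close>.\<close>

lemma step_sym: "j < N \<Longrightarrow> step (N - 1 - j) = 1 - step j"
proof (induction j)
  case (Suc j)
  have e: "N - 1 - j = Suc (N - 1 - Suc j)" using Suc.prems by simp
  have e': "N - 1 - j = N - Suc j" using Suc.prems by simp
  have "step (N - 1 - j) = step (N - 1 - Suc j) + jump (N - Suc j)"
    using step_Suc[of "N - 1 - Suc j"] unfolding e[symmetric] e' by simp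
  then show ?case using Suc jump_sym[of "Suc j"] step_Suc[of j] by simp
qed (use step_last in \<open>simp add: step_0\<close>)

text \<open>Landau's criterion bounds the function below by 0, and the symmetry turns this into the
  upper bound 1.\<close>

lemma step_cases: "j < N \<Longrightarrow> step j = 0 \<or> step j = 1"
proof -
  assume j: "j < N"
  have nonneg: "0 \<le> step i" if "i < N" for i
    unfolding step_def using Landau[OF that] by (simp flip: of_nat_diff)
  have "0 \<le> step j" "0 \<le> step (N - 1 - j)" using nonneg j by auto
  then show ?thesis using step_sym[OF j] by linarith
qed

lemma jump_cases: "j < N \<Longrightarrow> jump j \<in> {-1, 0, 1}"
  using jump_0 step_Suc[of "j - 1"] step_cases[of j] step_cases[of "j - 1"] by (cases j) auto

text \<open>After cancellation \<open>JA\<close> indexes the poles of the quotient and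
  \<open>JB\<close> its zeros. Since \<open>step\<close> only takes the values 0 and 1, the two
  kinds of jump alternate.\<close>

definition JA :: "nat set" where "JA = {j. j < N \<and> jump j = 1}"
definition JB :: "nat set" where "JB = {j. j < N \<and> jump j = -1}"

lemma finite_J: "finite JA" "finite JB" by (simp_all add: JA_def JB_def)

lemma zero_J: "0 \<notin> JA" "0 \<in> JB" using N_pos by (simp_all add: JA_def JB_def jump_0)

lemma J_disjoint: "JA \<inter> JB = {}" by (auto simp: JA_def JB_def)

lemma step_JA: "j \<in> JA \<Longrightarrow> step j = 1"
  using zero_J(1) step_Suc[of "j - 1"] step_cases[of j] step_cases[of "j - 1"]
  by (cases j) (auto simp: JA_def)

lemma sum_jump:
  assumes "S \<subseteq> {..<N}"
  shows "(\<Sum>j\<in>S. jump j) = int (card (JA \<inter> S)) - int (card (JB \<inter> S))"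
proof -
  have "finite S" using assms by (rule finite_subset) simp
  have "(\<Sum>j\<in>S. jump j) = (\<Sum>j\<in>S. of_bool (j \<in> JA) - of_bool (j \<in> JB))"
    using assms jump_cases by (intro sum.cong) (fastforce simp: JA_def JB_def)+
  also have "\<dots> = int (card (JA \<inter> S)) - int (card (JB \<inter> S))"
    using \<open>finite S\<close> by (simp add: sum_subtractf of_bool_def sum.If_cases Int_commute Int_def conj_commute)
  finally show ?thesis .
qed

lemma step_telescope: "i \<le> j \<Longrightarrow> step j = step i + (\<Sum>k\<in>{i<..j}. jump k)"
proof (induction j)
  case (Suc j)
  show ?case
  proof (cases "i = Suc j")
    case False
    then have "{i<..Suc j} = insert (Suc j) {i<..j}" using Suc.prems by auto
    then show ?thesis using Suc False step_Suc[of j] by simp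
  qed simp
qed simp

text \<open>\<open>step\<close> has the value 1 at an upward jump and again at the very end, so the
  jumps in between balance. This is the form in which interlacing fixes the signs of the
  weights.\<close>

lemma card_J_greater: "j \<in> JA \<Longrightarrow> card (JA \<inter> {j<..}) = card (JB \<inter> {j<..})"
proof -
  assume j: "j \<in> JA"
  then have jN: "j \<le> N - 1" "j < N" by (auto simp: JA_def)
  have "(\<Sum>k\<in>{j<..N - 1}. jump k) = 0"
    using step_telescope[OF jN(1)] step_last step_JA[OF j] by simp
  moreover have "{j<..N - 1} \<subseteq> {..<N}" using N_pos by auto
  ultimately have "card (JA \<inter> {j<..N - 1}) = card (JB \<inter> {j<..N - 1})"
    using sum_jump[of "{j<..N - 1}"] by simp
  moreover have "JA \<inter> {j<..N - 1} = JA \<inter> {j<..}" "JB \<inter> {j<..N - 1} = JB \<inter> {j<..}"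
    by (auto simp: JA_def JB_def)
  ultimately show ?thesis by simp
qed

lemma card_J: "card JA = card JB"
proof -
  have "(\<Sum>k\<in>{0<..N - 1}. jump k) = 1" using step_telescope[of 0 "N - 1"] step_0 step_last by simp
  moreover have "{..<N} = insert 0 {0<..N - 1}" using N_pos by auto
  ultimately have "(\<Sum>k<N. jump k) = 0" using jump_0 by simp
  moreover have "JA \<inter> {..<N} = JA" "JB \<inter> {..<N} = JB" by (auto simp: JA_def JB_def)
  ultimately show ?thesis using sum_jump[of "{..<N}"] by simp
qed

lemma J_sym_aux: "0 < j \<Longrightarrow> j < N \<Longrightarrow> 0 < N - j \<and> N - j < N \<and> jump (N - j) = jump j"
  using jump_sym[of j] by auto

lemma J_sym: "j \<in> JA \<Longrightarrow> N - j \<in> JA" "j \<in> JB - {0} \<Longrightarrow> N - j \<in> JB - {0}"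
proof -
  assume j: "j \<in> JA"
  then have "0 < j" using zero_J(1) by (metis gr0I)
  then show "N - j \<in> JA" using J_sym_aux[of j] j by (auto simp: JA_def)
next
  assume "j \<in> JB - {0}"
  then show "N - j \<in> JB - {0}" using J_sym_aux[of j] by (auto simp: JB_def)
qed

text \<open>The sum of the exponents is the phase of a product of roots of unity; it enters the
  leading coefficients and the weights.\<close>

lemma sum_sym:
  assumes "S \<subseteq> {0<..<N}" "\<And>j. j \<in> S \<Longrightarrow> N - j \<in> S"
  shows "2 * (\<Sum>j\<in>S. j) = card S * N"
proof -
  have "(\<Sum>j\<in>S. j) = (\<Sum>j\<in>S. N - j)"
    by (rule sum.reindex_bij_witness[of _ "\<lambda>j. N - j" "\<lambda>j. N - j"]) (use assms in \<open>auto simp: subset_eq\<close>)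
  then have "2 * (\<Sum>j\<in>S. j) = (\<Sum>j\<in>S. j) + (\<Sum>j\<in>S. N - j)" by simp
  also have "\<dots> = (\<Sum>j\<in>S. N)" unfolding sum.distrib[symmetric]
    using assms(1) by (intro sum.cong) auto
  finally show ?thesis by simp
qed

lemma sum_JA: "2 * (\<Sum>j\<in>JA. j) = card JA * N"
  using J_sym zero_J by (intro sum_sym) (auto simp: JA_def intro: gr0I)

text \<open>The exponent 0 belongs to \<open>JB\<close> and stays out of the reflection, hence
  \<open>card JA - 1\<close>.\<close>

lemma sum_JB: "2 * (\<Sum>j\<in>JB. j) = (card JA - 1) * N"
proof -
  have "2 * (\<Sum>j\<in>JB - {0}. j) = card (JB - {0}) * N"
    using J_sym(2) by (intro sum_sym) (auto simp: JB_def)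
  then show ?thesis using zero_J finite_J card_J by (simp add: sum.remove[of JB 0] card_Diff_singleton)
qed

end

section \<open>Roots of unity and the partial fraction expansion\<close>

context ratio begin

definition \<alpha> :: "nat \<Rightarrow> complex" where "\<alpha> j = cis (2 * pi * real j / real N)"

lemma \<alpha>_nz: "\<alpha> j \<noteq> 0" by (simp add: \<alpha>_def)
lemma \<alpha>_cnj: "\<alpha> j * cnj (\<alpha> j) = 1" "cnj (\<alpha> j) * \<alpha> j = 1"
  by (simp_all add: \<alpha>_def cis_cnj cis_mult)

lemma \<alpha>_pow: "\<alpha> j ^ k = cis (2 * pi * real (k * j) / real N)"
  by (simp add: \<alpha>_def Complex.DeMoivre algebra_simps)

lemma cis_eq_1: "cis (2 * pi * real k / real N) = 1 \<longleftrightarrow> N dvd k"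
proof
  assume "cis (2 * pi * real k / real N) = 1"
  then have "cos (2 * pi * real k / real N) = 1" by (simp add: complex_eq_iff)
  then obtain n :: int where "2 * pi * real k / real N = of_int n * 2 * pi"
    using cos_one_2pi_int by blast
  then have "real k = of_int n * real N" using N_pos by (simp add: field_simps)
  then have "int k = n * int N" by (metis of_int_eq_iff of_int_mult of_int_of_nat_eq)
  then show "N dvd k" by (metis dvd_triv_right int_dvd_int_iff)
next
  assume "N dvd k"
  then obtain m where "k = N * m" by blast
  then have "2 * pi * real k / real N = 2 * pi * real m" using N_pos by simp
  then show "cis (2 * pi * real k / real N) = 1" by (simp add: cis_multiple_2pi)
qed

lemma \<alpha>_pow_eq_1: "\<alpha> j ^ k = 1 \<longleftrightarrow> N dvd k * j"
  unfolding \<alpha>_pow cis_eq_1 ..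

lemma \<alpha>_inj: "inj_on \<alpha> {..<N}"
proof (rule inj_onI)
  have *: "i = j" if "i < N" "j < N" "\<alpha> i = \<alpha> j" "i \<le> j" for i j
  proof -
    have "\<alpha> j = \<alpha> i * cis (2 * pi * real (j - i) / real N)"
      using that(4) N_pos by (simp add: \<alpha>_def cis_mult of_nat_diff field_simps)
    then have "N dvd j - i" using that(3) \<alpha>_nz[of i] cis_eq_1[of "j - i"] by simp
    then show "i = j" using that by (auto dest: dvd_imp_le)
  qed
  fix i j assume "i \<in> {..<N}" "j \<in> {..<N}" "\<alpha> i = \<alpha> j"
  then show "i = j" using *[of i j] *[of j i] by (cases "i \<le> j") auto
qed

text \<open>Normalised to constant term 1, so that its inverse is a geometric series.\<close>

definition lin :: "nat \<Rightarrow> complex poly" where "lin j = [:1, - \<alpha> j:]"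

lemma poly_lin: "poly (lin i) x = 1 - \<alpha> i * x" by (simp add: lin_def algebra_simps)

lemma lin_nz: "lin j \<noteq> 0" by (simp add: lin_def)

lemma degree_prod_lin: "finite S \<Longrightarrow> degree (\<Prod>i\<in>S. lin i) = card S"
  by (subst degree_prod_eq_sum_degree) (auto simp: lin_def \<alpha>_nz)

lemma lead_coeff_prod_lin: "coeff (\<Prod>i\<in>S. lin i) (card S) = (\<Prod>i\<in>S. - \<alpha> i)" if "finite S"
proof -
  have "coeff (\<Prod>i\<in>S. lin i) (card S) = lead_coeff (\<Prod>i\<in>S. lin i)"
    using degree_prod_lin[OF that] by simp
  also have "\<dots> = (\<Prod>i\<in>S. lead_coeff (lin i))" by (rule lead_coeff_prod)
  also have "\<dots> = (\<Prod>i\<in>S. - \<alpha> i)" by (intro prod.cong) (auto simp: lin_def \<alpha>_nz)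
  finally show ?thesis .
qed

lemma card_multiples:
  assumes "a dvd N" shows "card {j. j < N \<and> N dvd a * j} = a"
proof -
  obtain M where M: "N = a * M" using assms by blast
  have "0 < a" "0 < M" using M N_pos by auto
  then have "{j. j < N \<and> N dvd a * j} = (\<lambda>k. M * k) ` {..<a}"
    by (auto simp: M mult.commute elim!: dvdE)
  moreover have "inj_on (\<lambda>k. M * k) {..<a}" using \<open>0 < M\<close> by (auto intro: inj_onI)
  ultimately show ?thesis by (simp add: card_image)
qed

text \<open>Both sides have degree at most \<open>a\<close> and agree at \<open>a + 1\<close>
  points: the \<open>a\<close> conjugate roots of unity, and 0, which fixes the constant
  factor.\<close>

lemma one_minus_monom:
  assumes a: "a dvd N"
  shows "1 - monom 1 a = (\<Prod>j\<in>{j. j < N \<and> N dvd a * j}. lin j)"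
proof -
  let ?Z = "{j. j < N \<and> N dvd a * j}"
  have a0: "0 < a" using a N_pos by (auto intro: gr0I)
  have fin: "finite ?Z" by simp
  let ?A = "insert 0 ((\<lambda>j. cnj (\<alpha> j)) ` ?Z)"
  have "inj_on (\<lambda>j. cnj (\<alpha> j)) ?Z" using \<alpha>_inj by (auto simp: inj_on_def)
  then have card: "card ?A = Suc a"
    using fin card_multiples[OF a] \<alpha>_nz by (subst card_insert_disjoint) (auto simp: card_image)
  show ?thesis
  proof (rule poly_eqI_degree)
    fix x assume "x \<in> ?A"
    then consider "x = 0" | j where "j \<in> ?Z" "x = cnj (\<alpha> j)" by blast
    then show "poly (1 - monom 1 a) x = poly (\<Prod>j\<in>?Z. lin j) x"
    proof cases
      case 1 then show ?thesis using a0 by (simp add: poly_prod poly_lin poly_monom)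
    next
      case (2 j)
      have "\<alpha> j ^ a = 1" using 2 by (simp add: \<alpha>_pow_eq_1)
      then have "x ^ a = 1" using 2 by (metis complex_cnj_one complex_cnj_power)
      moreover have "poly (lin j) x = 0" using 2 \<alpha>_cnj by (simp add: poly_lin)
      then have "poly (\<Prod>j\<in>?Z. lin j) x = 0" using 2(1) fin by (auto simp: poly_prod)
      ultimately show ?thesis by (simp add: poly_monom)
    qed
  next
    have "degree (1 - monom 1 a :: complex poly) \<le> a"
      by (intro degree_diff_le) (auto simp: degree_monom_le)
    then show "degree (1 - monom 1 a :: complex poly) < card ?A" using card by simp
    show "degree (\<Prod>j\<in>?Z. lin j) < card ?A" using card degree_prod_lin[OF fin] card_multiples[OF a] by simp
  qed
qed

definition pprod :: "nat list \<Rightarrow> complex poly" where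
  "pprod xs = (\<Prod>x\<leftarrow>xs. 1 - monom 1 x)"

lemma pprod_eq:
  assumes "\<And>x. x \<in> set xs \<Longrightarrow> x dvd N"
  shows "pprod xs = (\<Prod>j<N. lin j ^ ord_at xs j)"
  using assms
proof (induction xs)
  case (Cons x xs)
  have "pprod (x # xs) = (\<Prod>j\<in>{j. j < N \<and> N dvd x * j}. lin j) * (\<Prod>j<N. lin j ^ ord_at xs j)"
    using Cons one_minus_monom[of x] by (simp add: pprod_def)
  also have "(\<Prod>j\<in>{j. j < N \<and> N dvd x * j}. lin j) = (\<Prod>j<N. if N dvd x * j then lin j else 1)"
    by (simp add: prod.If_cases lessThan_def Collect_conj_eq)
  also have "\<dots> * (\<Prod>j<N. lin j ^ ord_at xs j) = (\<Prod>j<N. lin j ^ ord_at (x # xs) j)"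
    unfolding prod.distrib[symmetric] by (intro prod.cong) (auto simp: ord_at_def)
  finally show ?case .
qed (simp add: pprod_def ord_at_def)

definition P where "P = (\<Prod>j\<in>JA. lin j)"
definition Q where "Q = (\<Prod>j\<in>JB. lin j)"

lemma pprod_P_Q: "pprod bs * P = pprod as * Q"
proof -
  have P: "P = (\<Prod>j<N. if j \<in> JA then lin j else 1)"
    unfolding P_def by (subst prod.inter_restrict[symmetric]) (auto simp: JA_def intro!: prod.cong)
  have Q: "Q = (\<Prod>j<N. if j \<in> JB then lin j else 1)"
    unfolding Q_def by (subst prod.inter_restrict[symmetric]) (auto simp: JB_def intro!: prod.cong)
  have as: "pprod as = (\<Prod>j<N. lin j ^ ord_at as j)" by (rule pprod_eq) (rule as_dvd)
  have bs: "pprod bs = (\<Prod>j<N. lin j ^ ord_at bs j)" by (rule pprod_eq) (rule bs_dvd)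
  show ?thesis
    unfolding P Q as bs prod.distrib[symmetric]
  proof (rule prod.cong)
    fix j assume "j \<in> {..<N}"
    then have j: "j < N" by simp
    have "jump j = int (ord_at as j) - int (ord_at bs j)" by (simp add: jump_def)
    then have "ord_at as j = ord_at bs j \<and> j \<notin> JA \<and> j \<notin> JB \<or>
        ord_at as j = Suc (ord_at bs j) \<and> j \<in> JA \<and> j \<notin> JB \<or>
        ord_at bs j = Suc (ord_at as j) \<and> j \<notin> JA \<and> j \<in> JB"
      using jump_cases[OF j] j unfolding JA_def JB_def by auto
    then show "lin j ^ ord_at bs j * (if j \<in> JA then lin j else 1) =
         lin j ^ ord_at as j * (if j \<in> JB then lin j else 1)"
      by auto
  qed simp
qed

definition P' where "P' j = (\<Prod>i\<in>JA - {j}. lin i)"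

lemma P_eq: "j \<in> JA \<Longrightarrow> P = P' j * lin j"
  unfolding P_def P'_def using finite_J by (subst prod.remove[of _ j]) (auto simp: mult.commute)

definition w :: "nat \<Rightarrow> complex" where "w j = poly Q (cnj (\<alpha> j)) / poly (P' j) (cnj (\<alpha> j))"

lemma poly_lin_cnj: "poly (lin i) (cnj (\<alpha> j)) = 0 \<longleftrightarrow> i = j" if "i < N" "j < N"
proof
  assume "poly (lin i) (cnj (\<alpha> j)) = 0"
  then have "\<alpha> i * cnj (\<alpha> j) = \<alpha> j * cnj (\<alpha> j)" by (simp add: poly_lin \<alpha>_cnj)
  then have "\<alpha> i = \<alpha> j" using \<alpha>_nz[of j] by simp
  then show "i = j" using \<alpha>_inj that by (auto simp: inj_on_def)
qed (simp add: poly_lin \<alpha>_cnj)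

text \<open>The term \<open>- P\<close> is the value -1 of Q/P at infinity: the exponent sums of
  \<open>JA\<close> and \<open>JB\<close> differ by N/2, so the leading coefficients are opposite.
  The difference \<open>D\<close> of the two sides then has degree below \<open>card JA\<close> and
  vanishes at \<open>card JA\<close> points.\<close>

lemma partial_fractions: "Q = (\<Sum>j\<in>JA. smult (w j) (P' j)) - P"
proof -
  define D where "D = Q + P - (\<Sum>j\<in>JA. smult (w j) (P' j))"
  let ?n = "card JA"
  have n0: "0 < ?n" using card_J zero_J finite_J by (auto simp: card_gt_0_iff)
  have degP': "degree (P' j) = ?n - 1" if "j \<in> JA" for j
    unfolding P'_def using that finite_J by (simp add: degree_prod_lin)
  have degS: "degree (\<Sum>j\<in>JA. smult (w j) (P' j)) \<le> ?n - 1"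
    using finite_J degP' by (intro degree_sum_le) (auto intro: order.trans[OF degree_smult_le])
  have degPQ: "degree P = ?n" "degree Q = ?n"
    unfolding P_def Q_def using finite_J card_J by (simp_all add: degree_prod_lin)
  have "coeff D ?n = (\<Prod>i\<in>JB. - \<alpha> i) + (\<Prod>i\<in>JA. - \<alpha> i)"
    using degS n0 lead_coeff_prod_lin[OF finite_J(1)] lead_coeff_prod_lin[OF finite_J(2)] card_J
    by (simp add: D_def P_def Q_def coeff_eq_0)
  also have "\<dots> = 0"
  proof -
    have pr: "(\<Prod>i\<in>S. - \<alpha> i) = (-1) ^ card S * cis (2 * pi * real (\<Sum>i\<in>S. i) / real N)" if "finite S" for S
      using that by (induction S) (simp_all add: \<alpha>_def cis_mult add_divide_distrib distrib_left)
    have "cis (2 * pi * real (\<Sum>i\<in>JA. i) / real N) = cis (pi * real ?n)"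
    proof -
      have "2 * real (\<Sum>i\<in>JA. i) = real ?n * real N" using sum_JA by (metis of_nat_mult of_nat_numeral)
      then have "2 * pi * real (\<Sum>i\<in>JA. i) / real N = pi * real ?n" using N_pos by (simp add: field_simps del: of_nat_sum)
      then show ?thesis by (simp only:)
    qed
    moreover have "cis (2 * pi * real (\<Sum>i\<in>JB. i) / real N) = cis (pi * real (?n - 1))"
    proof -
      have "2 * real (\<Sum>i\<in>JB. i) = real (?n - 1) * real N" using sum_JB by (metis of_nat_mult of_nat_numeral)
      then have "2 * pi * real (\<Sum>i\<in>JB. i) / real N = pi * real (?n - 1)" using N_pos by (simp add: field_simps del: of_nat_sum)
      then show ?thesis by (simp only:)
    qed
    moreover have "cis (pi * real ?n) = - cis (pi * real (?n - 1))"
    proof -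
      have "pi * real ?n = pi * real (?n - 1) + pi" using n0 by (simp add: of_nat_diff algebra_simps)
      then show ?thesis by (simp add: cis_mult[symmetric])
    qed
    ultimately show ?thesis using pr[OF finite_J(1)] pr[OF finite_J(2)] card_J by simp
  qed
  finally have "coeff D ?n = 0" .
  moreover have "degree D \<le> ?n"
    unfolding D_def using degPQ degS by (intro degree_diff_le degree_add_le) auto
  ultimately have degD: "degree D < ?n"
    using n0 by (metis coeff_0 degree_0 le_neq_implies_less leading_coeff_0_iff)
  have "D = 0"
  proof (rule poly_eqI_degree)
    let ?A = "(\<lambda>j. cnj (\<alpha> j)) ` JA"
    have "inj_on (\<lambda>j. cnj (\<alpha> j)) JA" using \<alpha>_inj by (auto simp: inj_on_def JA_def)
    then have card: "card ?A = ?n" by (rule card_image)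
    show "degree D < card ?A" using degD card by simp
    show "degree (0::complex poly) < card ?A" using n0 card by simp
    fix x assume "x \<in> ?A"
    then obtain j where j: "j \<in> JA" "x = cnj (\<alpha> j)" by blast
    have JN: "i \<in> JA \<Longrightarrow> i < N" for i by (simp add: JA_def)
    have P'0: "poly (P' i) x = 0" if "i \<in> JA" "i \<noteq> j" for i
      using j that finite_J poly_lin_cnj[of j j] JN[OF j(1)] by (auto simp: P'_def poly_prod)
    have P'nz: "poly (P' j) x \<noteq> 0"
      using j finite_J poly_lin_cnj JN by (auto simp: P'_def poly_prod)
    have "poly P x = 0" using P_eq[OF j(1)] poly_lin_cnj[of j j] JN j by simp
    moreover have "(\<Sum>i\<in>JA. w i * poly (P' i) x) = w j * poly (P' j) x"
      using j(1) finite_J P'0 by (subst sum.remove[of _ j]) auto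
    moreover have "w j * poly (P' j) x = poly Q x" using P'nz by (simp add: w_def j)
    ultimately show "poly D x = poly 0 x" by (simp add: D_def poly_sum)
  qed
  then show ?thesis by (simp add: D_def algebra_simps)
qed

end

text \<open>Products of the factors in the weight: each is \<open>2 sin (\<pi> (j - i) / N)\<close> times a phase,
  and the phases cancel because of the symmetry of the two sets of exponents.\<close>

context ratio begin

definition s :: "nat \<Rightarrow> nat \<Rightarrow> real" where "s j i = 2 * sin (pi * (real j - real i) / real N)"

lemma poly_lin_polar:
  "poly (lin i) (cnj (\<alpha> j)) = of_real (s j i) * cis (pi / 2 + pi * (real i - real j) / real N)"
proof -
  define t where "t = pi * (real i - real j) / real N"
  have "\<alpha> i * cnj (\<alpha> j) = cis (2 * t)"
    by (simp add: \<alpha>_def cis_cnj cis_mult t_def diff_divide_distrib right_diff_distrib mult.assoc)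
  then have "poly (lin i) (cnj (\<alpha> j)) = 1 - cis (2 * t)" by (simp add: poly_lin)
  also have "\<dots> = of_real (- 2 * sin t) * cis (pi / 2 + t)"
    by (simp add: complex_eq_iff cos_add sin_add cos_double_sin sin_double power2_eq_square)
  also have "- 2 * sin t = s j i"
  proof -
    have "pi * (real j - real i) / real N = - t" by (simp add: t_def minus_divide_left algebra_simps)
    then show ?thesis by (simp add: s_def)
  qed
  finally show ?thesis by (simp add: t_def)
qed

lemma poly_prod_lin_polar:
  assumes "finite S"
  shows "poly (\<Prod>i\<in>S. lin i) (cnj (\<alpha> j)) = of_real (\<Prod>i\<in>S. s j i) *
    cis (real (card S) * (pi / 2) + pi * (real (\<Sum>i\<in>S. i) - real (card S) * real j) / real N)"
  using assms
proof (induction S)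
  case (insert i S)
  define A where "A = pi / 2 + pi * (real i - real j) / real N"
  define B where "B = real (card S) * (pi / 2) + pi * (real (\<Sum>i\<in>S. i) - real (card S) * real j) / real N"
  have "real (card (insert i S)) = 1 + real (card S)"
    "real (\<Sum>i\<in>insert i S. i) = real i + real (\<Sum>i\<in>S. i)"
    using insert(1,2) by simp_all
  then have AB: "real (card (insert i S)) * (pi / 2) +
     pi * (real (\<Sum>i\<in>insert i S. i) - real (card (insert i S)) * real j) / real N = A + B"
    unfolding A_def B_def by (simp only:) (simp add: algebra_simps add_divide_distrib diff_divide_distrib)
  have "poly (\<Prod>i\<in>insert i S. lin i) (cnj (\<alpha> j)) =
      (of_real (s j i) * cis A) * (of_real (\<Prod>i\<in>S. s j i) * cis B)"
    unfolding prod.insert[OF insert(1,2)] poly_mult poly_lin_polar insert(3) A_def B_def ..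
  also have "\<dots> = of_real (s j i) * of_real (\<Prod>i\<in>S. s j i) * (cis A * cis B)" by (simp only: mult_ac)
  finally show ?case unfolding AB using insert(1,2) by (simp add: cis_mult)
qed simp

lemma s_pos: "i < j \<Longrightarrow> j < N \<Longrightarrow> 0 < s j i"
proof -
  assume ij: "i < j" "j < N"
  then have "pi * (real j - real i) < pi * real N" by (intro mult_strict_left_mono) auto
  then have "0 < pi * (real j - real i) / real N" "pi * (real j - real i) / real N < pi"
    using ij by (auto simp: pos_divide_less_eq)
  then show ?thesis using sin_gt_zero by (simp add: s_def)
qed

lemma s_antisym: "s j i = - s i j"
proof -
  have "pi * (real j - real i) / real N = - (pi * (real i - real j) / real N)"
    by (simp add: minus_divide_left algebra_simps)
  then show ?thesis by (simp add: s_def)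
qed

text \<open>A factor \<open>s j i\<close> is negative exactly for the \<open>i\<close> beyond
  \<open>j\<close>.\<close>

lemma sgn_prod_s:
  assumes "finite S" "S \<subseteq> {..<N}" "j \<notin> S" "j < N"
  shows "0 < (-1) ^ card (S \<inter> {j<..}) * (\<Prod>i\<in>S. s j i)"
  using assms
proof (induction S)
  case (insert i S)
  then have IH: "0 < (-1) ^ card (S \<inter> {j<..}) * (\<Prod>i\<in>S. s j i)" by auto
  show ?case
  proof (cases "j < i")
    case True
    then have "insert i S \<inter> {j<..} = insert i (S \<inter> {j<..})" by auto
    then have "card (insert i S \<inter> {j<..}) = Suc (card (S \<inter> {j<..}))" using insert by simp
    moreover have neg: "s j i < 0" using s_pos[OF True] s_antisym[of j i] insert by simp
    ultimately show ?thesis using mult_neg_pos[OF neg IH] insert(1,2) by (simp add: mult_ac)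
  next
    case False
    then have "i < j" using insert by (cases "i = j") auto
    have "insert i S \<inter> {j<..} = S \<inter> {j<..}" using False by auto
    moreover have pos: "0 < s j i" using s_pos[OF \<open>i < j\<close>] insert by simp
    ultimately show ?thesis using mult_pos_pos[OF pos IH] insert(1,2) by (simp add: mult_ac)
  qed
qed simp

definition weight :: "nat \<Rightarrow> real" where
  "weight j = (\<Prod>i\<in>JB. s j i) / (\<Prod>i\<in>JA - {j}. s j i)"

text \<open>By \<open>card_J_greater\<close> the numerator and the denominator contain equally many
  negative factors.\<close>

lemma weight_pos: assumes j: "j \<in> JA" shows "0 < weight j"
proof -
  have jN: "j < N" using j by (simp add: JA_def)
  have "0 < (-1) ^ card (JB \<inter> {j<..}) * (\<Prod>i\<in>JB. s j i)"
    using finite_J J_disjoint j jN by (intro sgn_prod_s) (auto simp: JB_def)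
  moreover have "0 < (-1) ^ card ((JA - {j}) \<inter> {j<..}) * (\<Prod>i\<in>JA - {j}. s j i)"
    using finite_J jN by (intro sgn_prod_s) (auto simp: JA_def)
  moreover have "(JA - {j}) \<inter> {j<..} = JA \<inter> {j<..}" by auto
  ultimately have "0 < ((-1) ^ card (JB \<inter> {j<..}) * (\<Prod>i\<in>JB. s j i)) /
      ((-1) ^ card (JB \<inter> {j<..}) * (\<Prod>i\<in>JA - {j}. s j i))"
    using card_J_greater[OF j] by (intro divide_pos_pos) auto
  then show ?thesis by (simp add: weight_def)
qed

text \<open>The phases of the numerator and the denominator of a weight, with \<open>n\<close> for
  the number of poles and the values of \<open>sum_JB\<close> and \<open>sum_JA\<close>
  inserted.\<close>

lemma phase_identity:
  fixes n M j :: real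
  assumes "M \<noteq> 0"
  shows "n * (pi / 2) + pi * ((n - 1) * M / 2 - n * j) / M =
    (n - 1) * (pi / 2) + pi * (n * M / 2 - j - (n - 1) * j) / M"
  using assms by (simp add: field_simps)

lemma w_eq_weight: assumes j: "j \<in> JA" shows "w j = of_real (weight j)"
proof -
  let ?n = "card JA"
  have n0: "0 < ?n" using j finite_J by (auto simp: card_gt_0_iff)
  have cA: "card (JA - {j}) = ?n - 1" using j finite_J by simp
  have sA: "real (\<Sum>i\<in>JA - {j}. i) = real (\<Sum>i\<in>JA. i) - real j"
    using sum.remove[OF finite_J(1) j, of "\<lambda>i. i"] by simp
  define \<theta>B where "\<theta>B = real (card JB) * (pi / 2) + pi * (real (\<Sum>i\<in>JB. i) - real (card JB) * real j) / real N"
  define \<theta>A where "\<theta>A = real (card (JA - {j})) * (pi / 2) +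
     pi * (real (\<Sum>i\<in>JA - {j}. i) - real (card (JA - {j})) * real j) / real N"
  have "\<theta>B = \<theta>A"
  proof -
    have A: "real (\<Sum>i\<in>JA. i) = real ?n * real N / 2"
      using sum_JA by (metis of_nat_mult of_nat_numeral nonzero_mult_div_cancel_left zero_neq_numeral)
    have B: "real (\<Sum>i\<in>JB. i) = real (?n - 1) * real N / 2"
      using sum_JB by (metis of_nat_mult of_nat_numeral nonzero_mult_div_cancel_left zero_neq_numeral)
    have n1: "real (?n - 1) = real ?n - 1" using n0 by (simp add: of_nat_diff)
    show ?thesis unfolding \<theta>A_def \<theta>B_def sA A B cA n1 card_J[symmetric]
      by (rule phase_identity) (use N_pos in simp)
  qed
  have "w j = (of_real (\<Prod>i\<in>JB. s j i) * cis \<theta>B) / (of_real (\<Prod>i\<in>JA - {j}. s j i) * cis \<theta>A)"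
    unfolding w_def Q_def P'_def \<theta>A_def \<theta>B_def using finite_J by (simp only: poly_prod_lin_polar finite_Diff)
  also have "\<dots> = of_real (weight j)" unfolding \<open>\<theta>B = \<theta>A\<close> weight_def by simp
  finally show ?thesis .
qed

end

section \<open>Realising positive definite sequences\<close>

text \<open>The dimension of the space depends on the parameters, while a type cannot; finitely
  supported sequences accommodate all dimensions at once.\<close>

typedef fin_seq = "{f :: nat \<Rightarrow> complex. finite {i. f i \<noteq> 0}}"
  by (rule exI[of _ "\<lambda>_. 0"]) simp

setup_lifting type_definition_fin_seq

lift_definition coord :: "fin_seq \<Rightarrow> nat \<Rightarrow> complex" is "\<lambda>f. f" .

lemma fin_seq_eqI: "(\<And>i. coord x i = coord y i) \<Longrightarrow> x = y"
  by transfer auto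

lemma finite_coord: "finite {i. coord x i \<noteq> 0}" by transfer

instantiation fin_seq :: real_vector
begin

lift_definition zero_fin_seq :: fin_seq is "\<lambda>_. 0" by simp
lift_definition plus_fin_seq :: "fin_seq \<Rightarrow> fin_seq \<Rightarrow> fin_seq" is "\<lambda>f g i. f i + g i"
  subgoal for f g by (rule finite_subset[of _ "{i. f i \<noteq> 0} \<union> {i. g i \<noteq> 0}"]) auto
  done
lift_definition minus_fin_seq :: "fin_seq \<Rightarrow> fin_seq \<Rightarrow> fin_seq" is "\<lambda>f g i. f i - g i"
  subgoal for f g by (rule finite_subset[of _ "{i. f i \<noteq> 0} \<union> {i. g i \<noteq> 0}"]) auto
  done
lift_definition uminus_fin_seq :: "fin_seq \<Rightarrow> fin_seq" is "\<lambda>f i. - f i" by simp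
lift_definition scaleR_fin_seq :: "real \<Rightarrow> fin_seq \<Rightarrow> fin_seq" is "\<lambda>c f i. c *\<^sub>R f i"
  by (erule rev_finite_subset) auto

instance
  by standard (transfer; simp add: algebra_simps scaleR_add_left scaleR_add_right)+

end

lemma coord_simps [simp]:
  "coord 0 i = 0" "coord (x + y) i = coord x i + coord y i" "coord (x - y) i = coord x i - coord y i"
  "coord (- x) i = - coord x i" "coord (c *\<^sub>R x) i = c *\<^sub>R coord x i"
  by (transfer, simp)+

lemma coord_sum: "coord (\<Sum>k\<in>S. f k) i = (\<Sum>k\<in>S. coord (f k) i)"
  by (induction S rule: infinite_finite_induct) auto

instantiation fin_seq :: real_inner
begin

definition "inner_fin_seq x y = (\<Sum>i | coord x i \<noteq> 0. coord x i \<bullet> coord y i)"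
definition "norm_fin_seq (x :: fin_seq) = sqrt (x \<bullet> x)"
definition "dist_fin_seq (x :: fin_seq) y = norm (x - y)"
definition "sgn_fin_seq (x :: fin_seq) = x /\<^sub>R norm x"
definition "uniformity_fin_seq = (INF e\<in>{0 <..}. principal {(x :: fin_seq, y). dist x y < e})"
definition "open_fin_seq (U :: fin_seq set) \<longleftrightarrow> (\<forall>x\<in>U. \<forall>\<^sub>F (x', y) in uniformity. x' = x \<longrightarrow> y \<in> U)"

lemma inner_fin_seq_eq:
  assumes "finite S" "{i. coord x i \<noteq> 0} \<subseteq> S"
  shows "x \<bullet> y = (\<Sum>i\<in>S. coord x i \<bullet> coord y i)"
  unfolding inner_fin_seq_def using assms by (intro sum.mono_neutral_left) auto

lemma inner_fin_seq_Un: "x \<bullet> y = (\<Sum>i\<in>{i. coord x i \<noteq> 0} \<union> {i. coord z i \<noteq> 0}. coord x i \<bullet> coord y i)"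
  by (intro inner_fin_seq_eq) (auto simp: finite_coord)

instance
proof
  fix x y z :: fin_seq and c :: real
  let ?S = "\<lambda>x y :: fin_seq. {i. coord x i \<noteq> 0} \<union> {i. coord y i \<noteq> 0}"
  have fin: "finite (?S x y)" for x y by (simp add: finite_coord)
  show "dist x y = norm (x - y)" "sgn x = x /\<^sub>R norm x" "norm x = sqrt (x \<bullet> x)"
    by (simp_all add: dist_fin_seq_def sgn_fin_seq_def norm_fin_seq_def)
  show "uniformity = (INF e\<in>{0 <..}. principal {(x :: fin_seq, y). dist x y < e})"
    by (simp add: uniformity_fin_seq_def)
  show "open U \<longleftrightarrow> (\<forall>x\<in>U. \<forall>\<^sub>F (x', y) in uniformity. x' = x \<longrightarrow> y \<in> U)" for U :: "fin_seq set"
    by (simp add: open_fin_seq_def)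
  have "x \<bullet> y = (\<Sum>i\<in>?S x y. coord x i \<bullet> coord y i)" by (intro inner_fin_seq_eq fin) auto
  also have "\<dots> = (\<Sum>i\<in>?S x y. coord y i \<bullet> coord x i)" by (intro sum.cong inner_commute) simp
  also have "\<dots> = y \<bullet> x" by (intro inner_fin_seq_eq[symmetric] fin) auto
  finally show "x \<bullet> y = y \<bullet> x" .
  have "(x + y) \<bullet> z = (\<Sum>i\<in>?S x y. coord (x + y) i \<bullet> coord z i)"
    by (intro inner_fin_seq_eq fin) auto
  also have "\<dots> = (\<Sum>i\<in>?S x y. coord x i \<bullet> coord z i) + (\<Sum>i\<in>?S x y. coord y i \<bullet> coord z i)"
    by (simp add: inner_add_left sum.distrib)
  also have "(\<Sum>i\<in>?S x y. coord x i \<bullet> coord z i) = x \<bullet> z" by (intro inner_fin_seq_eq[symmetric] fin) auto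
  also have "(\<Sum>i\<in>?S x y. coord y i \<bullet> coord z i) = y \<bullet> z" by (intro inner_fin_seq_eq[symmetric] fin) auto
  finally show "(x + y) \<bullet> z = x \<bullet> z + y \<bullet> z" .
  have "(c *\<^sub>R x) \<bullet> y = (\<Sum>i | coord x i \<noteq> 0. coord (c *\<^sub>R x) i \<bullet> coord y i)"
    by (intro inner_fin_seq_eq finite_coord) auto
  then show "(c *\<^sub>R x) \<bullet> y = c * (x \<bullet> y)" by (simp add: inner_fin_seq_def sum_distrib_left)
  show "0 \<le> x \<bullet> x" by (simp add: inner_fin_seq_def sum_nonneg)
  show "x \<bullet> x = 0 \<longleftrightarrow> x = 0"
  proof
    assume "x \<bullet> x = 0"
    then have "\<forall>i\<in>{i. coord x i \<noteq> 0}. coord x i \<bullet> coord x i = 0"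
      unfolding inner_fin_seq_def by (subst (asm) sum_nonneg_eq_0_iff) (auto simp: finite_coord)
    then show "x = 0" by (intro fin_seq_eqI) auto
  qed (simp add: inner_fin_seq_def)
qed

end

lift_definition twist :: "(nat \<Rightarrow> complex) \<Rightarrow> fin_seq \<Rightarrow> fin_seq" is "\<lambda>a f i. a i * f i"
  by (erule rev_finite_subset) auto

lemma coord_twist [simp]: "coord (twist a x) i = a i * coord x i" by transfer simp

lemma coord_twist_pow: "coord ((twist a ^^ k) x) i = a i ^ k * coord x i"
  by (induction k) simp_all

lemma linear_twist: "linear (twist a)"
  by (intro linearI fin_seq_eqI) (simp_all add: algebra_simps)

lemma inner_twist:
  assumes "\<And>i. norm (a i) = 1" shows "twist a x \<bullet> twist a y = x \<bullet> y"
proof -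
  have "a i \<noteq> 0" for i using assms[of i] by auto
  moreover have "(a i * u) \<bullet> (a i * v) = u \<bullet> v" for i u v
  proof -
    have "(a i * u) * cnj (a i * v) = (a i * cnj (a i)) * (u * cnj v)" by simp
    also have "a i * cnj (a i) = 1" using assms[of i] by (simp add: complex_norm_square[symmetric])
    finally have e: "(a i * u) * cnj (a i * v) = u * cnj v" by simp
    have r: "x \<bullet> y = Re (x * cnj y)" for x y :: complex by (simp add: inner_complex_def)
    show ?thesis unfolding r e ..
  qed
  ultimately show ?thesis by (simp add: inner_fin_seq_def)
qed

lemma inner_fin_seq_coords:
  assumes "finite S" "\<And>i. i \<notin> S \<Longrightarrow> coord x i = 0"
  shows "x \<bullet> y = (\<Sum>i\<in>S. coord x i \<bullet> coord y i)"
  using assms by (intro inner_fin_seq_eq) auto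

section \<open>Products of cyclotomic factors\<close>

definition mprod :: "nat multiset \<Rightarrow> real fps" where
  "mprod M = (\<Prod>m\<in>#M. 1 - fps_X ^ m)"

lemma mprod_empty [simp]: "mprod {#} = 1" by (simp add: mprod_def)
lemma mprod_add [simp]: "mprod (add_mset m M) = (1 - fps_X ^ m) * mprod M" by (simp add: mprod_def)
lemma mprod_union: "mprod (M + M') = mprod M * mprod M'" by (simp add: mprod_def)

lemma fps_nth_one_minus_X_power_mult:
  "fps_nth ((1 - fps_X ^ m) * F) k = fps_nth F k - (if k < m then 0 else fps_nth F (k - m))"
  for F :: "real fps"
  by (simp add: left_diff_distrib fps_X_power_mult_nth)

lemma mprod_nth_0: "(\<And>m. m \<in># M \<Longrightarrow> 0 < m) \<Longrightarrow> fps_nth (mprod M) 0 = 1"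
  by (induction M) (auto simp: fps_nth_one_minus_X_power_mult)

lemma mprod_nz: "(\<And>m. m \<in># M \<Longrightarrow> 0 < m) \<Longrightarrow> mprod M \<noteq> 0"
  using mprod_nth_0[of M] by auto

lemma mprod_nth_less:
  "(\<And>m. m \<in># M \<Longrightarrow> k < m) \<Longrightarrow> 0 < k \<Longrightarrow> fps_nth (mprod M) k = 0"
  by (induction M) (auto simp: fps_nth_one_minus_X_power_mult)

lemma mprod_nth_least:
  assumes "\<And>m. m \<in># M \<Longrightarrow> k \<le> m" "0 < k"
  shows "fps_nth (mprod M) k = - real (count M k)"
  using assms
proof (induction M)
  case (add m M)
  have "fps_nth (mprod M) 0 = 1" using add.prems by (intro mprod_nth_0) force
  moreover have "m = k \<or> k < m" using add.prems(1)[of m] by auto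
  ultimately show ?case using add by (auto simp: fps_nth_one_minus_X_power_mult)
qed simp

text \<open>The lowest exponent present is visible with its multiplicity as the first non-zero
  coefficient after the constant one; it is cancelled on both sides.\<close>

lemma mprod_inj:
  assumes "mprod M = mprod M'" "\<And>m. m \<in># M \<Longrightarrow> 0 < m" "\<And>m. m \<in># M' \<Longrightarrow> 0 < m"
  shows "M = M'"
  using assms
proof (induction "size M + size M'" arbitrary: M M' rule: less_induct)
  case less
  show ?case
  proof (cases "M + M' = {#}")
    case False
    define k where "k = Min (set_mset (M + M'))"
    have kin: "k \<in> set_mset (M + M')" unfolding k_def using False by (intro Min_in) auto
    have k: "k \<le> m" if "m \<in># M + M'" for m unfolding k_def using that by (intro Min_le) auto
    have k0: "0 < k" using kin less.prems(2,3) by auto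
    have "fps_nth (mprod M) k = - real (count M k)" "fps_nth (mprod M') k = - real (count M' k)"
      using k k0 by (intro mprod_nth_least; auto)+
    then have "count M k = count M' k" using less.prems(1) by simp
    then have in2: "k \<in># M" "k \<in># M'" using kin by (auto simp: count_greater_zero_iff[symmetric] simp del: count_greater_zero_iff)
    obtain L L' where L: "M = add_mset k L" "M' = add_mset k L'" using in2 by (meson multi_member_split)
    have "(1 - fps_X ^ k :: real fps) \<noteq> 0"
      using mprod_nz[of "{#k#}"] k0 by simp
    then have "mprod L = mprod L'" using less.prems(1) unfolding L by simp
    then have "L = L'" using less.prems L by (intro less.hyps) auto
    then show ?thesis by (simp add: L)
  qed simp
qed

definition multiples_only :: "nat \<Rightarrow> real fps \<Rightarrow> bool" where
  "multiples_only d F \<longleftrightarrow> (\<forall>k. \<not> d dvd k \<longrightarrow> fps_nth F k = 0)"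

lemma multiples_only_mult:
  assumes "multiples_only d F" "multiples_only d G" shows "multiples_only d (F * G)"
  unfolding multiples_only_def
proof (intro allI impI)
  fix k assume k: "\<not> d dvd k"
  have "fps_nth F i * fps_nth G (k - i) = 0" if "i \<le> k" for i
  proof (cases "d dvd i")
    case True
    then have "\<not> d dvd (k - i)" using k that by (metis dvd_add le_add_diff_inverse)
    then show ?thesis using assms(2) by (simp add: multiples_only_def)
  qed (use assms(1) in \<open>simp add: multiples_only_def\<close>)
  then show "fps_nth (F * G) k = 0" unfolding fps_mult_nth by (intro sum.neutral) auto
qed

lemma multiples_only_mprod:
  "(\<And>m. m \<in># M \<Longrightarrow> d dvd m) \<Longrightarrow> multiples_only d (mprod M)"
proof (induction M)
  case empty show ?case by (auto simp: multiples_only_def)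
next
  case (add m M)
  then have "\<not> d dvd k - m" if "\<not> d dvd k" "m \<le> k" for k
    using that by (metis dvd_add le_add_diff_inverse2 union_single_eq_member)
  then show ?case using add
    by (auto simp: multiples_only_def fps_nth_one_minus_X_power_mult)
qed

text \<open>If the quotient is a power series in \<open>X ^ d\<close>, compare coefficients at the least
  exponent which is not a multiple of \<open>d\<close>.\<close>

lemma multiples_only_quotient:
  assumes eq: "mprod A * H = mprod B" and H: "multiples_only d H" "fps_nth H 0 = 1"
    and pos: "\<And>m. m \<in># A + B \<Longrightarrow> 0 < m" and disj: "set_mset A \<inter> set_mset B = {}" and m: "m \<in># A + B"
  shows "d dvd m"
proof (rule ccontr)
  assume nm: "\<not> d dvd m"
  \<comment> \<open>The factors with exponents divisible by \<open>d\<close> are series in X^d and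
    do not affect the coefficient at the least exponent \<open>k\<close> that is not
    divisible.\<close>
  define A1 A2 B1 B2 where "A1 = filter_mset (\<lambda>m. d dvd m) A" and "A2 = filter_mset (\<lambda>m. \<not> d dvd m) A"
    and "B1 = filter_mset (\<lambda>m. d dvd m) B" and "B2 = filter_mset (\<lambda>m. \<not> d dvd m) B"
  have split: "A = A2 + A1" "B = B2 + B1" unfolding A1_def A2_def B1_def B2_def by (simp_all add: multiset_partition add.commute)
  define k where "k = Min (set_mset (A2 + B2))"
  have ne: "set_mset (A2 + B2) \<noteq> {}" using m nm by (auto simp: A2_def B2_def)
  have kin: "k \<in># A2 + B2" unfolding k_def using ne by (intro Min_in) auto
  have kle: "k \<le> m" if "m \<in># A2 + B2" for m unfolding k_def using that by (intro Min_le) auto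
  have nk: "\<not> d dvd k" using kin by (auto simp: A2_def B2_def)
  have k0: "0 < k" using kin pos by (auto simp: A2_def B2_def)
  have coeff: "fps_nth (mprod M * F) k = - real (count M k)"
    if M: "\<And>m. m \<in># M \<Longrightarrow> k \<le> m" and F: "multiples_only d F" "fps_nth F 0 = 1" for M F
  proof -
    have M0: "fps_nth (mprod M) 0 = 1" using M k0 by (intro mprod_nth_0) force
    have "fps_nth (mprod M) i * fps_nth F (k - i) = (if i = k then - real (count M k) else 0)" if "i \<in> {0..k}" for i
    proof -
      have "i \<le> k" using that by simp
      then consider "i = 0" | "0 < i" "i < k" | "i = k" by linarith
      then show ?thesis
      proof cases
        case 1 then show ?thesis using F(1) nk k0 by (simp add: multiples_only_def)
      next
        case 2
        then have "fps_nth (mprod M) i = 0" using M by (intro mprod_nth_less) force+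
        then show ?thesis using 2 by simp
      next
        case 3 then show ?thesis using F(2) mprod_nth_least[OF M k0] by simp
      qed
    qed
    then show ?thesis by (simp add: fps_mult_nth)
  qed
  have "mprod A2 * (mprod A1 * H) = mprod B2 * mprod B1"
    using eq unfolding split mprod_union by (simp add: mult.assoc)
  moreover have "fps_nth (mprod A2 * (mprod A1 * H)) k = - real (count A2 k)"
  proof (rule coeff)
    show "multiples_only d (mprod A1 * H)"
      by (intro multiples_only_mult H multiples_only_mprod) (simp add: A1_def)
    show "fps_nth (mprod A1 * H) 0 = 1" using H(2) mprod_nth_0[of A1] pos by (simp add: A1_def)
  qed (use kle in auto)
  moreover have "fps_nth (mprod B2 * mprod B1) k = - real (count B2 k)"
  proof (rule coeff)
    show "multiples_only d (mprod B1)" by (intro multiples_only_mprod) (simp add: B1_def)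
    show "fps_nth (mprod B1) 0 = 1" using mprod_nth_0[of B1] pos by (simp add: B1_def)
  qed (use kle in auto)
  ultimately have "count A2 k = count B2 k" by simp
  then have "k \<in># A2 \<and> k \<in># B2" using kin by (auto simp: count_greater_zero_iff[symmetric] simp del: count_greater_zero_iff)
  then show False using disj by (auto simp: A2_def B2_def)
qed

definition to_complex :: "real fps \<Rightarrow> complex fps" where
  "to_complex F = Abs_fps (\<lambda>k. complex_of_real (fps_nth F k))"

lemma to_complex_nth [simp]: "fps_nth (to_complex F) k = complex_of_real (fps_nth F k)"
  by (simp add: to_complex_def)

lemma to_complex_mult: "to_complex (F * G) = to_complex F * to_complex G"
  by (rule fps_ext) (simp add: fps_mult_nth)

lemma to_complex_mprod: "to_complex (mprod M) = (\<Prod>m\<in>#M. 1 - fps_X ^ m)"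
proof (induction M)
  case (add m M)
  have "to_complex (1 - fps_X ^ m) = 1 - fps_X ^ m"
    by (rule fps_ext) (simp add: fps_X_power_iff)
  then show ?case using add by (simp add: to_complex_mult)
next
  case empty
  show ?case by (rule fps_ext) simp
qed

definition fps_Ints :: "real fps \<Rightarrow> bool" where "fps_Ints F \<longleftrightarrow> (\<forall>k. fps_nth F k \<in> \<int>)"

lemma fps_Ints_mult: "fps_Ints F \<Longrightarrow> fps_Ints G \<Longrightarrow> fps_Ints (F * G)"
  by (auto simp: fps_Ints_def fps_mult_nth intro!: Ints_sum Ints_mult)

lemma fps_Ints_mprod: "fps_Ints (mprod M)"
proof (induction M)
  case (add m M)
  have "fps_Ints (1 - fps_X ^ m)" by (auto simp: fps_Ints_def fps_X_power_iff)
  then show ?case using add by (simp add: fps_Ints_mult)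
qed (simp add: fps_Ints_def)

lemma mprod_inverse:
  assumes "\<And>m. m \<in># M \<Longrightarrow> 0 < m"
  shows "\<exists>F. fps_Ints F \<and> mprod M * F = 1"
  using assms
proof (induction M)
  case empty
  show ?case by (rule exI[of _ 1]) (simp add: fps_Ints_def)
next
  case (add m M)
  then obtain F where F: "fps_Ints F" "mprod M * F = 1" by auto
  define G :: "real fps" where "G = Abs_fps (\<lambda>k. if m dvd k then 1 else 0)"
  have m: "0 < m" using add.prems by simp
  have "(1 - fps_const 1 * fps_X ^ m) * G = fps_const 1 * fps_X ^ 0"
    unfolding G_def using m by (intro fps_geometric_periodic) (auto dest: dvd_imp_le)
  then have G: "(1 - fps_X ^ m) * G = 1" by simp
  have "mprod (add_mset m M) * (G * F) = ((1 - fps_X ^ m) * G) * (mprod M * F)"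
    by (simp add: mult_ac)
  also have "\<dots> = 1" using G F by simp
  finally have "mprod (add_mset m M) * (G * F) = 1" .
  moreover have "fps_Ints G" by (simp add: G_def fps_Ints_def)
  ultimately show ?case using fps_Ints_mult F(1) by blast
qed

section \<open>The vector and the isometry attached to a factorial ratio\<close>

context ratio begin

lemma exists_quotient: "\<exists>F. fps_Ints F \<and> mprod (mset as) * F = mprod (mset bs)"
proof -
  obtain F where "fps_Ints F" "mprod (mset as) * F = 1" using mprod_inverse[of "mset as"] as_pos by auto
  then have "mprod (mset as) * (F * mprod (mset bs)) = mprod (mset bs)" by (simp flip: mult.assoc)
  then show ?thesis using fps_Ints_mult[OF \<open>fps_Ints F\<close> fps_Ints_mprod] by blast
qed

definition quot :: "real fps" where
  "quot = (SOME F. fps_Ints F \<and> mprod (mset as) * F = mprod (mset bs))"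

lemma quot: "fps_Ints quot" "mprod (mset as) * quot = mprod (mset bs)"
  using someI_ex[OF exists_quotient] unfolding quot_def by auto

lemma quot_0: "fps_nth quot 0 = 1"
  using arg_cong[OF quot(2), of "\<lambda>F. fps_nth F 0"] mprod_nth_0[of "mset as"] mprod_nth_0[of "mset bs"] as_pos bs_pos
  by simp

lemma fps_of_poly_pprod: "fps_of_poly (pprod xs) = to_complex (mprod (mset xs))"
proof -
  have "fps_of_poly (pprod xs) = (\<Prod>x\<leftarrow>xs. 1 - fps_X ^ x)"
    by (induction xs) (simp_all add: pprod_def fps_of_poly_mult fps_of_poly_diff fps_of_poly_monom)
  then show ?thesis by (simp add: to_complex_mprod prod_mset_prod_list flip: mset_map)
qed

definition geo :: "nat \<Rightarrow> complex fps" where "geo j = Abs_fps (\<lambda>k. \<alpha> j ^ k)"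

lemma lin_geo: "fps_of_poly (lin j) * geo j = 1"
proof -
  have 1: "fps_of_poly (lin j) = 1 - fps_const (\<alpha> j) * fps_X ^ 1"
    by (rule fps_ext) (auto simp: lin_def fps_X_power_iff coeff_pCons fps_X_def split: nat.split)
  moreover have "(1 - fps_const (\<alpha> j) * fps_X ^ 1) * geo j = fps_const 1 * fps_X ^ 0"
    unfolding geo_def by (rule fps_geometric_periodic) auto
  ultimately show ?thesis unfolding 1 by simp
qed

lemma quot_partial_fractions:
  "to_complex quot = (\<Sum>j\<in>JA. fps_const (w j) * geo j) - 1"
proof -
  let ?H = "(\<Sum>j\<in>JA. fps_const (w j) * geo j) - 1"
  have "fps_of_poly P * ?H = (\<Sum>j\<in>JA. fps_const (w j) * (fps_of_poly P * geo j)) - fps_of_poly P"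
    by (simp add: right_diff_distrib sum_distrib_left mult_ac)
  also have "(\<Sum>j\<in>JA. fps_const (w j) * (fps_of_poly P * geo j)) = (\<Sum>j\<in>JA. fps_of_poly (smult (w j) (P' j)))"
  proof (rule sum.cong)
    fix j assume "j \<in> JA"
    then have "fps_of_poly P * geo j = fps_of_poly (P' j) * (fps_of_poly (lin j) * geo j)"
      by (simp add: P_eq fps_of_poly_mult mult.assoc)
    then show "fps_const (w j) * (fps_of_poly P * geo j) = fps_of_poly (smult (w j) (P' j))"
      by (simp add: lin_geo fps_of_poly_smult)
  qed simp
  also have "\<dots> - fps_of_poly P = fps_of_poly Q"
    by (subst partial_fractions) (simp add: fps_of_poly_diff fps_of_poly_sum)
  finally have PH: "fps_of_poly P * ?H = fps_of_poly Q" .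
  let ?A = "to_complex (mprod (mset as))" and ?B = "to_complex (mprod (mset bs))"
  have "?B * fps_of_poly P = ?A * fps_of_poly Q"
    using arg_cong[OF pprod_P_Q, of fps_of_poly] by (simp add: fps_of_poly_mult fps_of_poly_pprod)
  also have "\<dots> = ?A * ?H * fps_of_poly P" by (simp add: PH[symmetric] mult_ac)
  finally have "?B = ?A * ?H"
    using finite_J lin_nz by (simp add: P_def)
  moreover have "?A * to_complex quot = ?B" by (simp add: quot(2) flip: to_complex_mult)
  moreover have "?A \<noteq> 0"
    using mprod_nth_0[of "mset as"] as_pos by (metis fps_zero_nth of_real_1 set_mset_mset to_complex_nth zero_neq_one)
  ultimately show ?thesis by simp
qed

definition h :: "nat \<Rightarrow> real" where "h k = (\<Sum>j\<in>JA. weight j * Re (\<alpha> j ^ k))"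

text \<open>The extra 1 at index 0 compensates the \<open>- 1\<close> in
  \<open>quot_partial_fractions\<close>, so that \<open>h\<close> is the pure sum over the
  poles.\<close>

lemma h_eq: "h k = fps_nth quot k + (if k = 0 then 1 else 0)"
proof -
  have "complex_of_real (fps_nth quot k) = (\<Sum>j\<in>JA. of_real (weight j) * \<alpha> j ^ k) - (if k = 0 then 1 else 0)"
    using arg_cong[OF quot_partial_fractions, of "\<lambda>F. fps_nth F k"] w_eq_weight
    by (simp add: fps_sum_nth geo_def)
  then have "fps_nth quot k = Re ((\<Sum>j\<in>JA. of_real (weight j) * \<alpha> j ^ k) - (if k = 0 then 1 else 0))"
    by (metis Re_complex_of_real)
  then show ?thesis by (simp add: h_def)
qed

lemma h_Ints: "h k \<in> \<int>" using quot(1) by (auto simp: h_eq fps_Ints_def)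

lemma h_0: "h 0 = 2" by (simp add: h_eq quot_0)

lemma gen_h: "gen h = quot"
  by (rule fps_ext) (auto simp: gen_def h_eq quot_0)

text \<open>Positivity of the weights makes their square roots real. Multiplying coordinate
  \<open>j\<close> by \<open>\<alpha> j\<close> then turns the inner products along the orbit into
  the weighted power sums \<open>h\<close>.\<close>

lift_definition base :: fin_seq is "\<lambda>j. if j \<in> JA then complex_of_real (sqrt (weight j)) else 0"
  using finite_J(1) by (rule rev_finite_subset) auto

lemma coord_base: "coord base j = (if j \<in> JA then complex_of_real (sqrt (weight j)) else 0)"
  by transfer simp

lemma inner_base: "base \<bullet> (twist \<alpha> ^^ k) base = h k"
proof -
  have "base \<bullet> (twist \<alpha> ^^ k) base = (\<Sum>j\<in>JA. coord base j \<bullet> coord ((twist \<alpha> ^^ k) base) j)"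
    by (intro inner_fin_seq_coords finite_J) (simp add: coord_base)
  also have "\<dots> = h k" unfolding h_def
  proof (rule sum.cong)
    fix j assume j: "j \<in> JA"
    have "sqrt (weight j) * (sqrt (weight j) * t) = weight j * t" for t
      using weight_pos[OF j] by (simp flip: mult.assoc)
    then show "coord base j \<bullet> coord ((twist \<alpha> ^^ k) base) j = weight j * Re (\<alpha> j ^ k)"
      using j by (simp add: coord_twist_pow coord_base inner_complex_def mult.left_commute)
  qed simp
  finally show ?thesis .
qed

text \<open>A Vandermonde argument: a polynomial of degree below \<open>card JA\<close> with
  \<open>card JA\<close> distinct zeros vanishes.\<close>

lemma power_sum_zero:
  assumes "\<And>j. j \<in> JA \<Longrightarrow> (\<Sum>k<card JA. of_real (c k) * \<alpha> j ^ k) = 0" "k < card JA"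
  shows "c k = 0"
proof -
  let ?n = "card JA"
  define p where "p = (\<Sum>k<?n. monom (complex_of_real (c k)) k)"
  have "p = 0"
  proof (rule poly_eqI_degree)
    have "inj_on \<alpha> JA" using \<alpha>_inj by (rule inj_on_subset) (auto simp: JA_def)
    then have card: "card (\<alpha> ` JA) = ?n" by (rule card_image)
    have "degree p \<le> ?n - 1"
      unfolding p_def by (intro degree_sum_le) (auto intro: order.trans[OF degree_monom_le])
    then show "degree p < card (\<alpha> ` JA)" "degree (0 :: complex poly) < card (\<alpha> ` JA)" using assms(2) card by auto
    fix x assume "x \<in> \<alpha> ` JA"
    then show "poly p x = poly 0 x" using assms(1) by (auto simp: p_def poly_sum poly_monom)
  qed
  then have "coeff p k = 0" by simp
  then have "complex_of_real (c k) = 0" using assms(2) by (simp add: p_def coeff_sum)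
  then show ?thesis by simp
qed

lemma base_independent:
  assumes "(\<Sum>k<card JA. c k *\<^sub>R (twist \<alpha> ^^ k) base) = 0" "k < card JA"
  shows "c k = 0"
proof (rule power_sum_zero[OF _ assms(2)])
  fix j assume j: "j \<in> JA"
  have "0 = coord (\<Sum>k<card JA. c k *\<^sub>R (twist \<alpha> ^^ k) base) j" by (simp add: assms(1))
  also have "\<dots> = (\<Sum>k<card JA. of_real (c k) * \<alpha> j ^ k) * coord base j"
    by (simp add: coord_sum coord_twist_pow sum_distrib_right scaleR_conv_of_real mult.assoc)
  finally show "(\<Sum>k<card JA. of_real (c k) * \<alpha> j ^ k) = 0"
    using weight_pos[OF j] j by (simp add: coord_base)
qed

text \<open>The first \<open>card JA\<close> orbit vectors are independent, so the rank is at least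
  the number of poles.\<close>

lemma card_span:
  assumes "finite T" "\<And>k. (twist \<alpha> ^^ k) base \<in> span T"
  shows "card JA \<le> card T"
proof -
  let ?v = "\<lambda>k. (twist \<alpha> ^^ k) base" and ?n = "card JA"
  have inj: "inj_on ?v {..<?n}"
  proof (rule inj_onI, rule ccontr)
    fix k l assume kl: "k \<in> {..<?n}" "l \<in> {..<?n}" "?v k = ?v l" "k \<noteq> l"
    have "(\<Sum>i<?n. (of_bool (i = k) - of_bool (i = l)) *\<^sub>R ?v i) = ?v k - ?v l"
      using kl by (simp add: scaleR_diff_left sum_subtractf of_bool_def if_distrib[of "\<lambda>c. c *\<^sub>R _"] cong: if_cong)
    then have "(of_bool (k = k) - of_bool (k = l) :: real) = 0"
      using kl by (intro base_independent) auto
    then show False using kl by simp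
  qed
  have "independent (?v ` {..<?n})"
  proof (rule independent_if_scalars_zero)
    fix f x assume f: "(\<Sum>x\<in>?v ` {..<?n}. f x *\<^sub>R x) = 0" and x: "x \<in> ?v ` {..<?n}"
    then obtain k where k: "k < ?n" "x = ?v k" by auto
    have "(\<Sum>k<?n. f (?v k) *\<^sub>R ?v k) = 0" using f by (simp add: sum.reindex[OF inj])
    from base_independent[of "\<lambda>k. f (?v k)", OF this k(1)] show "f x = 0" using k by simp
  qed simp
  moreover have "?v ` {..<?n} \<subseteq> span T" using assms(2) by blast
  ultimately have "card (?v ` {..<?n}) \<le> card T" using independent_span_bound[OF assms(1)] by blast
  then show ?thesis using card_image[OF inj] by simp
qed

text \<open>If all non-zero correlations sit at multiples of \<open>d\<close>, the quotient is a
  series in X^d and \<open>d\<close> divides every parameter; the gcd condition thus yields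
  \<open>primitive\<close>.\<close>

theorem large_rank_cycles:
  assumes disj: "set as \<inter> set bs = {}" and gcd: "Gcd (set as \<union> set bs) = 1" and big: "8 < card JA"
  shows "one_cycle quot \<or> two_cycles quot"
proof -
  have iso: "isometry (twist \<alpha>) N"
  proof (rule isometry.intro)
    show "linear (twist \<alpha>)" by (rule linear_twist)
    show "twist \<alpha> x \<bullet> twist \<alpha> y = x \<bullet> y" for x y by (rule inner_twist) (simp add: \<alpha>_def)
    show "0 < N" by (rule N_pos)
    show "(twist \<alpha> ^^ N) x = x" for x
      by (rule fin_seq_eqI) (simp add: coord_twist_pow \<alpha>_pow_eq_1[THEN iffD2])
  qed
  have "cyclic_root (twist \<alpha>) N base"
  proof (intro cyclic_root.intro iso cyclic_root_axioms.intro)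
    show "base \<bullet> base = 2" using inner_base[of 0] h_0 by simp
    show "base \<bullet> (twist \<alpha> ^^ k) base \<in> \<int>" for k by (simp add: inner_base h_Ints)
    show "8 < card T" if "finite T" "\<And>k. (twist \<alpha> ^^ k) base \<in> span T" for T
      using card_span[OF that] big by simp
    fix d assume d: "\<And>k. base \<bullet> (twist \<alpha> ^^ k) base \<noteq> 0 \<Longrightarrow> d dvd k"
    have "multiples_only d quot" unfolding multiples_only_def
    proof (intro allI impI)
      fix k assume k: "\<not> d dvd k"
      then have "h k = 0" using d[of k] by (auto simp: inner_base)
      moreover have "k \<noteq> 0" using k by (metis dvd_0_right)
      ultimately show "fps_nth quot k = 0" by (simp add: h_eq)
    qed
    then have "d dvd m" if "m \<in> set as \<union> set bs" for m
      using that as_pos bs_pos disj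
      by (intro multiples_only_quotient[OF quot(2) _ quot_0]) auto
    then have "d dvd Gcd (set as \<union> set bs)" by (rule Gcd_greatest)
    then show "d = 1" using gcd by simp
  qed
  from cyclic_root.cycles[OF this] show ?thesis by (simp add: inner_base gen_h)
qed

end

section \<open>The three infinite families\<close>

text \<open>Membership is stated as a multiset identity because the entries of a form may cancel:
  for a = 2b the second form reduces to [4b]/[2b, 2b].\<close>

definition family :: "nat multiset \<Rightarrow> nat multiset \<Rightarrow> bool" where
  "family A B \<longleftrightarrow> (\<exists>a b. 0 < a \<and> 0 < b \<and>
     (A + {#a, b#} = B + {#a + b#} \<or>
      b < a \<and> A + {#a, 2 * b, a - b#} = B + {#2 * a, b#} \<or>
      A + {#a, b, a + b#} = B + {#2 * a, 2 * b#}))"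

lemma family_1I: "0 < a \<Longrightarrow> 0 < b \<Longrightarrow> A + {#a, b#} = B + {#a + b#} \<Longrightarrow> family A B"
  and family_2I: "0 < b \<Longrightarrow> b < a \<Longrightarrow> A + {#a, 2 * b, a - b#} = B + {#2 * a, b#} \<Longrightarrow> family A B"
  and family_3I: "0 < a \<Longrightarrow> 0 < b \<Longrightarrow> A + {#a, b, a + b#} = B + {#2 * a, 2 * b#} \<Longrightarrow> family A B"
  unfolding family_def by (metis less_trans)+

lemma one_minus_X_square: "(1 - fps_X ^ k) * (1 + fps_X ^ k) = (1 - fps_X ^ (2 * k) :: real fps)"
proof -
  have "(1 - y) * (1 + y) = 1 - y\<^sup>2" for y :: "real fps"
    by (simp add: power2_eq_square algebra_simps)
  from this[of "fps_X ^ k"] show ?thesis by (simp only: power_mult[symmetric] mult.commute)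
qed

lemma fps_const_minus_1: "fps_const (-1) = (-1 :: real fps)"
  by (simp flip: fps_const_neg)

context ratio begin

lemma quot_unique:
  assumes "mprod C * quot = mprod D" "0 \<notin># C" "0 \<notin># D"
  shows "mset as + D = mset bs + C"
proof (rule mprod_inj)
  have "mprod (mset as) * mprod D = (mprod (mset as) * quot) * mprod C"
    by (simp add: mult_ac flip: assms(1))
  then show "mprod (mset as + D) = mprod (mset bs + C)" by (simp add: mprod_union quot(2))
qed (use assms(2,3) as_pos bs_pos in \<open>auto intro: gr0I\<close>)

text \<open>The denominator has one entry more than the numerator; this count excludes the cycle
  types that are not realised.\<close>

lemma size_eq: "size (mset as + D) = size (mset bs + C) \<Longrightarrow> size D = Suc (size C)"
  using len by simp

text \<open>Each 1 + X^k is rewritten as (1 - X^(2k))/(1 - X^k). Of the four sign patterns one gives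
  the first form, two give the second with the roles of \<open>c\<close> and \<open>n - c\<close>
  exchanged, and one fails the count.\<close>

lemma one_cycle_family:
  assumes "one_cycle quot" shows "family (mset as) (mset bs)"
proof -
  obtain n c and \<epsilon> \<eta> :: real where nc: "0 < c" "c < n" and s: "\<epsilon> \<in> {1, -1}" "\<eta> \<in> {1, -1}" and
    eq: "(1 - fps_const \<epsilon> * fps_X ^ n) * quot =
     (1 + fps_const \<eta> * fps_X ^ c) * (1 + fps_const (\<eta> * \<epsilon>) * fps_X ^ (n - c))"
    using assms unfolding one_cycle_def by blast
  define e where "e = n - c"
  have e: "0 < e" "c + e = n" "n - e = c" "e < n" using nc by (auto simp: e_def)
  consider "\<epsilon> = 1" "\<eta> = -1" | "\<epsilon> = 1" "\<eta> = 1" | "\<epsilon> = -1" "\<eta> = 1" | "\<epsilon> = -1" "\<eta> = -1" using s by auto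
  then show ?thesis
  proof cases
    case 1
    have "mprod {#n#} * quot = mprod {#c, e#}" using eq 1 by (simp add: e_def fps_const_minus_1)
    from quot_unique[OF this] have "mset as + {#c, e#} = mset bs + {#c + e#}" using nc(1) e(1,2) by simp
    with nc(1) e(1) show ?thesis by (rule family_1I)
  next
    case 2
    then have "(1 - fps_X ^ n) * quot = (1 + fps_X ^ c) * (1 + fps_X ^ e)" using eq by (simp add: e_def fps_const_minus_1)
    then have "mprod {#n, c, e#} * quot = ((1 - fps_X ^ c) * (1 + fps_X ^ c)) * ((1 - fps_X ^ e) * (1 + fps_X ^ e))"
      by (simp add: mult_ac)
    then have "mprod {#n, c, e#} * quot = mprod {#2 * c, 2 * e#}" unfolding one_minus_X_square by simp
    \<comment> \<open>Impossible: three entries in the numerator against two in the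
      denominator.\<close>
    from quot_unique[OF this] size_eq[of "{#2 * c, 2 * e#}" "{#n, c, e#}"] show ?thesis using nc e by auto
  next
    case 3
    then have "(1 + fps_X ^ n) * quot = (1 + fps_X ^ c) * (1 - fps_X ^ e)" using eq by (simp add: e_def fps_const_minus_1)
    then have "((1 - fps_X ^ n) * (1 + fps_X ^ n)) * (1 - fps_X ^ c) * quot
        = (1 - fps_X ^ n) * ((1 - fps_X ^ c) * (1 + fps_X ^ c)) * (1 - fps_X ^ e)"
      by (simp add: mult_ac)
    then have "mprod {#2 * n, c#} * quot = mprod {#n, 2 * c, n - c#}"
      unfolding one_minus_X_square by (simp add: mult_ac e_def)
    from quot_unique[OF this] have "mset as + {#n, 2 * c, n - c#} = mset bs + {#2 * n, c#}" using nc by simp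
    with nc show ?thesis by (rule family_2I)
  next
    case 4
    then have "(1 + fps_X ^ n) * quot = (1 - fps_X ^ c) * (1 + fps_X ^ e)" using eq by (simp add: e_def fps_const_minus_1)
    then have "((1 - fps_X ^ n) * (1 + fps_X ^ n)) * (1 - fps_X ^ e) * quot
        = (1 - fps_X ^ n) * ((1 - fps_X ^ e) * (1 + fps_X ^ e)) * (1 - fps_X ^ c)"
      by (simp add: mult_ac)
    then have "mprod {#2 * n, e#} * quot = mprod {#n, 2 * e, n - e#}"
      unfolding one_minus_X_square e(3) by (simp add: mult_ac)
    from quot_unique[OF this] have "mset as + {#n, 2 * e, n - e#} = mset bs + {#2 * n, e#}" using e(1,4) by simp
    with e(1,4) show ?thesis by (rule family_2I)
  qed
qed

text \<open>Only two cycles of sign -1 survive the count; they give the third form.\<close>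

lemma two_cycles_family:
  assumes "two_cycles quot" shows "family (mset as) (mset bs)"
proof -
  have mixed: False
    if nm: "0 < n" "0 < m" and eq: "(1 - fps_X ^ n) * (1 + fps_X ^ m) * quot = 1 + fps_X ^ (n + m)" for n m
  proof -
    have "(1 - fps_X ^ n) * ((1 - fps_X ^ m) * (1 + fps_X ^ m)) * (1 - fps_X ^ (n + m)) * quot
        = (1 - fps_X ^ m) * ((1 - fps_X ^ (n + m)) * (1 + fps_X ^ (n + m)))"
      unfolding eq[symmetric] by (simp only: mult_ac)
    then have "mprod {#n, 2 * m, n + m#} * quot = mprod {#m, 2 * (n + m)#}"
      unfolding one_minus_X_square by (simp add: mult_ac)
    from quot_unique[OF this] size_eq[of "{#m, 2 * (n + m)#}" "{#n, 2 * m, n + m#}"] show False using nm by auto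
  qed
  obtain n m and \<epsilon> \<delta> :: real where nm: "0 < n" "0 < m" and s: "\<epsilon> \<in> {1, -1}" "\<delta> \<in> {1, -1}" and
    eq: "(1 - fps_const \<epsilon> * fps_X ^ n) * (1 - fps_const \<delta> * fps_X ^ m) * quot =
     1 - fps_const (\<epsilon> * \<delta>) * fps_X ^ (n + m)"
    using assms unfolding two_cycles_def by blast
  consider "\<epsilon> = 1" "\<delta> = 1" | "\<epsilon> = 1" "\<delta> = -1" | "\<epsilon> = -1" "\<delta> = 1" | "\<epsilon> = -1" "\<delta> = -1" using s by auto
  then show ?thesis
  proof cases
    case 1
    then have "mprod {#n, m#} * quot = mprod {#n + m#}" using eq by simp
    from quot_unique[OF this] size_eq[of "{#n + m#}" "{#n, m#}"] show ?thesis using nm by auto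
  next
    case 2
    then show ?thesis using mixed[of n m] nm eq by (simp add: fps_const_minus_1)
  next
    case 3
    then show ?thesis using mixed[of m n] nm eq by (simp add: fps_const_minus_1 mult_ac add_ac)
  next
    case 4
    then have eq': "(1 + fps_X ^ n) * (1 + fps_X ^ m) * quot = 1 - fps_X ^ (n + m)" using eq by (simp add: fps_const_minus_1)
    have "((1 - fps_X ^ n) * (1 + fps_X ^ n)) * ((1 - fps_X ^ m) * (1 + fps_X ^ m)) * quot
        = (1 - fps_X ^ n) * (1 - fps_X ^ m) * (1 - fps_X ^ (n + m))"
      unfolding eq'[symmetric] by (simp only: mult_ac)
    then have "mprod {#2 * n, 2 * m#} * quot = mprod {#n, m, n + m#}"
      unfolding one_minus_X_square by (simp add: mult_ac)
    from quot_unique[OF this] have "mset as + {#n, m, n + m#} = mset bs + {#2 * n, 2 * m#}" using nm by simp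
    with nm show ?thesis by (rule family_3I)
  qed
qed

end

lemma prod_fact_mset: "(\<Prod>x\<leftarrow>xs. fact (x * n)) = (\<Prod>x\<in>#mset xs. fact (x * n) :: rat)"
  by (simp add: prod_mset_prod_list flip: mset_map)

lemma factorial_ratio_transfer:
  assumes "mset as + mset ds = mset bs + mset cs"
  shows "factorial_ratio as bs n = factorial_ratio cs ds n"
proof -
  let ?f = "\<lambda>xs. \<Prod>x\<leftarrow>xs. fact (x * n) :: rat"
  have nz: "?f xs \<noteq> 0" for xs by (auto simp: prod_list_zero_iff)
  have "?f as * ?f ds = ?f bs * ?f cs"
    using arg_cong[OF assms, of "\<lambda>M. \<Prod>x\<in>#M. fact (x * n) :: rat"] by (simp add: prod_fact_mset)
  then show ?thesis unfolding factorial_ratio_def using nz[of bs] nz[of ds] by (simp add: field_simps)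
qed

text \<open>As \<open>as\<close> and \<open>bs\<close> are disjoint, their entries survive the
  cancellation and occur in \<open>cs\<close> and \<open>ds\<close>; a common divisor of the latter
  divides all of the former.\<close>

lemma coprime_transfer:
  assumes eq: "mset as + mset ds = mset bs + mset cs" and disj: "set as \<inter> set bs = {}"
    and gcd: "Gcd (set as \<union> set bs) = 1" and g: "\<And>x. x \<in> set cs \<union> set ds \<Longrightarrow> g dvd x"
  shows "g = (1::nat)"
proof -
  have "set as \<union> set ds = set bs \<union> set cs" using arg_cong[OF eq, of set_mset] by simp
  then have "set as \<subseteq> set cs" "set bs \<subseteq> set ds" using disj by auto
  then have "g dvd Gcd (set as \<union> set bs)" using g by (intro Gcd_greatest) auto
  then show ?thesis using gcd by simp
qed

lemma family_forms:
  assumes fam: "family (mset as) (mset bs)" and disj: "set as \<inter> set bs = {}"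
    and gcd: "Gcd (set as \<union> set bs) = 1"
  shows "\<exists>a b :: nat. a > 0 \<and> b > 0 \<and>
      ((coprime a b \<and>
        (\<forall>n. factorial_ratio as bs n =
           fact ((a + b) * n) / (fact (a * n) * fact (b * n)))) \<or>
       (coprime a b \<and> a > b \<and>
        (\<forall>n. factorial_ratio as bs n =
           fact (2 * a * n) * fact (b * n) /
           (fact (a * n) * fact (2 * b * n) * fact ((a - b) * n)))) \<or>
       (coprime a b \<and>
        (\<forall>n. factorial_ratio as bs n =
           fact (2 * a * n) * fact (2 * b * n) /
           (fact (a * n) * fact (b * n) * fact ((a + b) * n)))))"
proof -
  obtain a b where ab: "0 < a" "0 < b" and
    c: "mset as + mset [a, b] = mset bs + mset [a + b] \<or>
      b < a \<and> mset as + mset [a, 2 * b, a - b] = mset bs + mset [2 * a, b] \<or>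
      mset as + mset [a, b, a + b] = mset bs + mset [2 * a, 2 * b]"
    using fam unfolding family_def by auto
  from c show ?thesis
  proof (elim disjE conjE)
    assume e: "mset as + mset [a, b] = mset bs + mset [a + b]"
    have "gcd a b = 1" by (rule coprime_transfer[OF e disj gcd]) auto
    then have "coprime a b" by (simp add: coprime_iff_gcd_eq_1)
    moreover have "\<forall>n. factorial_ratio as bs n = fact ((a + b) * n) / (fact (a * n) * fact (b * n))"
      unfolding factorial_ratio_transfer[OF e] by (simp add: factorial_ratio_def)
    ultimately show ?thesis using ab by blast
  next
    assume ba: "b < a" and e: "mset as + mset [a, 2 * b, a - b] = mset bs + mset [2 * a, b]"
    have "gcd a b = 1" by (rule coprime_transfer[OF e disj gcd]) (auto intro: dvd_diff_nat)
    then have "coprime a b" by (simp add: coprime_iff_gcd_eq_1)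
    moreover have "\<forall>n. factorial_ratio as bs n = fact (2 * a * n) * fact (b * n) /
           (fact (a * n) * fact (2 * b * n) * fact ((a - b) * n))"
      unfolding factorial_ratio_transfer[OF e] by (simp add: factorial_ratio_def mult.assoc)
    ultimately show ?thesis using ab ba by blast
  next
    assume e: "mset as + mset [a, b, a + b] = mset bs + mset [2 * a, 2 * b]"
    have "gcd a b = 1" by (rule coprime_transfer[OF e disj gcd]) auto
    then have "coprime a b" by (simp add: coprime_iff_gcd_eq_1)
    moreover have "\<forall>n. factorial_ratio as bs n = fact (2 * a * n) * fact (2 * b * n) /
           (fact (a * n) * fact (b * n) * fact ((a + b) * n))"
      unfolding factorial_ratio_transfer[OF e] by (simp add: factorial_ratio_def mult.assoc)
    ultimately show ?thesis using ab by blast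
  qed
qed

section \<open>Integrality\<close>

text \<open>Legendre's formula, cut off at an exponent that can be chosen common to several
  factorials.\<close>

lemma multiplicity_fact:
  assumes p: "prime (p::nat)" and "m < p ^ Suc k"
  shows "multiplicity p (fact m :: nat) = (\<Sum>i=1..k. m div p ^ i)"
  using assms(2)
proof (induction m)
  case (Suc m)
  have "Suc m \<noteq> 0" by simp
  have card: "{i \<in> {1..k}. p ^ i dvd Suc m} = {1..multiplicity p (Suc m)}"
  proof -
    have "multiplicity p (Suc m) \<le> k"
    proof (rule ccontr)
      assume "\<not> ?thesis"
      then have "p ^ Suc k dvd Suc m" by (intro multiplicity_dvd') simp
      then show False using Suc.prems dvd_imp_le by fastforce
    qed
    moreover have "p ^ i dvd Suc m \<longleftrightarrow> i \<le> multiplicity p (Suc m)" for i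
      using p by (intro power_dvd_iff_le_multiplicity) (auto simp: prime_gt_1_nat)
    ultimately have "{i \<in> {1..k}. p ^ i dvd Suc m} = {i \<in> {1..k}. i \<le> multiplicity p (Suc m)}"
      "multiplicity p (Suc m) \<le> k" by blast+
    moreover have "{i \<in> {1..k}. i \<le> M} = {1..M}" if "M \<le> k" for M :: nat using that by auto
    ultimately show ?thesis by simp
  qed
  have "multiplicity p (fact (Suc m) :: nat) = multiplicity p (Suc m) + multiplicity p (fact m :: nat)"
    using p by (simp only: fact_Suc of_nat_id, subst prime_elem_multiplicity_mult_distrib) auto
  also have "multiplicity p (Suc m) = (\<Sum>i=1..k. if p ^ i dvd Suc m then 1 else 0)"
    using card by (simp add: sum.If_cases Int_def)
  also have "\<dots> + multiplicity p (fact m :: nat) = (\<Sum>i=1..k. Suc m div p ^ i)"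
    using Suc by (simp add: sum.distrib[symmetric] div_Suc mod_eq_0_iff_dvd cong: if_cong)
      (intro sum.cong; simp)
  finally show ?case .
qed simp

lemma multiplicity_prod_list_fact:
  assumes p: "prime (p::nat)" and k: "\<And>x. x \<in> set xs \<Longrightarrow> x * n < p ^ Suc k"
  shows "multiplicity p (\<Prod>x\<leftarrow>xs. fact (x * n) :: nat) = (\<Sum>i=1..k. \<Sum>x\<leftarrow>xs. x * n div p ^ i)"
  using k
proof (induction xs)
  case (Cons x xs)
  have "(\<Prod>x\<leftarrow>xs. fact (x * n) :: nat) \<noteq> 0" by (auto simp: prod_list_zero_iff)
  then show ?case using Cons p multiplicity_fact[OF p, of "x * n" k]
    by (simp add: prime_elem_multiplicity_mult_distrib sum.distrib)
qed simp

lemma factorial_ratio_Ints_iff: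
  "factorial_ratio as bs n \<in> \<int> \<longleftrightarrow>
    (\<Prod>b\<leftarrow>bs. fact (b * n) :: nat) dvd (\<Prod>a\<leftarrow>as. fact (a * n))"
proof -
  let ?A = "\<Prod>a\<leftarrow>as. fact (a * n) :: nat" and ?B = "\<Prod>b\<leftarrow>bs. fact (b * n) :: nat"
  have of: "(\<Prod>x\<leftarrow>xs. fact (x * n) :: rat) = of_nat (\<Prod>x\<leftarrow>xs. fact (x * n))" for xs
    by (induction xs) simp_all
  have B: "?B \<noteq> 0" by (auto simp: prod_list_zero_iff)
  have eq: "factorial_ratio as bs n = of_nat ?A / of_nat ?B" by (simp only: factorial_ratio_def of)
  show ?thesis
  proof
    assume "?B dvd ?A"
    then obtain c where "?A = ?B * c" by blast
    then have "factorial_ratio as bs n = of_nat c" unfolding eq using B by (simp only: of_nat_mult) simp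
    then show "factorial_ratio as bs n \<in> \<int>" by simp
  next
    assume "factorial_ratio as bs n \<in> \<int>"
    then obtain z where "of_nat ?A / of_nat ?B = (of_int z :: rat)" unfolding eq by (auto elim: Ints_cases)
    then have "(of_nat ?A :: rat) = of_int z * of_nat ?B" using B by (metis nonzero_eq_divide_eq of_nat_eq_0_iff)
    then have "(of_int (int ?A) :: rat) = of_int (z * int ?B)" by (simp only: of_int_of_nat_eq of_int_mult)
    then have "int ?A = z * int ?B" by (simp only: of_int_eq_iff)
    then have "int ?B dvd int ?A" by (metis dvd_triv_right)
    then show "?B dvd ?A" by (simp only: int_dvd_int_iff)
  qed
qed

lemma Landau_sufficient:
  assumes "\<And>d. 0 < d \<Longrightarrow> (\<Sum>b\<leftarrow>bs. b * n div d) \<le> (\<Sum>a\<leftarrow>as. a * n div d)"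
  shows "factorial_ratio as bs n \<in> \<int>"
  unfolding factorial_ratio_Ints_iff
proof (rule multiplicity_le_imp_dvd)
  show "(\<Prod>b\<leftarrow>bs. fact (b * n) :: nat) \<noteq> 0" by (auto simp: prod_list_zero_iff)
  fix p :: nat assume p: "prime p"
  define k where "k = (\<Sum>x\<leftarrow>as @ bs. x * n)"
  have k: "x * n < p ^ Suc k" if "x \<in> set (as @ bs)" for x
  proof -
    have "x * n \<le> k" unfolding k_def using that by (intro member_le_sum_list) auto
    also have "k < 2 ^ k" by (rule less_exp)
    also have "(2::nat) ^ k \<le> p ^ k" using prime_ge_2_nat[OF p] by (rule power_mono) simp
    also have "p ^ k \<le> p ^ Suc k" using prime_ge_1_nat[OF p] by simp
    finally show ?thesis .
  qed
  show "multiplicity p (\<Prod>b\<leftarrow>bs. fact (b * n) :: nat) \<le> multiplicity p (\<Prod>a\<leftarrow>as. fact (a * n) :: nat)"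
    using k assms p by (subst (1 2) multiplicity_prod_list_fact[OF p, where k = k])
      (auto intro!: sum_mono simp: prime_gt_0_nat)
qed

text \<open>Conversely, a violation at \<open>j / N\<close> produces a prime in the denominator: take \<open>n\<close> minimal with
  \<open>n / p \<ge> j / N\<close> for a large prime \<open>p\<close>.\<close>

lemma Landau_necessary:
  assumes int: "\<And>n. factorial_ratio as bs n \<in> \<int>" and j: "j < N"
  shows "(\<Sum>b\<leftarrow>bs. b * j div N) \<le> (\<Sum>a\<leftarrow>as. a * j div N)"
proof -
  define X where "X = sum_list (as @ bs)"
  have X: "x \<le> X" if "x \<in> set (as @ bs)" for x
    unfolding X_def using that by (intro member_le_sum_list) auto
  obtain p where p: "prime p" "N * X + N + X < p" using bigger_prime by blast
  have N0: "0 < N" using j by simp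
  have p0: "0 < p" using p by simp
  define n where "n = (j * p + (N - 1)) div N"
  have n_eq: "n * N + (j * p + (N - 1)) mod N = j * p + (N - 1)" unfolding n_def by simp
  have "(j * p + (N - 1)) mod N < N" using N0 by simp
  then have n: "j * p \<le> n * N" "n * N < j * p + N" using n_eq N0 by linarith+
  have "n * N < p * N"
  proof -
    have "n * N < j * p + p" using n(2) p(2) by simp
    also have "\<dots> = Suc j * p" by simp
    also have "\<dots> \<le> N * p" using j by (intro mult_right_mono) auto
    finally show ?thesis by (simp add: mult.commute)
  qed
  then have np: "n < p" by simp
  \<comment> \<open>With all arguments below p^2, only the first power of \<open>p\<close>
    contributes to Legendre's formula.\<close>
  have small: "x * n < p ^ Suc 1" if x: "x \<in> set (as @ bs)" for x
  proof -
    have "x < p" using X[OF x] p(2) by linarith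
    then have "x * n < p * p" using np by (intro mult_strict_mono') auto
    then show ?thesis by simp
  qed
  \<comment> \<open>Rounding n/p up from j/N costs less than 1/p, and x/p is below 1/N, the least
    distance of x j / N from the next larger integer.\<close>
  have div: "x * n div p = x * j div N" if x: "x \<in> set (as @ bs)" for x
  proof -
    define q where "q = x * j div N"
    have q1: "q * N \<le> x * j" unfolding q_def by simp
    have q2: "x * j < (q + 1) * N" 
      using dividend_less_times_div[OF N0, of "x * j"] by (simp add: q_def algebra_simps)
    have "q * p * N \<le> x * n * N"
    proof -
      have "q * p * N = (q * N) * p" by simp
      also have "\<dots> \<le> (x * j) * p" using q1 by (rule mult_right_mono) simp
      also have "\<dots> = x * (j * p)" by simp
      also have "\<dots> \<le> x * (n * N)" using n(1) by (rule mult_left_mono) simp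
      finally show ?thesis by (simp add: mult.assoc)
    qed
    then have lower: "q * p \<le> x * n" using N0 by simp
    have "x * n * N < (q + 1) * p * N"
    proof -
      have "x * n * N = x * (n * N)" by simp
      also have "\<dots> \<le> x * (j * p + N)" using n(2) by (intro mult_left_mono) auto
      also have "\<dots> = (x * j) * p + x * N" by (simp add: algebra_simps)
      also have "x * N \<le> N * X" using X[OF x] by (simp add: mult.commute)
      then have "(x * j) * p + x * N < (x * j) * p + p" using p(2) by linarith
      also have "\<dots> = Suc (x * j) * p" by simp
      also have "\<dots> \<le> ((q + 1) * N) * p" using q2 by (intro mult_right_mono) auto
      finally show ?thesis by (simp only: mult.assoc mult.commute[of N p])
    qed
    then have "x * n < (q + 1) * p" using mult_less_cancel2 by blast
    then show ?thesis using lower unfolding q_def[symmetric] by (intro div_nat_eqI) (auto simp: mult.commute)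
  qed
  have "(\<Prod>b\<leftarrow>bs. fact (b * n) :: nat) dvd (\<Prod>a\<leftarrow>as. fact (a * n))"
    using int[of n] by (simp only: factorial_ratio_Ints_iff)
  then have "multiplicity p (\<Prod>b\<leftarrow>bs. fact (b * n) :: nat) \<le> multiplicity p (\<Prod>a\<leftarrow>as. fact (a * n) :: nat)"
    by (intro dvd_imp_multiplicity_le) (auto simp: prod_list_zero_iff)
  then have "(\<Sum>b\<leftarrow>bs. b * n div p) \<le> (\<Sum>a\<leftarrow>as. a * n div p)"
    using small multiplicity_prod_list_fact[OF p(1), of as n 1] multiplicity_prod_list_fact[OF p(1), of bs n 1] by simp
  moreover have "(\<Sum>b\<leftarrow>bs. b * n div p) = (\<Sum>b\<leftarrow>bs. b * j div N)" "(\<Sum>a\<leftarrow>as. a * n div p) = (\<Sum>a\<leftarrow>as. a * j div N)"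
    using div by (auto intro!: arg_cong[of _ _ sum_list] map_cong)
  ultimately show ?thesis by simp
qed

text \<open>The step function decreases only at fractions with a denominator in \<open>bs\<close>, so it suffices to
  test those.\<close>

primrec all_below :: "(nat \<Rightarrow> bool) \<Rightarrow> nat \<Rightarrow> bool" where
  "all_below P 0 \<longleftrightarrow> True"
| "all_below P (Suc n) \<longleftrightarrow> P n \<and> all_below P n"

lemma all_belowD: "all_below P n \<Longrightarrow> i < n \<Longrightarrow> P i"
  by (induction n) (auto simp: less_Suc_eq)

definition Landau_check :: "nat list \<Rightarrow> nat list \<Rightarrow> bool" where
  "Landau_check as bs \<longleftrightarrow> list_all (\<lambda>c. all_below (\<lambda>i.
     (\<Sum>b\<leftarrow>bs. b * i div c) \<le> (\<Sum>a\<leftarrow>as. a * i div c)) c) bs"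

lemma Landau_check_sufficient:
  assumes chk: "Landau_check as bs" and pos: "\<forall>b\<in>set bs. 0 < b" and sums: "sum_list as = sum_list bs"
  shows "factorial_ratio as bs n \<in> \<int>"
proof (rule Landau_sufficient)
  fix d :: nat assume d: "0 < d"
  define m where "m = n mod d"
  have red: "(\<Sum>x\<leftarrow>xs. x * n div d) = (\<Sum>x\<leftarrow>xs. x * m div d) + sum_list xs * (n div d)" for xs
  proof (induction xs)
    case (Cons x xs)
    have "x * n = x * m + d * (x * (n div d))" unfolding m_def
      by (metis add_mult_distrib2 mod_mult_div_eq mult.left_commute)
    then have "x * n div d = x * m div d + x * (n div d)" using d by simp
    then show ?case using Cons by (simp add: algebra_simps)
  qed simp
  have md: "m < d" using d by (simp add: m_def)
  have "(\<Sum>b\<leftarrow>bs. b * m div d) \<le> (\<Sum>a\<leftarrow>as. a * m div d)"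
  proof (cases "bs = []")
    case False
    \<comment> \<open>The largest fraction not exceeding m/d with a denominator from
      \<open>bs\<close>, written as i/c below. Moving from m/d down to it leaves all floors
      belonging to \<open>bs\<close> unchanged, while those belonging to \<open>as\<close> can only
      drop.\<close>
    define y where "y = Max ((\<lambda>b. real (b * m div d) / real b) ` set bs)"
    have "y \<in> (\<lambda>b. real (b * m div d) / real b) ` set bs"
      unfolding y_def using False by (intro Max_in) auto
    then obtain c where c: "c \<in> set bs" "y = real (c * m div d) / real c" by blast
    have y: "real (b * m div d) / real b \<le> real (c * m div d) / real c" if "b \<in> set bs" for b
      unfolding c(2)[symmetric] y_def using that by (intro Max_ge) auto
    define i where "i = c * m div d"
    have c0: "0 < c" using pos c by auto
    have "c * m < d * c" using md c0 by simp
    then have ic: "i < c" unfolding i_def by (simp add: less_mult_imp_div_less mult.commute)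
    have di: "i * d \<le> c * m" by (simp add: i_def)
    have down: "x * i div c \<le> x * m div d" for x
    proof -
      have "(x * i div c) * d * c \<le> x * m * c"
      proof -
        have "(x * i div c) * d * c = (x * i div c * c) * d" by simp
        also have "\<dots> \<le> x * i * d" by (intro mult_right_mono) auto
        also have "\<dots> \<le> x * (c * m)" using di by (simp add: mult.assoc)
        finally show ?thesis by (simp add: mult_ac)
      qed
      then show ?thesis using c0 d by (simp add: less_eq_div_iff_mult_less_eq)
    qed
    have same: "b * m div d \<le> b * i div c" if b: "b \<in> set bs" for b
    proof -
      have b0: "0 < b" using pos b by auto
      have "real (b * m div d) * real c \<le> real i * real b"
        using y[OF b] b0 c0 by (simp add: i_def field_simps)
      then have "(b * m div d) * c \<le> i * b" by (metis of_nat_le_iff of_nat_mult)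
      then show ?thesis using c0 by (simp add: less_eq_div_iff_mult_less_eq mult.commute)
    qed
    have "(\<Sum>b\<leftarrow>bs. b * m div d) \<le> (\<Sum>b\<leftarrow>bs. b * i div c)" by (intro sum_list_mono same)
    also have "\<dots> \<le> (\<Sum>a\<leftarrow>as. a * i div c)" 
      using chk c(1) ic unfolding Landau_check_def list_all_iff
      by (auto dest!: bspec[where x = c] dest: all_belowD)
    also have "\<dots> \<le> (\<Sum>a\<leftarrow>as. a * m div d)" by (intro sum_list_mono down)
    finally show ?thesis .
  qed simp
  then show "(\<Sum>b\<leftarrow>bs. b * n div d) \<le> (\<Sum>a\<leftarrow>as. a * n div d)" by (simp add: red sums)
qed

lemma factorial_ratio_cong:
  assumes "mset as = mset as'" "mset bs = mset bs'"
  shows "factorial_ratio as bs n = factorial_ratio as' bs' n"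
proof -
  have "(\<Prod>x\<leftarrow>xs. fact (x * n) :: rat) = (\<Prod>x\<in>#mset xs. fact (x * n))" for xs
    by (simp add: prod_mset_prod_list flip: mset_map)
  then show ?thesis by (simp add: factorial_ratio_def assms)
qed

lemma all_below_numeral:
  "all_below P (numeral k) \<longleftrightarrow> P (pred_numeral k) \<and> all_below P (pred_numeral k)"
  by (simp add: numeral_eq_Suc)

lemma sporadic_Ints:
  assumes "(as, bs) \<in> sporadic_parameters" shows "factorial_ratio as bs n \<in> \<int>"
proof (rule Landau_check_sufficient)
  define Q where "Q = (\<lambda>as bs. Landau_check as bs \<and> list_all ((<) 0) bs \<and> sum_list as = sum_list bs)"
  have "\<forall>x\<in>sporadic_parameters. Q (fst x) (snd x)"
    unfolding sporadic_parameters_def Q_def by (simp add: Landau_check_def all_below_numeral)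
  then have "Q as bs" using assms by fastforce
  then show "Landau_check as bs" "\<forall>b\<in>set bs. 0 < b" "sum_list as = sum_list bs"
    unfolding Q_def list_all_iff by blast+
qed

lemma form_1_Ints: "factorial_ratio [a + b] [a, b] n \<in> \<int>"
  by (rule Landau_sufficient) (simp add: add_mult_distrib div_add1_eq[of "a * n" "b * n"])

text \<open>Splits off the integral parts, so that the two-parameter forms only require inequalities
  between remainders.\<close>

lemma div_reduce:
  fixes d x y :: nat
  assumes "0 < d"
  shows "(2 * x + 2 * y) div d = 2 * (x div d) + 2 * (y div d) + (2 * (x mod d) + 2 * (y mod d)) div d"
    "(x + y) div d = x div d + y div d + (x mod d + y mod d) div d"
    "2 * x div d = 2 * (x div d) + 2 * (x mod d) div d"
proof -
  have e: "2 * (d * X + r) + 2 * (d * Y + s) = (2 * r + 2 * s) + d * (2 * X + 2 * Y)"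
    "(d * X + r) + (d * Y + s) = (r + s) + d * (X + Y)" "2 * (d * X + r) = 2 * r + d * (2 * X)"
    for X Y r s :: nat by (simp_all add: algebra_simps)
  note e' = e(1,2)[of "x div d" "x mod d" "y div d" "y mod d", unfolded mult_div_mod_eq]
    e(3)[of "x div d" "x mod d", unfolded mult_div_mod_eq]
  show "(2 * x + 2 * y) div d = 2 * (x div d) + 2 * (y div d) + (2 * (x mod d) + 2 * (y mod d)) div d"
    by (subst e'(1)) (use assms in simp)
  show "(x + y) div d = x div d + y div d + (x mod d + y mod d) div d"
    by (subst e'(2)) (use assms in simp)
  show "2 * x div d = 2 * (x div d) + 2 * (x mod d) div d"
    by (subst e'(3)) (use assms in simp)
qed

lemma le_div_nat: "0 < d \<Longrightarrow> k * d \<le> x \<Longrightarrow> k \<le> x div (d::nat)"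
  by (simp add: less_eq_div_iff_mult_less_eq)

lemma div_small:
  fixes d x :: nat
  assumes "x < 2 * d" shows "x div d = (if d \<le> x then 1 else 0)"
  using assms by (auto intro: div_nat_eqI)

text \<open>With x = bn and y = (a-b)n, and r, s the remainders, everything reduces to [r+s] + [2r]
  \<le> [2r+2s] for the floors after division by d.\<close>

lemma form_2_Ints:
  assumes "b < a" shows "factorial_ratio [2 * a, b] [a, 2 * b, a - b] n \<in> \<int>"
proof (rule Landau_sufficient)
  fix d :: nat assume d: "0 < d"
  define x y where "x = b * n" and "y = (a - b) * n"
  have a: "a * n = x + y" using assms by (simp add: x_def y_def flip: add_mult_distrib)
  define r s where "r = x mod d" and "s = y mod d"
  have rs: "r < d" "s < d" using d by (simp_all add: r_def s_def)
  have "(r + s) div d + 2 * r div d \<le> (2 * r + 2 * s) div d"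
  proof -
    have le: "(r + s) div d \<le> 1" "2 * r div d \<le> 1"
      using div_small[of "r + s" d] div_small[of "2 * r" d] rs by simp_all
    consider "d \<le> r + s" | "r + s < d" "d \<le> 2 * r" | "r + s < d" "2 * r < d" by linarith
    then show ?thesis
    proof cases
      case 1
      then have "2 \<le> (2 * r + 2 * s) div d" by (intro le_div_nat[OF d]) linarith
      then show ?thesis using le by linarith
    next
      case 2
      then have "1 \<le> (2 * r + 2 * s) div d" by (intro le_div_nat[OF d]) linarith
      moreover have "(r + s) div d = 0" using 2(1) by (rule div_less)
      ultimately show ?thesis using le by linarith
    next
      case 3
      then have "(r + s) div d = 0" "2 * r div d = 0" by (simp_all only: div_less)
      then show ?thesis by linarith
    qed
  qed
  then have "(x + y) div d + 2 * x div d + y div d \<le> (2 * x + 2 * y) div d + x div d"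
    using div_reduce(1)[OF d, of x y] div_reduce(2)[OF d, of x y] div_reduce(3)[OF d, of x]
    unfolding r_def[symmetric] s_def[symmetric] by linarith
  moreover have "2 * a * n = 2 * x + 2 * y" "2 * b * n = 2 * x" "(a - b) * n = y" "b * n = x"
    using a by (simp_all only: x_def y_def mult.assoc distrib_left)
  ultimately show "(\<Sum>b\<leftarrow>[a, 2 * b, a - b]. b * n div d) \<le> (\<Sum>a\<leftarrow>[2 * a, b]. a * n div d)"
    unfolding list.map sum_list.Cons sum_list.Nil by (simp only: a)
qed

text \<open>Reduces to [r+s] \<le> [2r] + [2s]: if the remainders add up to at least d, one of them
  is at least d/2.\<close>

lemma form_3_Ints: "factorial_ratio [2 * a, 2 * b] [a, b, a + b] n \<in> \<int>"
proof (rule Landau_sufficient)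
  fix d :: nat assume d: "0 < d"
  define x y where "x = a * n" and "y = b * n"
  define r s where "r = x mod d" and "s = y mod d"
  have rs: "r < d" "s < d" using d by (simp_all add: r_def s_def)
  have "(r + s) div d \<le> 2 * r div d + 2 * s div d"
  proof (cases "d \<le> r + s")
    case True
    then have "1 * d \<le> 2 * r \<or> 1 * d \<le> 2 * s" by linarith
    then have "1 \<le> 2 * r div d + 2 * s div d"
      using le_div_nat[OF d, of 1 "2 * r"] le_div_nat[OF d, of 1 "2 * s"] by linarith
    moreover have "(r + s) div d \<le> 1" using div_small[of "r + s" d] rs by simp
    ultimately show ?thesis by linarith
  next
    case False
    then have "(r + s) div d = 0" by (intro div_less) linarith
    then show ?thesis by linarith
  qed
  then have "x div d + y div d + (x + y) div d \<le> 2 * x div d + 2 * y div d"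
    using div_reduce(2)[OF d, of x y] div_reduce(3)[OF d, of x] div_reduce(3)[OF d, of y]
    unfolding r_def[symmetric] s_def[symmetric] by linarith
  moreover have "2 * a * n = 2 * x" "2 * b * n = 2 * y" "(a + b) * n = x + y" "a * n = x" "b * n = y"
    by (simp_all only: x_def y_def mult.assoc add_mult_distrib)
  ultimately show "(\<Sum>b\<leftarrow>[a, b, a + b]. b * n div d) \<le> (\<Sum>a\<leftarrow>[2 * a, 2 * b]. a * n div d)"
    unfolding list.map sum_list.Cons sum_list.Nil by (simp only:)
qed

section \<open>Ratios of small rank\<close>

text \<open>The orders d with totient at most 8, in other words those with cyclotomic polynomial of
  degree at most 8.\<close>

definition small_orders :: "nat list" where
  "small_orders = [1, 2, 3, 4, 5, 6, 7, 8, 9, 10, 12, 14, 15, 16, 18, 20, 24, 30]"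

text \<open>Since p \<le> 2(p-1), the prime power is at most twice its totient, hence at most 16.
  Apart from 11 and 13, all prime powers up to 16 divide 5040 = 16 * 9 * 5 * 7.\<close>

lemma prime_power_totient_le_8:
  assumes p: "prime (p::nat)" and k: "0 < k" and le: "totient (p ^ k) \<le> 8"
  shows "p ^ k dvd 5040"
proof -
  have t: "totient (p ^ k) = p ^ (k - 1) * (p - 1)" using p k by (rule totient_prime_power)
  have p2: "2 \<le> p" using p by (rule prime_ge_2_nat)
  have pk: "p ^ k = p ^ (k - 1) * p" using k by (cases k) auto
  have "p ^ (k - 1) * p \<le> p ^ (k - 1) * (2 * (p - 1))" using p2 by (intro mult_left_mono) auto
  then have "p ^ (k - 1) * p \<le> 2 * (p ^ (k - 1) * (p - 1))" by (simp only: mult.left_commute)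
  then have le16: "p ^ k \<le> 16" using t le pk by linarith
  have "p ^ k \<noteq> 11" "p ^ k \<noteq> 13"
  proof -
    have "prime (11::nat)" "prime (13::nat)" by simp_all
    then show "p ^ k \<noteq> 11" "p ^ k \<noteq> 13" using le totient_prime[of 11] totient_prime[of 13] by auto
  qed
  moreover have "p ^ k \<noteq> 0" using p2 by simp
  moreover have "n = 11 \<or> n = 13 \<or> n dvd 5040" if "n \<noteq> 0" "n \<le> 16" for n :: nat
  proof -
    have "n = 1 \<or> n = 2 \<or> n = 3 \<or> n = 4 \<or> n = 5 \<or> n = 6 \<or> n = 7 \<or> n = 8 \<or> n = 9 \<or> n = 10 \<or> n = 11
      \<or> n = 12 \<or> n = 13 \<or> n = 14 \<or> n = 15 \<or> n = 16" using that by presburger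
    then show ?thesis by (elim disjE) simp_all
  qed
  ultimately show ?thesis using le16 by blast
qed

text \<open>The eight exceptional numbers are the minimal divisors of 5040 with totient above
  8.\<close>

lemma divisors_5040:
  fixes w x y z :: nat
  assumes "w \<in> {1, 2, 4, 8, 16}" "x \<in> {1, 3, 9}" "y \<in> {1, 5}" "z \<in> {1, 7}"
  shows "w * (x * (y * z)) \<in> set small_orders \<or>
    (\<exists>m\<in>{35, 21, 28, 36, 40, 45, 48, 60}. m dvd w * (x * (y * z)))"
  using assms unfolding small_orders_def by (elim insertE emptyE) simp_all

lemma totient_le_8:
  assumes d: "0 < d" and t: "totient d \<le> 8" shows "d \<in> set small_orders"
proof -
  have mono: "totient m \<le> 8" if "m dvd d" for m using totient_dvd_mono[OF that d] t by simp
  have "d dvd 5040"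
  proof (rule multiplicity_le_imp_dvd)
    show "d \<noteq> 0" using d by simp
    fix p :: nat assume p: "prime p"
    show "multiplicity p d \<le> multiplicity p 5040"
    proof (cases "multiplicity p d = 0")
      case False
      have "p ^ multiplicity p d dvd 5040"
        using False mono[OF multiplicity_dvd] by (intro prime_power_totient_le_8[OF p]) auto
      then show ?thesis by (intro multiplicity_geI) (use p in auto)
    qed simp
  qed
  then have "d dvd 16 * (9 * (5 * 7))" by simp
  then obtain w x y z where d_eq: "d = w * (x * (y * z))" and dv: "w dvd 16" "x dvd 9" "y dvd 5" "z dvd 7"
    by (metis division_decomp)
  have "w \<in> {1, 2, 4, 8, 16}"
  proof -
    have "w dvd 2 ^ 4" using dv(1) by simp
    then obtain i where "i \<le> 4" "w = 2 ^ i" using divides_primepow_nat[of 2 w 4] by auto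
    moreover from \<open>i \<le> 4\<close> have "i = 0 \<or> i = 1 \<or> i = 2 \<or> i = 3 \<or> i = 4" by linarith
    ultimately show ?thesis by (elim disjE) simp_all
  qed
  moreover have "x \<in> {1, 3, 9}"
  proof -
    have "x dvd 3 ^ 2" using dv(2) by simp
    then obtain i where "i \<le> 2" "x = 3 ^ i" using divides_primepow_nat[of 3 x 2] by auto
    moreover from \<open>i \<le> 2\<close> have "i = 0 \<or> i = 1 \<or> i = 2" by linarith
    ultimately show ?thesis by (elim disjE) simp_all
  qed
  moreover have "y \<in> {1, 5}" "z \<in> {1, 7}"
    using dv(3,4) prime_nat_iff[of 5] prime_nat_iff[of 7] by auto
  moreover have "\<not> m dvd d" if "m \<in> {35, 21, 28, 36, 40, 45, 48, 60}" for m
  proof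
    assume "m dvd d"
    from mono[OF this] have "totient m \<le> 8" .
    moreover have "coprime 5 (7::nat)" "coprime 3 (7::nat)" "coprime 4 (7::nat)" "coprime 4 (9::nat)"
      "coprime 8 (5::nat)" "coprime 9 (5::nat)" "coprime 16 (3::nat)" "coprime 4 (15::nat)" "coprime 3 (5::nat)"
      by (simp_all add: coprime_iff_gcd_eq_1 gcd_non_0_nat)
    then have "totient (5 * 7) = totient 5 * totient 7" "totient (3 * 7) = totient 3 * totient 7"
      "totient (4 * 7) = totient 4 * totient 7" "totient (4 * 9) = totient 4 * totient 9"
      "totient (8 * 5) = totient 8 * totient 5" "totient (9 * 5) = totient 9 * totient 5"
      "totient (16 * 3) = totient 16 * totient 3" "totient (4 * 15) = totient 4 * totient 15"
      "totient (3 * 5) = totient 3 * totient 5"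
      by (simp_all only: totient_mult_coprime)
    moreover have "totient 3 = 2" "totient 5 = 4" "totient 7 = 6"
      using totient_prime[of 3] totient_prime[of 5] totient_prime[of 7] by simp_all
    moreover have "totient 9 = 6" "totient 8 = 4" "totient 16 = 8"
      using totient_prime_power[of 3 2] totient_prime_power[of 2 3] totient_prime_power[of 2 4] by simp_all
    ultimately show False using that by auto
  qed
  ultimately show ?thesis using divisors_5040[of w x y z] unfolding d_eq by blast
qed

section \<open>Cyclotomic exponents and the step function by orders\<close>

text \<open>The exponent of the d-th cyclotomic polynomial in the product of the 1 - X^a divided by
  that of the 1 - X^b.\<close>

definition esig :: "nat list \<Rightarrow> nat list \<Rightarrow> nat \<Rightarrow> int" where
  "esig as bs d = int (length (filter (\<lambda>x. d dvd x) as)) - int (length (filter (\<lambda>x. d dvd x) bs))"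

text \<open>The number of primitive d-th roots of unity exp(2 pi i u / d) with 0 < u/d \<le>
  p/q.\<close>

definition tcount :: "nat \<Rightarrow> nat \<Rightarrow> nat \<Rightarrow> nat" where
  "tcount d p q = length (filter (\<lambda>u. coprime u d \<and> u * q \<le> p * d) [1..<Suc d])"

lemma tcount_card: "tcount d p q = card {u \<in> {1..d}. coprime u d \<and> u * q \<le> p * d}"
proof -
  have "tcount d p q = card (set (filter (\<lambda>u. coprime u d \<and> u * q \<le> p * d) [1..<Suc d]))"
    unfolding tcount_def by (intro distinct_card[symmetric] distinct_filter distinct_upt)
  also have "set (filter (\<lambda>u. coprime u d \<and> u * q \<le> p * d) [1..<Suc d]) = {u \<in> {1..d}. coprime u d \<and> u * q \<le> p * d}"
    by auto
  finally show ?thesis .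
qed

lemma tcount_totient: "0 < d \<Longrightarrow> tcount d 1 1 = totient d"
  unfolding tcount_card totient_def totatives_def by (intro arg_cong[of _ _ card]) auto

context ratio begin

abbreviation e :: "nat \<Rightarrow> int" where "e \<equiv> esig as bs"

text \<open>exp(2 pi i k / N) has order \<open>N div gcd k N\<close>, and its multiplicity as a zero
  depends on the order alone.\<close>

lemma jump_esig: "k \<noteq> 0 \<Longrightarrow> jump k = e (N div gcd k N)"
proof -
  assume "k \<noteq> 0"
  have "N dvd x * k \<longleftrightarrow> (N div gcd k N) dvd x" for x
  proof -
    define g where "g = gcd k N"
    obtain k' N' where kN: "k = g * k'" "N = g * N'" unfolding g_def by (metis gcd_dvd1 gcd_dvd2 dvdE)
    have g0: "0 < g" using N_pos kN(2) by (auto intro: gr0I)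
    have "coprime k' N'"
      using div_gcd_coprime[of k N] kN g0 N_pos by (metis g_def less_not_refl nonzero_mult_div_cancel_left)
    then have "N' dvd x * k' \<longleftrightarrow> N' dvd x" by (simp add: coprime_commute coprime_dvd_mult_left_iff)
    moreover have "N dvd x * k \<longleftrightarrow> N' dvd x * k'" using g0 by (simp add: kN mult.left_commute)
    moreover have "N div g = N'" using g0 by (subst kN(2)) simp
    ultimately show ?thesis unfolding g_def by simp
  qed
  then show ?thesis by (simp add: jump_def ord_at_def esig_def)
qed

lemma card_order:
  assumes d: "d dvd N" and q: "0 < q"
  shows "card {k \<in> {0<..N * p div q}. k \<le> N \<and> N div gcd k N = d} = tcount d p q"
proof -
  obtain m where m: "N = m * d" using d by (metis dvdE mult.commute)
  have "0 < m * d" using N_pos m by simp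
  then have pos: "0 < m" "0 < d" by simp_all
  have gcd_eq: "gcd (m * u) N = m * gcd u d" for u by (subst m) (rule gcd_mult_distrib_nat[symmetric])
  have "{k \<in> {0<..N * p div q}. k \<le> N \<and> N div gcd k N = d} = (\<lambda>u. m * u) ` {u \<in> {1..d}. coprime u d \<and> u * q \<le> p * d}"
    (is "?L = ?R")
  proof (intro set_eqI iffI)
    fix k assume k: "k \<in> ?L"
    then have "N div gcd k N = d" by blast
    then have "gcd k N * d = N" using dvd_mult_div_cancel[OF gcd_dvd2[of k N]] by (simp only:)
    then have "gcd k N * d = m * d" using m by (rule trans)
    then have g: "gcd k N = m" using pos(2) by simp
    have "m dvd k" using gcd_dvd1[of k N] unfolding g .
    then obtain u where u: "k = m * u" by (rule dvdE)
    have "coprime u d" using g[unfolded u gcd_eq] pos(1) by (simp add: coprime_iff_gcd_eq_1)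
    moreover have "0 < k" "k \<le> N" using k by auto
    then have "0 < m * u" "m * u \<le> m * d" using u m by (simp_all only:)
    then have "1 \<le> u" "u \<le> d" using pos(1) by (simp_all add: Suc_le_eq)
    moreover have "u * q \<le> p * d"
    proof -
      have "k * q \<le> N * p" using k q by (simp add: less_eq_div_iff_mult_less_eq)
      then have "m * (u * q) \<le> m * (p * d)" unfolding u by (subst (asm) m) (simp only: mult_ac)
      then show ?thesis using pos by simp
    qed
    ultimately show "k \<in> ?R" using u by auto
  next
    fix k assume "k \<in> ?R"
    then obtain u where u: "k = m * u" "1 \<le> u" "u \<le> d" "coprime u d" "u * q \<le> p * d" by auto
    have "gcd k N = m" using u(4) unfolding u(1) gcd_eq by (simp add: coprime_iff_gcd_eq_1)
    then have "N div gcd k N = d" by (simp only:) (subst m, use pos in simp)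
    moreover have "m * (u * q) \<le> m * (p * d)" using u(5) by (rule mult_left_mono) simp
    then have "k * q \<le> N * p" unfolding u(1) by (subst m) (simp only: mult_ac)
    then have "k \<le> N * p div q" using q by (simp add: less_eq_div_iff_mult_less_eq)
    moreover have "0 < k" using u(1,2) pos by simp
    moreover have "m * u \<le> m * d" using u(3) by (rule mult_left_mono) simp
    then have "k \<le> N" unfolding u(1) by (subst m)
    ultimately show "k \<in> ?L" by auto
  qed
  moreover have "inj_on (\<lambda>u. m * u) {u \<in> {1..d}. coprime u d \<and> u * q \<le> p * d}" using pos by (auto intro: inj_onI)
  ultimately show ?thesis by (simp add: card_image tcount_card)
qed

text \<open>Grouping the indices up to N p / q by order replaces positions, which depend on
  \<open>N\<close>, by counts that do not.\<close>

lemma sum_orders: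
  fixes f :: "nat \<Rightarrow> int"
  assumes q: "0 < q" and pq: "p \<le> q"
  shows "(\<Sum>k\<in>{0<..N * p div q}. f (N div gcd k N)) = (\<Sum>d | d dvd N. f d * int (tcount d p q))"
proof -
  have le: "k \<le> N" if "k \<le> N * p div q" for k
  proof -
    have "N * p div q \<le> N * q div q" using pq by (intro div_le_mono) simp
    then show ?thesis using that q by simp
  qed
  have fin: "finite {d. d dvd N}" using N_pos by simp
  have "(\<Sum>k\<in>{0<..N * p div q}. f (N div gcd k N)) =
      (\<Sum>d | d dvd N. \<Sum>k\<in>{k \<in> {0<..N * p div q}. N div gcd k N = d}. f (N div gcd k N))"
    by (intro sum.group[symmetric] fin) (auto intro: div_dvd_iff_mult[THEN iffD2])
  also have "\<dots> = (\<Sum>d | d dvd N. f d * int (tcount d p q))"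
  proof (rule sum.cong)
    fix d assume "d \<in> {d. d dvd N}"
    then have d: "d dvd N" by simp
    have "{k \<in> {0<..N * p div q}. N div gcd k N = d} = {k \<in> {0<..N * p div q}. k \<le> N \<and> N div gcd k N = d}"
      using le by auto
    then have "card {k \<in> {0<..N * p div q}. N div gcd k N = d} = tcount d p q"
      using card_order[OF d q] by simp
    then show "(\<Sum>k\<in>{k \<in> {0<..N * p div q}. N div gcd k N = d}. f (N div gcd k N)) = f d * int (tcount d p q)"
      by simp
  qed simp
  finally show ?thesis .
qed

lemma esig_support: "e d \<noteq> 0 \<Longrightarrow> d dvd N"
proof -
  assume "e d \<noteq> 0"
  have "(\<exists>x\<in>set as. d dvd x) \<or> (\<exists>x\<in>set bs. d dvd x)"
  proof (rule ccontr)
    assume "\<not> ?thesis"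
    then have "filter (\<lambda>x. d dvd x) as = []" "filter (\<lambda>x. d dvd x) bs = []"
      by (auto simp: filter_empty_conv)
    then show False using \<open>e d \<noteq> 0\<close> by (simp add: esig_def)
  qed
  then show ?thesis using as_dvd bs_dvd dvd_trans by blast
qed

text \<open>Index \<open>N\<close> replaces index 0 as the representative of the root 1, to match
  the range 1..d in \<open>tcount\<close>.\<close>

lemma JA_alt: "JA = {k \<in> {0<..N}. jump k = 1}" and card_JB_alt: "card JB = card {k \<in> {0<..N}. jump k = -1}"
proof -
  have jN: "jump N = -1" using jump_sym[of 0] jump_0 by simp
  show "JA = {k \<in> {0<..N}. jump k = 1}"
    using zero_J(1) jN by (auto simp: JA_def order_le_less intro: gr0I)
  have "{k \<in> {0<..N}. jump k = -1} = insert N (JB - {0})"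
    using jN N_pos by (auto simp: JB_def order_le_less)
  moreover have "N \<notin> JB - {0}" by (simp add: JB_def)
  ultimately show "card JB = card {k \<in> {0<..N}. jump k = -1}"
    using card_Suc_Diff1[OF finite_J(2) zero_J(2)] finite_J(2) by simp
qed

lemma card_jump:
  "card {k \<in> {0<..N}. jump k = c} = (\<Sum>d | d dvd N. of_bool (e d = c) * tcount d 1 1)"
proof -
  have "int (card {k \<in> {0<..N}. jump k = c}) = (\<Sum>k\<in>{0<..N}. of_bool (jump k = c))"
    by (simp add: of_bool_def sum.If_cases Int_def)
  also have "\<dots> = (\<Sum>k\<in>{0<..N * 1 div 1}. of_bool (e (N div gcd k N) = c))"
    by (intro sum.cong) (auto simp: jump_esig)
  also have "\<dots> = (\<Sum>d | d dvd N. of_bool (e d = c) * int (tcount d 1 1))"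
    by (rule sum_orders) auto
  finally have "int (card {k \<in> {0<..N}. jump k = c}) = int (\<Sum>d | d dvd N. of_bool (e d = c) * tcount d 1 1)"
    by (simp only: of_nat_sum of_nat_mult of_nat_of_bool)
  then show ?thesis by (simp only: of_nat_eq_iff)
qed

text \<open>The order \<open>d\<close> is realised by the index N/d, so the exponent is one of the
  jumps.\<close>

lemma esig_cases: "e d \<in> {-1, 0, 1}"
proof (cases "d dvd N")
  case True
  then obtain m where m: "N = m * d" by (metis dvdE mult.commute)
  have "0 < m * d" using N_pos m by simp
  then have "0 < m" "0 < d" by simp_all
  then have m0: "0 < m" "m \<le> N" by (simp, subst m, simp)
  have "gcd m N = m" by (subst m) simp
  then have "N div gcd m N = d" by (simp only:) (subst m, use m0 in simp)
  then have "jump m = e d" using jump_esig[of m] m0 by simp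
  moreover have "jump m \<in> {-1, 0, 1}"
    using jump_cases[of m] m0(2) jump_sym[of 0] jump_0 by (cases "m = N") auto
  ultimately show ?thesis by simp
qed (use esig_support in auto)

end

locale small_ratio = ratio +
  assumes small: "card JA \<le> 8"
begin

text \<open>All primitive d-th roots of unity have the same jump, so a non-zero exponent places
  \<open>totient d\<close> elements in \<open>JA\<close> or in \<open>JB\<close>, each of which has
  at most 8.\<close>

lemma esig_small: "e d \<noteq> 0 \<Longrightarrow> d \<in> set small_orders"
proof -
  assume e0: "e d \<noteq> 0"
  then have d: "d dvd N" by (rule esig_support)
  then have d0: "0 < d" using N_pos by (auto intro: gr0I)
  have fin: "finite {d. d dvd N}" using N_pos by simp
  have "of_bool (e d = c) * tcount d 1 1 \<le> (\<Sum>d | d dvd N. of_bool (e d = c) * tcount d 1 1)" for c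
    using d by (intro member_le_sum fin) auto
  from this[of "e d"] have le: "tcount d 1 1 \<le> card {k \<in> {0<..N}. jump k = e d}"
    unfolding card_jump by simp
  have "e d = 1 \<or> e d = -1" using esig_cases[of d] e0 by auto
  then have "card {k \<in> {0<..N}. jump k = e d} = card JA"
    using card_JB_alt card_J by (elim disjE) (simp_all only: JA_alt[symmetric])
  with le have "tcount d 1 1 \<le> card JA" by (simp only:)
  then show ?thesis using small tcount_totient[OF d0] totient_le_8[OF d0] by simp
qed

definition oA where "oA = filter (\<lambda>d. e d = 1) small_orders"
definition oB where "oB = filter (\<lambda>d. e d = -1) small_orders"

lemma distinct_small: "distinct small_orders" by (simp add: small_orders_def)

lemma sum_esig:
  fixes f :: "int \<Rightarrow> nat \<Rightarrow> int"
  assumes f: "\<And>d. f 0 d = 0"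
  shows "(\<Sum>d | d dvd N. f (e d) d) = (\<Sum>d\<leftarrow>oA. f 1 d) + (\<Sum>d\<leftarrow>oB. f (-1) d)"
proof -
  have fin: "finite {d. d dvd N}" using N_pos by simp
  have z: "f (e d) d = 0" if "d \<notin> set small_orders" for d using esig_small[of d] that f by (cases "e d = 0") auto
  have "(\<Sum>d | d dvd N. f (e d) d) = (\<Sum>d\<in>set small_orders. f (e d) d)"
    using fin esig_support f z by (intro sum.mono_neutral_cong) (auto, metis)
  also have "\<dots> = (\<Sum>d\<leftarrow>small_orders. f (e d) d)" by (rule sum.distinct_set_conv_list[OF distinct_small])
  also have "(\<Sum>d\<leftarrow>xs. f (e d) d) = (\<Sum>d\<leftarrow>filter (\<lambda>d. e d = 1) xs. f 1 d) + (\<Sum>d\<leftarrow>filter (\<lambda>d. e d = -1) xs. f (-1) d)" for xs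
  proof (induction xs)
    case (Cons x xs)
    then show ?case using esig_cases[of x] f by auto
  qed simp
  finally show ?thesis by (simp add: oA_def oB_def)
qed

lemma weight_oA: "(\<Sum>d\<leftarrow>oA. tcount d 1 1) = card JA"
  and weight_oB: "(\<Sum>d\<leftarrow>oB. tcount d 1 1) = card JA"
proof -
  have i: "int (\<Sum>d\<leftarrow>xs. f d) = (\<Sum>d\<leftarrow>xs. int (f d))" for f :: "nat \<Rightarrow> nat" and xs
    by (induction xs) auto
  have "int (card {k \<in> {0<..N}. jump k = c}) = (\<Sum>d | d dvd N. of_bool (e d = c) * int (tcount d 1 1))" for c
    by (simp only: card_jump of_nat_sum of_nat_mult of_nat_of_bool)
  from this[of 1] this[of "-1"]
  have "int (card {k \<in> {0<..N}. jump k = 1}) = int (\<Sum>d\<leftarrow>oA. tcount d 1 1)"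
    "int (card {k \<in> {0<..N}. jump k = -1}) = int (\<Sum>d\<leftarrow>oB. tcount d 1 1)"
    using sum_esig[of "\<lambda>x d. of_bool (x = 1) * int (tcount d 1 1)"] sum_esig[of "\<lambda>x d. of_bool (x = -1) * int (tcount d 1 1)"]
    by (simp_all add: i)
  then show "(\<Sum>d\<leftarrow>oA. tcount d 1 1) = card JA" "(\<Sum>d\<leftarrow>oB. tcount d 1 1) = card JA"
    using JA_alt card_JB_alt card_J by auto
qed

text \<open>The alternation of zeros and poles, tested at p/q and expressed through orders only: the
  common multiple \<open>N\<close> has disappeared.\<close>

lemma step_test:
  assumes "0 < q" "p < q"
  shows "(\<Sum>d\<leftarrow>oA. tcount d p q) = (\<Sum>d\<leftarrow>oB. tcount d p q) \<or> (\<Sum>d\<leftarrow>oA. tcount d p q) = Suc (\<Sum>d\<leftarrow>oB. tcount d p q)"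
proof -
  define j where "j = N * p div q"
  have "N * p < N * q" using assms N_pos by simp
  then have j: "j < N" unfolding j_def using assms by (simp add: less_mult_imp_div_less)
  have i: "int (\<Sum>d\<leftarrow>xs. tcount d p q) = (\<Sum>d\<leftarrow>xs. int (tcount d p q))" for xs by (induction xs) auto
  have neg: "(\<Sum>d\<leftarrow>xs. - int (tcount d p q)) = - (\<Sum>d\<leftarrow>xs. int (tcount d p q))" for xs by (induction xs) auto
  have "step j = (\<Sum>k\<in>{0<..j}. jump k)" using step_telescope[of 0 j] step_0 by simp
  also have "\<dots> = (\<Sum>k\<in>{0<..N * p div q}. e (N div gcd k N))"
    unfolding j_def by (intro sum.cong) (auto simp: jump_esig)
  also have "\<dots> = (\<Sum>d | d dvd N. e d * int (tcount d p q))" using assms by (intro sum_orders) auto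
  also have "\<dots> = int (\<Sum>d\<leftarrow>oA. tcount d p q) - int (\<Sum>d\<leftarrow>oB. tcount d p q)"
    using sum_esig[of "\<lambda>x d. x * int (tcount d p q)"] by (simp add: i neg)
  finally show ?thesis using step_cases[OF j] by linarith
qed

end

section \<open>Tables for the finite search\<close>

text \<open>Euclid's algorithm in a form that evaluates on numerals; it decides coprimality in the
  tables below.\<close>

fun euclid :: "nat \<Rightarrow> nat \<Rightarrow> nat" where
  "euclid m n = (if n = 0 then m else euclid n (m mod n))"

lemma coprime_euclid: "coprime m n \<longleftrightarrow> euclid m n = 1"
proof -
  have "euclid m n = gcd m n"
    by (induction m n rule: euclid.induct) (metis euclid.simps gcd_0_nat gcd_red_nat)
  then show ?thesis by (simp only: coprime_iff_gcd_eq_1)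
qed

primrec down :: "nat \<Rightarrow> nat list" where
  "down 0 = []"
| "down (Suc n) = Suc n # down n"

lemma down_numeral: "down (numeral k) = numeral k # down (pred_numeral k)"
  by (simp add: numeral_eq_Suc)

lemma down_rev: "down n = rev [1..<Suc n]"
  by (induction n) simp_all

definition units :: "nat \<Rightarrow> nat list" where "units d = filter (\<lambda>u. coprime u d) (down d)"

lemma tcount_units: "tcount d p q = length (filter (\<lambda>u. u * q \<le> p * d) (units d))"
  unfolding tcount_def units_def down_rev filter_filter rev_filter[symmetric] length_rev ..

text \<open>Fractions with denominators among the small orders, at which these 22 tests suffice for
  the checks below. None exceeds 1/2, in keeping with the symmetry of the step function.\<close>

definition test_points :: "(nat \<times> nat) list" where
  "test_points = [(1, 10), (7, 18), (2, 9), (5, 16), (1, 6), (4, 15), (1, 14), (5, 12), (3, 20), (1, 3), (1, 5), (7, 24), (1, 18), (1, 12), (1, 8), (5, 14), (2, 5), (7, 16), (1, 9), (3, 16), (3, 10), (3, 8)]"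

lemma units_eq:
  "units 2 = [1]"
  "units 3 = [2, 1]"
  "units 4 = [3, 1]"
  "units 5 = [4, 3, 2, 1]"
  "units 6 = [5, 1]"
  "units 7 = [6, 5, 4, 3, 2, 1]"
  "units 8 = [7, 5, 3, 1]"
  "units 9 = [8, 7, 5, 4, 2, 1]"
  "units 10 = [9, 7, 3, 1]"
  "units 12 = [11, 7, 5, 1]"
  "units 14 = [13, 11, 9, 5, 3, 1]"
  "units 15 = [14, 13, 11, 8, 7, 4, 2, 1]"
  "units 16 = [15, 13, 11, 9, 7, 5, 3, 1]"
  "units 18 = [17, 13, 11, 7, 5, 1]"
  "units 20 = [19, 17, 13, 11, 9, 7, 3, 1]"
  "units 24 = [23, 19, 17, 13, 11, 7, 5, 1]"
  "units 30 = [29, 23, 19, 17, 13, 11, 7, 1]"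
  by (simp_all add: units_def down_numeral coprime_euclid)

definition tvec :: "nat \<Rightarrow> nat list" where
  "tvec d = map (\<lambda>(p, q). tcount d p q) test_points"

lemma tvec_eq:
  "tvec 2 = [0, 0, 0, 0, 0, 0, 0, 0, 0, 0, 0, 0, 0, 0, 0, 0, 0, 0, 0, 0, 0, 0]"
  "tvec 3 = [0, 1, 0, 0, 0, 0, 0, 1, 0, 1, 0, 0, 0, 0, 0, 1, 1, 1, 0, 0, 0, 1]"
  "tvec 4 = [0, 1, 0, 1, 0, 1, 0, 1, 0, 1, 0, 1, 0, 0, 0, 1, 1, 1, 0, 0, 1, 1]"
  "tvec 5 = [0, 1, 1, 1, 0, 1, 0, 2, 0, 1, 1, 1, 0, 0, 0, 1, 2, 2, 0, 0, 1, 1]"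
  "tvec 6 = [0, 1, 1, 1, 1, 1, 0, 1, 0, 1, 1, 1, 0, 0, 0, 1, 1, 1, 0, 1, 1, 1]"
  "tvec 7 = [0, 2, 1, 2, 1, 1, 0, 2, 1, 2, 1, 2, 0, 0, 0, 2, 2, 3, 0, 1, 2, 2]"
  "tvec 8 = [0, 2, 1, 1, 1, 1, 0, 2, 1, 1, 1, 1, 0, 0, 1, 1, 2, 2, 0, 1, 1, 2]"
  "tvec 9 = [0, 2, 2, 2, 1, 2, 0, 2, 1, 2, 1, 2, 0, 0, 1, 2, 2, 2, 1, 1, 2, 2]"
  "tvec 10 = [1, 2, 1, 2, 1, 1, 0, 2, 1, 2, 1, 1, 0, 0, 1, 2, 2, 2, 1, 1, 2, 2]"
  "tvec 12 = [1, 1, 1, 1, 1, 1, 0, 2, 1, 1, 1, 1, 0, 1, 1, 1, 1, 2, 1, 1, 1, 1]"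
  "tvec 14 = [1, 3, 2, 2, 1, 2, 1, 3, 1, 2, 1, 2, 0, 1, 1, 3, 3, 3, 1, 1, 2, 3]"
  "tvec 15 = [1, 3, 2, 3, 2, 3, 1, 3, 2, 3, 2, 3, 0, 1, 1, 3, 3, 3, 1, 2, 3, 3]"
  "tvec 16 = [1, 3, 2, 3, 1, 2, 1, 3, 1, 3, 2, 2, 0, 1, 1, 3, 3, 4, 1, 2, 2, 3]"
  "tvec 18 = [1, 3, 1, 2, 1, 1, 1, 3, 1, 2, 1, 2, 1, 1, 1, 2, 3, 3, 1, 1, 2, 2]"
  "tvec 20 = [1, 3, 2, 2, 2, 2, 1, 3, 2, 2, 2, 2, 1, 1, 1, 3, 3, 3, 1, 2, 2, 3]"
  "tvec 24 = [1, 3, 2, 3, 1, 2, 1, 3, 1, 3, 1, 3, 1, 1, 1, 3, 3, 3, 1, 1, 3, 3]"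
  "tvec 30 = [1, 3, 1, 2, 1, 2, 1, 3, 1, 2, 1, 2, 1, 1, 1, 2, 3, 4, 1, 1, 2, 3]"
  by (simp_all add: tvec_def test_points_def tcount_units units_eq)

text \<open>Each order with its totient. Order 1 is left out because its exponent is always
  -1.\<close>

definition orders :: "(nat \<times> nat) list" where
  "orders = [(2, 1), (3, 2), (4, 2), (5, 4), (6, 2), (7, 6), (8, 4), (9, 6), (10, 4), (12, 4), (14, 6), (15, 8), (16, 8), (18, 6), (20, 8), (24, 8), (30, 8)]"

lemma orders_eq: "map (\<lambda>d. (d, tcount d 1 1)) (tl small_orders) = orders"
  by (simp add: small_orders_def orders_def tcount_units units_eq)

definition sporadic_list :: "(nat list \<times> nat list) list" where
  "sporadic_list = [
     ([12, 1], [6, 4, 3]), ([12, 3, 2], [6, 6, 4, 1]), ([12, 1], [8, 3, 2]),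
     ([12, 3], [8, 6, 1]), ([12, 3], [6, 5, 4]), ([12, 5], [10, 4, 3]), ([18, 1], [9, 6, 4]),
     ([9, 2], [6, 4, 1]), ([9, 4], [8, 3, 2]), ([18, 4, 3], [9, 8, 6, 2]), ([9, 1], [5, 3, 2]),
     ([18, 5, 3], [10, 9, 6, 1]), ([18, 4], [12, 9, 1]), ([12, 2], [9, 4, 1]),
     ([18, 2], [9, 6, 5]), ([10, 6], [9, 5, 2]), ([14, 3], [9, 7, 1]),
     ([18, 3, 2], [9, 7, 6, 1]), ([12, 2], [7, 4, 3]), ([14, 6, 4], [12, 7, 3, 2]),
     ([14, 1], [7, 5, 3]), ([10, 6, 1], [7, 5, 3, 2]), ([15, 1], [9, 5, 2]),
     ([30, 9, 5], [18, 15, 10, 1]), ([15, 4], [12, 5, 2]), ([30, 5, 4], [15, 12, 10, 2]),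
     ([15, 4], [8, 6, 5]), ([30, 5, 4], [15, 10, 8, 6]), ([15, 2], [10, 4, 3]),
     ([30, 3, 2], [15, 10, 6, 4]), ([30, 1], [15, 10, 6]), ([15, 2], [10, 6, 1]),
     ([15, 7], [14, 5, 3]), ([30, 5, 3], [15, 10, 7, 6]), ([30, 5, 3], [15, 12, 10, 1]),
     ([15, 6, 1], [12, 5, 3, 2]), ([15, 1], [8, 5, 3]), ([30, 5, 3, 2], [15, 10, 8, 6, 1]),
     ([20, 3], [12, 10, 1]), ([20, 6, 1], [12, 10, 3, 2]), ([20, 1], [10, 8, 3]),
     ([20, 3, 2], [10, 8, 6, 1]), ([20, 1], [10, 7, 4]), ([20, 7, 2], [14, 10, 4, 1]),
     ([20, 3], [10, 9, 4]), ([20, 9, 6], [18, 10, 4, 3]), ([24, 1], [12, 8, 5]),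
     ([24, 5, 2], [12, 10, 8, 1]), ([24, 4, 1], [12, 8, 7, 2]), ([24, 7, 4], [14, 12, 8, 1]),
     ([24, 4, 3], [12, 9, 8, 2]), ([24, 9, 6, 4], [18, 12, 8, 3, 2])]"

text \<open>Interlacing does not detect common factors, so the search also meets signatures of
  tuples divisible by 2, 3, 5 or 7. The gcd condition removes them at the end.\<close>

definition imprimitive_list :: "(nat list \<times> nat list) list" where
  "imprimitive_list = [
     ([4], [2, 2]), ([6], [3, 3]), ([12, 2], [6, 4, 4]), ([8], [4, 4]), ([6], [4, 2]),
     ([10], [5, 5]), ([18, 3], [9, 6, 6]), ([9], [6, 3]), ([12, 4], [8, 6, 2]), ([12], [6, 6]),
     ([8], [6, 2]), ([14], [7, 7]), ([24, 6, 4], [12, 12, 8, 2]), ([24, 4], [12, 8, 8]),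
     ([24, 2], [12, 8, 6]), ([20, 6], [12, 10, 4]), ([20, 2], [10, 8, 4]),
     ([16, 6], [12, 8, 2]), ([16], [8, 8]), ([16, 2], [8, 6, 4]), ([10], [8, 2]),
     ([10], [6, 4]), ([12], [8, 4])]"

definition pairs_1 :: "(nat \<times> nat) list" where
  "pairs_1 = [(2, 1), (3, 1), (4, 1), (3, 2), (5, 1), (5, 2), (6, 1), (4, 3), (7, 1), (5, 3), (7, 2),
     (8, 1), (5, 4)]"

definition pairs_2 :: "(nat \<times> nat) list" where
  "pairs_2 = [(3, 1), (3, 2), (5, 3), (5, 1), (4, 3), (4, 1), (5, 4), (5, 2), (7, 5), (7, 3), (7, 1),
     (6, 5), (6, 1), (7, 6), (7, 2), (7, 4), (8, 7), (8, 1), (8, 3), (8, 5), (9, 7), (9, 5),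
     (9, 1)]"

text \<open>The pair (1, 1) gives [2, 2]/[1, 1, 2], which cancels to the central binomial
  coefficient; this is why it is absent from \<open>pairs_1\<close>.\<close>

definition pairs_3 :: "(nat \<times> nat) list" where
  "pairs_3 = [(1, 1), (5, 1), (4, 1), (3, 2), (7, 1), (5, 3), (4, 3), (6, 1), (5, 2)]"

definition family_1 :: "(nat list \<times> nat list) list" where
  "family_1 = [
     ([3], [2, 1]), ([4], [3, 1]), ([5], [4, 1]), ([5], [3, 2]), ([6], [5, 1]), ([7], [5, 2]),
     ([7], [6, 1]), ([7], [4, 3]), ([8], [7, 1]), ([8], [5, 3]), ([9], [7, 2]), ([9], [8, 1]),
     ([9], [5, 4])]"

lemma family_1: "family_1 = map (\<lambda>(a, b). ([a + b], [a, b])) pairs_1" "list_all (\<lambda>(a, b). 0 < a \<and> 0 < b) pairs_1"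
  by (simp_all add: family_1_def pairs_1_def)

definition family_2 :: "(nat list \<times> nat list) list" where
  "family_2 = [
     ([6, 1], [3, 2, 2]), ([6, 2], [3, 4, 1]), ([10, 3], [5, 6, 2]), ([10, 1], [5, 2, 4]),
     ([8, 3], [4, 6, 1]), ([8, 1], [4, 2, 3]), ([10, 4], [5, 8, 1]), ([10, 2], [5, 4, 3]),
     ([14, 5], [7, 10, 2]), ([14, 3], [7, 6, 4]), ([14, 1], [7, 2, 6]), ([12, 5], [6, 10, 1]),
     ([12, 1], [6, 2, 5]), ([14, 6], [7, 12, 1]), ([14, 2], [7, 4, 5]), ([14, 4], [7, 8, 3]),
     ([16, 7], [8, 14, 1]), ([16, 1], [8, 2, 7]), ([16, 3], [8, 6, 5]), ([16, 5], [8, 10, 3]),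
     ([18, 7], [9, 14, 2]), ([18, 5], [9, 10, 4]), ([18, 1], [9, 2, 8])]"

lemma family_2: "family_2 = map (\<lambda>(a, b). ([2 * a, b], [a, 2 * b, a - b])) pairs_2" "list_all (\<lambda>(a, b). 0 < b \<and> b < a) pairs_2"
  by (simp_all add: family_2_def pairs_2_def)

definition family_3 :: "(nat list \<times> nat list) list" where
  "family_3 = [
     ([2, 2], [1, 1, 2]), ([10, 2], [5, 1, 6]), ([8, 2], [4, 1, 5]), ([6, 4], [3, 2, 5]),
     ([14, 2], [7, 1, 8]), ([10, 6], [5, 3, 8]), ([8, 6], [4, 3, 7]), ([12, 2], [6, 1, 7]),
     ([10, 4], [5, 2, 7])]"

lemma family_3: "family_3 = map (\<lambda>(a, b). ([2 * a, 2 * b], [a, b, a + b])) pairs_3" "list_all (\<lambda>(a, b). 0 < a \<and> 0 < b) pairs_3"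
  by (simp_all add: family_3_def pairs_3_def)

definition parameters :: "(nat list \<times> nat list) list" where
  "parameters = sporadic_list @ imprimitive_list @ family_1 @ family_2 @ family_3"

definition signature :: "nat list \<Rightarrow> nat list \<Rightarrow> nat list \<times> nat list" where
  "signature as bs = (filter (\<lambda>d. esig as bs d = 1) small_orders, filter (\<lambda>d. esig as bs d = -1) small_orders)"

definition signatures :: "(nat list \<times> nat list) list" where
  "signatures = [
     ([12], [1, 2, 3]), ([12], [1, 2, 6]), ([6, 12], [1, 2, 8]), ([3, 12], [1, 2, 8]),
     ([3, 12], [1, 2, 5]), ([6, 12], [1, 2, 10]), ([18], [1, 2, 3, 4]), ([9], [1, 2, 4, 6]),
     ([9], [1, 2, 8]), ([18], [1, 2, 8]), ([9], [1, 2, 5]), ([18], [1, 2, 10]),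
     ([2, 18], [1, 3, 12]), ([2, 6, 12], [1, 9]), ([2, 18], [1, 3, 5]), ([2, 6, 10], [1, 9]),
     ([2, 14], [1, 9]), ([2, 18], [1, 7]), ([2, 6, 12], [1, 7]), ([2, 14], [1, 3, 12]),
     ([2, 14], [1, 3, 5]), ([2, 6, 10], [1, 7]), ([15], [1, 2, 9]), ([30], [1, 2, 18]),
     ([15], [1, 2, 6, 12]), ([30], [1, 2, 3, 12]), ([15], [1, 2, 6, 8]), ([30], [1, 2, 3, 8]),
     ([15], [1, 2, 4, 10]), ([30], [1, 2, 4, 5]), ([30], [1, 2, 3, 5]), ([15], [1, 2, 6, 10]),
     ([15], [1, 2, 14]), ([30], [1, 2, 7]), ([30], [1, 2, 4, 12]), ([15], [1, 2, 4, 12]),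
     ([15], [1, 2, 4, 8]), ([30], [1, 2, 4, 8]), ([20], [1, 2, 6, 12]), ([20], [1, 2, 3, 12]),
     ([20], [1, 2, 3, 8]), ([20], [1, 2, 6, 8]), ([20], [1, 2, 7]), ([20], [1, 2, 14]),
     ([20], [1, 2, 9]), ([20], [1, 2, 18]), ([24], [1, 2, 4, 5]), ([24], [1, 2, 4, 10]),
     ([24], [1, 2, 7]), ([24], [1, 2, 14]), ([24], [1, 2, 9]), ([24], [1, 2, 18]),
     ([4], [1, 2]), ([2, 6], [1, 3]), ([12], [1, 2, 4]), ([8], [1, 2, 4]), ([3, 6], [1, 2, 4]),
     ([2, 10], [1, 5]), ([18], [1, 2, 3, 6]), ([9], [1, 2, 3, 6]), ([4, 12], [1, 2, 8]),
     ([4, 12], [1, 2, 3, 6]), ([4, 8], [1, 2, 3, 6]), ([2, 14], [1, 7]), ([24], [1, 2, 4, 12]),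
     ([24], [1, 2, 4, 8]), ([24], [1, 2, 3, 4, 6]), ([20], [1, 2, 4, 12]),
     ([20], [1, 2, 4, 8]), ([16], [1, 2, 4, 12]), ([16], [1, 2, 4, 8]),
     ([16], [1, 2, 3, 4, 6]), ([5, 10], [1, 2, 4, 8]), ([5, 10], [1, 2, 3, 4, 6]),
     ([3, 6, 12], [1, 2, 4, 8]), ([3], [1, 2]), ([2, 4], [1, 3]), ([5], [1, 2, 4]),
     ([5], [1, 2, 3]), ([2, 3, 6], [1, 5]), ([7], [1, 2, 5]), ([7], [1, 2, 3, 6]),
     ([7], [1, 2, 3, 4]), ([2, 4, 8], [1, 7]), ([2, 4, 8], [1, 3, 5]), ([3, 9], [1, 2, 7]),
     ([3, 9], [1, 2, 4, 8]), ([3, 9], [1, 2, 4, 5]), ([6], [1, 2]), ([2, 6], [1, 4]),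
     ([10], [1, 2, 6]), ([10], [1, 2, 4]), ([8], [1, 2, 6]), ([8], [1, 2, 3]),
     ([2, 10], [1, 8]), ([2, 10], [1, 3, 4]), ([14], [1, 2, 10]), ([14], [1, 2, 4, 6]),
     ([14], [1, 2, 3, 6]), ([4, 12], [1, 2, 10]), ([4, 12], [1, 2, 5]), ([2, 14], [1, 4, 12]),
     ([2, 14], [1, 4, 5]), ([2, 14], [1, 3, 8]), ([16], [1, 2, 14]), ([16], [1, 2, 7]),
     ([16], [1, 2, 5, 6]), ([16], [1, 2, 3, 10]), ([6, 18], [1, 2, 14]),
     ([6, 18], [1, 2, 4, 10]), ([6, 18], [1, 2, 4, 8]), ([2], [1]), ([2, 10], [1, 3, 6]),
     ([2, 8], [1, 5]), ([2, 4, 6], [1, 5]), ([2, 14], [1, 4, 8]), ([2, 6, 10], [1, 4, 8]),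
     ([2, 6, 8], [1, 7]), ([2, 4, 12], [1, 7]), ([2, 4, 10], [1, 7])]"

lemmas parameter_defs = parameters_def sporadic_list_def imprimitive_list_def family_1_def family_2_def family_3_def

lemma signatures_eq: "map (\<lambda>(as, bs). signature as bs) parameters = signatures"
  by (simp add: parameter_defs signatures_def signature_def esig_def small_orders_def)

definition large_orders :: "nat list" where
  "large_orders = [11, 13, 17, 19, 21, 22, 23, 25, 26, 27, 28, 29]"

text \<open>Under these conditions the signature determines \<open>esig\<close> at every positive d:
  beyond 30 and on \<open>large_orders\<close> it vanishes, and on the small orders it is -1, 0 or
  1.\<close>

definition bounded_parameter :: "nat list \<times> nat list \<Rightarrow> bool" where
  "bounded_parameter x \<longleftrightarrow> list_all (\<lambda>y. 0 < y \<and> y \<le> 30) (fst x @ snd x) \<and>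
     list_all (\<lambda>d. esig (fst x) (snd x) d = 0) large_orders \<and>
     list_all (\<lambda>d. esig (fst x) (snd x) d \<in> {-1, 0, 1}) small_orders"

lemma parameters_bounded: "list_all bounded_parameter parameters"
  by (simp add: parameter_defs bounded_parameter_def large_orders_def small_orders_def esig_def)

section \<open>Enumeration and elimination of candidates\<close>

text \<open>At each test point the poles counted so far exceed the zeros other than 1 by 0 or 1. The
  nested conditionals stop at the first failure.\<close>

fun compatible :: "nat list \<Rightarrow> nat list \<Rightarrow> bool" where
  "compatible (x # xs) (y # ys) = (if y \<le> x then if x \<le> Suc y then compatible xs ys else False else False)"
| "compatible _ _ = True"

primrec selections :: "(nat \<times> nat) list \<Rightarrow> nat \<Rightarrow> nat list list" where
  "selections [] w = (if w = 0 then [[]] else [])"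
| "selections (r # rs) w = selections rs w @
     (if snd r \<le> w then map ((#) (fst r)) (selections rs (w - snd r)) else [])"

definition vec :: "nat list \<Rightarrow> nat list" where
  "vec A = map (\<lambda>(p, q). \<Sum>d\<leftarrow>A. tcount d p q) test_points"

lemma vec_Cons: "vec (d # A) = map2 (+) (tvec d) (vec A)"
  by (simp add: vec_def tvec_def test_points_def)

lemma vec_Nil: "vec [] = map (\<lambda>_. 0) test_points"
  by (simp add: vec_def test_points_def)

definition candidates :: "nat \<Rightarrow> (nat list \<times> nat list) list" where
  "candidates n = map (\<lambda>A. (A, vec A)) (selections orders n)"

text \<open>The second set has weight n - 1 because order 1 is added to it afterwards: its root 1
  counts at the fraction 1 and at no test point.\<close>

definition check :: "nat \<Rightarrow> bool" where
  "check n \<longleftrightarrow> list_all (\<lambda>a. list_all (\<lambda>b. if compatible (snd a) (snd b)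
     then if list_all (\<lambda>d. d \<notin> set (fst b)) (fst a) then (fst a, 1 # fst b) \<in> set signatures else True
     else True) (candidates (n - 1))) (candidates n)"

lemma candidates_0: "candidates 0 = [
     ([], [0, 0, 0, 0, 0, 0, 0, 0, 0, 0, 0, 0, 0, 0, 0, 0, 0, 0, 0, 0, 0, 0])]"
  by (simp add: candidates_def orders_def test_points_def vec_Cons vec_Nil tvec_eq)

lemma candidates_1: "candidates 1 = [
     ([2], [0, 0, 0, 0, 0, 0, 0, 0, 0, 0, 0, 0, 0, 0, 0, 0, 0, 0, 0, 0, 0, 0])]"
  by (simp add: candidates_def orders_def test_points_def vec_Cons vec_Nil tvec_eq)

lemma candidates_2: "candidates 2 = [
     ([6], [0, 1, 1, 1, 1, 1, 0, 1, 0, 1, 1, 1, 0, 0, 0, 1, 1, 1, 0, 1, 1, 1]),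
     ([4], [0, 1, 0, 1, 0, 1, 0, 1, 0, 1, 0, 1, 0, 0, 0, 1, 1, 1, 0, 0, 1, 1]),
     ([3], [0, 1, 0, 0, 0, 0, 0, 1, 0, 1, 0, 0, 0, 0, 0, 1, 1, 1, 0, 0, 0, 1])]"
  by (simp add: candidates_def orders_def test_points_def vec_Cons vec_Nil tvec_eq)

lemma candidates_3: "candidates 3 = [
     ([2, 6], [0, 1, 1, 1, 1, 1, 0, 1, 0, 1, 1, 1, 0, 0, 0, 1, 1, 1, 0, 1, 1, 1]),
     ([2, 4], [0, 1, 0, 1, 0, 1, 0, 1, 0, 1, 0, 1, 0, 0, 0, 1, 1, 1, 0, 0, 1, 1]),
     ([2, 3], [0, 1, 0, 0, 0, 0, 0, 1, 0, 1, 0, 0, 0, 0, 0, 1, 1, 1, 0, 0, 0, 1])]"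
  by (simp add: candidates_def orders_def test_points_def vec_Cons vec_Nil tvec_eq)

lemma candidates_4: "candidates 4 = [
     ([12], [1, 1, 1, 1, 1, 1, 0, 2, 1, 1, 1, 1, 0, 1, 1, 1, 1, 2, 1, 1, 1, 1]),
     ([10], [1, 2, 1, 2, 1, 1, 0, 2, 1, 2, 1, 1, 0, 0, 1, 2, 2, 2, 1, 1, 2, 2]),
     ([8], [0, 2, 1, 1, 1, 1, 0, 2, 1, 1, 1, 1, 0, 0, 1, 1, 2, 2, 0, 1, 1, 2]),
     ([5], [0, 1, 1, 1, 0, 1, 0, 2, 0, 1, 1, 1, 0, 0, 0, 1, 2, 2, 0, 0, 1, 1]),
     ([4, 6], [0, 2, 1, 2, 1, 2, 0, 2, 0, 2, 1, 2, 0, 0, 0, 2, 2, 2, 0, 1, 2, 2]),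
     ([3, 6], [0, 2, 1, 1, 1, 1, 0, 2, 0, 2, 1, 1, 0, 0, 0, 2, 2, 2, 0, 1, 1, 2]),
     ([3, 4], [0, 2, 0, 1, 0, 1, 0, 2, 0, 2, 0, 1, 0, 0, 0, 2, 2, 2, 0, 0, 1, 2])]"
  by (simp add: candidates_def orders_def test_points_def vec_Cons vec_Nil tvec_eq)

lemma candidates_5: "candidates 5 = [
     ([2, 12], [1, 1, 1, 1, 1, 1, 0, 2, 1, 1, 1, 1, 0, 1, 1, 1, 1, 2, 1, 1, 1, 1]),
     ([2, 10], [1, 2, 1, 2, 1, 1, 0, 2, 1, 2, 1, 1, 0, 0, 1, 2, 2, 2, 1, 1, 2, 2]),
     ([2, 8], [0, 2, 1, 1, 1, 1, 0, 2, 1, 1, 1, 1, 0, 0, 1, 1, 2, 2, 0, 1, 1, 2]),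
     ([2, 5], [0, 1, 1, 1, 0, 1, 0, 2, 0, 1, 1, 1, 0, 0, 0, 1, 2, 2, 0, 0, 1, 1]),
     ([2, 4, 6], [0, 2, 1, 2, 1, 2, 0, 2, 0, 2, 1, 2, 0, 0, 0, 2, 2, 2, 0, 1, 2, 2]),
     ([2, 3, 6], [0, 2, 1, 1, 1, 1, 0, 2, 0, 2, 1, 1, 0, 0, 0, 2, 2, 2, 0, 1, 1, 2]),
     ([2, 3, 4], [0, 2, 0, 1, 0, 1, 0, 2, 0, 2, 0, 1, 0, 0, 0, 2, 2, 2, 0, 0, 1, 2])]"
  by (simp add: candidates_def orders_def test_points_def vec_Cons vec_Nil tvec_eq)

lemma candidates_6: "candidates 6 = [
     ([18], [1, 3, 1, 2, 1, 1, 1, 3, 1, 2, 1, 2, 1, 1, 1, 2, 3, 3, 1, 1, 2, 2]),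
     ([14], [1, 3, 2, 2, 1, 2, 1, 3, 1, 2, 1, 2, 0, 1, 1, 3, 3, 3, 1, 1, 2, 3]),
     ([9], [0, 2, 2, 2, 1, 2, 0, 2, 1, 2, 1, 2, 0, 0, 1, 2, 2, 2, 1, 1, 2, 2]),
     ([7], [0, 2, 1, 2, 1, 1, 0, 2, 1, 2, 1, 2, 0, 0, 0, 2, 2, 3, 0, 1, 2, 2]),
     ([6, 12], [1, 2, 2, 2, 2, 2, 0, 3, 1, 2, 2, 2, 0, 1, 1, 2, 2, 3, 1, 2, 2, 2]),
     ([6, 10], [1, 3, 2, 3, 2, 2, 0, 3, 1, 3, 2, 2, 0, 0, 1, 3, 3, 3, 1, 2, 3, 3]),
     ([6, 8], [0, 3, 2, 2, 2, 2, 0, 3, 1, 2, 2, 2, 0, 0, 1, 2, 3, 3, 0, 2, 2, 3]),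
     ([5, 6], [0, 2, 2, 2, 1, 2, 0, 3, 0, 2, 2, 2, 0, 0, 0, 2, 3, 3, 0, 1, 2, 2]),
     ([4, 12], [1, 2, 1, 2, 1, 2, 0, 3, 1, 2, 1, 2, 0, 1, 1, 2, 2, 3, 1, 1, 2, 2]),
     ([4, 10], [1, 3, 1, 3, 1, 2, 0, 3, 1, 3, 1, 2, 0, 0, 1, 3, 3, 3, 1, 1, 3, 3]),
     ([4, 8], [0, 3, 1, 2, 1, 2, 0, 3, 1, 2, 1, 2, 0, 0, 1, 2, 3, 3, 0, 1, 2, 3]),
     ([4, 5], [0, 2, 1, 2, 0, 2, 0, 3, 0, 2, 1, 2, 0, 0, 0, 2, 3, 3, 0, 0, 2, 2]),
     ([3, 12], [1, 2, 1, 1, 1, 1, 0, 3, 1, 2, 1, 1, 0, 1, 1, 2, 2, 3, 1, 1, 1, 2]),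
     ([3, 10], [1, 3, 1, 2, 1, 1, 0, 3, 1, 3, 1, 1, 0, 0, 1, 3, 3, 3, 1, 1, 2, 3]),
     ([3, 8], [0, 3, 1, 1, 1, 1, 0, 3, 1, 2, 1, 1, 0, 0, 1, 2, 3, 3, 0, 1, 1, 3]),
     ([3, 5], [0, 2, 1, 1, 0, 1, 0, 3, 0, 2, 1, 1, 0, 0, 0, 2, 3, 3, 0, 0, 1, 2]),
     ([3, 4, 6], [0, 3, 1, 2, 1, 2, 0, 3, 0, 3, 1, 2, 0, 0, 0, 3, 3, 3, 0, 1, 2, 3])]"
  by (simp add: candidates_def orders_def test_points_def vec_Cons vec_Nil tvec_eq)

lemma candidates_7: "candidates 7 = [
     ([2, 18], [1, 3, 1, 2, 1, 1, 1, 3, 1, 2, 1, 2, 1, 1, 1, 2, 3, 3, 1, 1, 2, 2]),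
     ([2, 14], [1, 3, 2, 2, 1, 2, 1, 3, 1, 2, 1, 2, 0, 1, 1, 3, 3, 3, 1, 1, 2, 3]),
     ([2, 9], [0, 2, 2, 2, 1, 2, 0, 2, 1, 2, 1, 2, 0, 0, 1, 2, 2, 2, 1, 1, 2, 2]),
     ([2, 7], [0, 2, 1, 2, 1, 1, 0, 2, 1, 2, 1, 2, 0, 0, 0, 2, 2, 3, 0, 1, 2, 2]),
     ([2, 6, 12], [1, 2, 2, 2, 2, 2, 0, 3, 1, 2, 2, 2, 0, 1, 1, 2, 2, 3, 1, 2, 2, 2]),
     ([2, 6, 10], [1, 3, 2, 3, 2, 2, 0, 3, 1, 3, 2, 2, 0, 0, 1, 3, 3, 3, 1, 2, 3, 3]),
     ([2, 6, 8], [0, 3, 2, 2, 2, 2, 0, 3, 1, 2, 2, 2, 0, 0, 1, 2, 3, 3, 0, 2, 2, 3]),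
     ([2, 5, 6], [0, 2, 2, 2, 1, 2, 0, 3, 0, 2, 2, 2, 0, 0, 0, 2, 3, 3, 0, 1, 2, 2]),
     ([2, 4, 12], [1, 2, 1, 2, 1, 2, 0, 3, 1, 2, 1, 2, 0, 1, 1, 2, 2, 3, 1, 1, 2, 2]),
     ([2, 4, 10], [1, 3, 1, 3, 1, 2, 0, 3, 1, 3, 1, 2, 0, 0, 1, 3, 3, 3, 1, 1, 3, 3]),
     ([2, 4, 8], [0, 3, 1, 2, 1, 2, 0, 3, 1, 2, 1, 2, 0, 0, 1, 2, 3, 3, 0, 1, 2, 3]),
     ([2, 4, 5], [0, 2, 1, 2, 0, 2, 0, 3, 0, 2, 1, 2, 0, 0, 0, 2, 3, 3, 0, 0, 2, 2]),
     ([2, 3, 12], [1, 2, 1, 1, 1, 1, 0, 3, 1, 2, 1, 1, 0, 1, 1, 2, 2, 3, 1, 1, 1, 2]),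
     ([2, 3, 10], [1, 3, 1, 2, 1, 1, 0, 3, 1, 3, 1, 1, 0, 0, 1, 3, 3, 3, 1, 1, 2, 3]),
     ([2, 3, 8], [0, 3, 1, 1, 1, 1, 0, 3, 1, 2, 1, 1, 0, 0, 1, 2, 3, 3, 0, 1, 1, 3]),
     ([2, 3, 5], [0, 2, 1, 1, 0, 1, 0, 3, 0, 2, 1, 1, 0, 0, 0, 2, 3, 3, 0, 0, 1, 2]),
     ([2, 3, 4, 6], [0, 3, 1, 2, 1, 2, 0, 3, 0, 3, 1, 2, 0, 0, 0, 3, 3, 3, 0, 1, 2, 3])]"
  by (simp add: candidates_def orders_def test_points_def vec_Cons vec_Nil tvec_eq)

lemma candidates_8: "candidates 8 = [
     ([30], [1, 3, 1, 2, 1, 2, 1, 3, 1, 2, 1, 2, 1, 1, 1, 2, 3, 4, 1, 1, 2, 3]),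
     ([24], [1, 3, 2, 3, 1, 2, 1, 3, 1, 3, 1, 3, 1, 1, 1, 3, 3, 3, 1, 1, 3, 3]),
     ([20], [1, 3, 2, 2, 2, 2, 1, 3, 2, 2, 2, 2, 1, 1, 1, 3, 3, 3, 1, 2, 2, 3]),
     ([16], [1, 3, 2, 3, 1, 2, 1, 3, 1, 3, 2, 2, 0, 1, 1, 3, 3, 4, 1, 2, 2, 3]),
     ([15], [1, 3, 2, 3, 2, 3, 1, 3, 2, 3, 2, 3, 0, 1, 1, 3, 3, 3, 1, 2, 3, 3]),
     ([10, 12], [2, 3, 2, 3, 2, 2, 0, 4, 2, 3, 2, 2, 0, 1, 2, 3, 3, 4, 2, 2, 3, 3]),
     ([8, 12], [1, 3, 2, 2, 2, 2, 0, 4, 2, 2, 2, 2, 0, 1, 2, 2, 3, 4, 1, 2, 2, 3]),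
     ([8, 10], [1, 4, 2, 3, 2, 2, 0, 4, 2, 3, 2, 2, 0, 0, 2, 3, 4, 4, 1, 2, 3, 4]),
     ([6, 18], [1, 4, 2, 3, 2, 2, 1, 4, 1, 3, 2, 3, 1, 1, 1, 3, 4, 4, 1, 2, 3, 3]),
     ([6, 14], [1, 4, 3, 3, 2, 3, 1, 4, 1, 3, 2, 3, 0, 1, 1, 4, 4, 4, 1, 2, 3, 4]),
     ([6, 9], [0, 3, 3, 3, 2, 3, 0, 3, 1, 3, 2, 3, 0, 0, 1, 3, 3, 3, 1, 2, 3, 3]),
     ([6, 7], [0, 3, 2, 3, 2, 2, 0, 3, 1, 3, 2, 3, 0, 0, 0, 3, 3, 4, 0, 2, 3, 3]),
     ([5, 12], [1, 2, 2, 2, 1, 2, 0, 4, 1, 2, 2, 2, 0, 1, 1, 2, 3, 4, 1, 1, 2, 2]),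
     ([5, 10], [1, 3, 2, 3, 1, 2, 0, 4, 1, 3, 2, 2, 0, 0, 1, 3, 4, 4, 1, 1, 3, 3]),
     ([5, 8], [0, 3, 2, 2, 1, 2, 0, 4, 1, 2, 2, 2, 0, 0, 1, 2, 4, 4, 0, 1, 2, 3]),
     ([4, 18], [1, 4, 1, 3, 1, 2, 1, 4, 1, 3, 1, 3, 1, 1, 1, 3, 4, 4, 1, 1, 3, 3]),
     ([4, 14], [1, 4, 2, 3, 1, 3, 1, 4, 1, 3, 1, 3, 0, 1, 1, 4, 4, 4, 1, 1, 3, 4]),
     ([4, 9], [0, 3, 2, 3, 1, 3, 0, 3, 1, 3, 1, 3, 0, 0, 1, 3, 3, 3, 1, 1, 3, 3]),
     ([4, 7], [0, 3, 1, 3, 1, 2, 0, 3, 1, 3, 1, 3, 0, 0, 0, 3, 3, 4, 0, 1, 3, 3]),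
     ([4, 6, 12], [1, 3, 2, 3, 2, 3, 0, 4, 1, 3, 2, 3, 0, 1, 1, 3, 3, 4, 1, 2, 3, 3]),
     ([4, 6, 10], [1, 4, 2, 4, 2, 3, 0, 4, 1, 4, 2, 3, 0, 0, 1, 4, 4, 4, 1, 2, 4, 4]),
     ([4, 6, 8], [0, 4, 2, 3, 2, 3, 0, 4, 1, 3, 2, 3, 0, 0, 1, 3, 4, 4, 0, 2, 3, 4]),
     ([4, 5, 6], [0, 3, 2, 3, 1, 3, 0, 4, 0, 3, 2, 3, 0, 0, 0, 3, 4, 4, 0, 1, 3, 3]),
     ([3, 18], [1, 4, 1, 2, 1, 1, 1, 4, 1, 3, 1, 2, 1, 1, 1, 3, 4, 4, 1, 1, 2, 3]),
     ([3, 14], [1, 4, 2, 2, 1, 2, 1, 4, 1, 3, 1, 2, 0, 1, 1, 4, 4, 4, 1, 1, 2, 4]),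
     ([3, 9], [0, 3, 2, 2, 1, 2, 0, 3, 1, 3, 1, 2, 0, 0, 1, 3, 3, 3, 1, 1, 2, 3]),
     ([3, 7], [0, 3, 1, 2, 1, 1, 0, 3, 1, 3, 1, 2, 0, 0, 0, 3, 3, 4, 0, 1, 2, 3]),
     ([3, 6, 12], [1, 3, 2, 2, 2, 2, 0, 4, 1, 3, 2, 2, 0, 1, 1, 3, 3, 4, 1, 2, 2, 3]),
     ([3, 6, 10], [1, 4, 2, 3, 2, 2, 0, 4, 1, 4, 2, 2, 0, 0, 1, 4, 4, 4, 1, 2, 3, 4]),
     ([3, 6, 8], [0, 4, 2, 2, 2, 2, 0, 4, 1, 3, 2, 2, 0, 0, 1, 3, 4, 4, 0, 2, 2, 4]),
     ([3, 5, 6], [0, 3, 2, 2, 1, 2, 0, 4, 0, 3, 2, 2, 0, 0, 0, 3, 4, 4, 0, 1, 2, 3]),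
     ([3, 4, 12], [1, 3, 1, 2, 1, 2, 0, 4, 1, 3, 1, 2, 0, 1, 1, 3, 3, 4, 1, 1, 2, 3]),
     ([3, 4, 10], [1, 4, 1, 3, 1, 2, 0, 4, 1, 4, 1, 2, 0, 0, 1, 4, 4, 4, 1, 1, 3, 4]),
     ([3, 4, 8], [0, 4, 1, 2, 1, 2, 0, 4, 1, 3, 1, 2, 0, 0, 1, 3, 4, 4, 0, 1, 2, 4]),
     ([3, 4, 5], [0, 3, 1, 2, 0, 2, 0, 4, 0, 3, 1, 2, 0, 0, 0, 3, 4, 4, 0, 0, 2, 3])]"
  by (simp add: candidates_def orders_def test_points_def vec_Cons vec_Nil tvec_eq)

lemma check_1: "check 1"
  by (simp add: check_def candidates_1[simplified] candidates_0[simplified] signatures_def)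

lemma check_2: "check 2"
  by (simp add: check_def candidates_2 candidates_1[simplified] signatures_def)

lemma check_3: "check 3"
  by (simp add: check_def candidates_3 candidates_2 signatures_def)

lemma check_4: "check 4"
  by (simp add: check_def candidates_4 candidates_3 signatures_def)

lemma check_5: "check 5"
  by (simp add: check_def candidates_5 candidates_4 signatures_def)

lemma check_6: "check 6"
  by (simp add: check_def candidates_6 candidates_5 signatures_def)

lemma check_7: "check 7"
  by (simp add: check_def candidates_7 candidates_6 signatures_def)

lemma check_8: "check 8"
  by (simp add: check_def candidates_8 candidates_7 signatures_def)

section \<open>The classification\<close>

text \<open>The only multiples of the largest entry are its own copies, so its multiplicity is one
  of the given counts; remove one copy from both sides and repeat.\<close>

lemma multiset_eq_if_dvd_counts:
  fixes M M' :: "nat multiset"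
  assumes "\<And>d. 0 < d \<Longrightarrow> size (filter_mset (\<lambda>x. d dvd x) M) = size (filter_mset (\<lambda>x. d dvd x) M')"
    and "0 \<notin># M" "0 \<notin># M'"
  shows "M = M'"
  using assms
proof (induction "size M + size M'" arbitrary: M M' rule: less_induct)
  case less
  show ?case
  proof (cases "M + M' = {#}")
    case False
    define m where "m = Max (set_mset (M + M'))"
    have min: "m \<in># M + M'" unfolding m_def using False by (intro Max_in) auto
    have le: "x \<le> m" if "x \<in># M + M'" for x unfolding m_def using that by (intro Max_ge) auto
    have m0: "0 < m" using min less.prems(2,3) by (auto intro: gr0I)
    have eq: "filter_mset (\<lambda>x. m dvd x) L = replicate_mset (count L m) m" if "L = M \<or> L = M'" for L
    proof -
      have "m dvd x \<longleftrightarrow> x = m" if x: "x \<in># L" for x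
      proof -
        have "x \<in># M + M'" using x \<open>L = M \<or> L = M'\<close> by auto
        then have "x \<le> m" by (rule le)
        moreover have "x \<noteq> 0" using x \<open>L = M \<or> L = M'\<close> less.prems(2,3) by metis
        ultimately have "0 < x" "x \<le> m" by simp_all
        then show ?thesis by (auto dest: dvd_imp_le)
      qed
      then have "filter_mset (\<lambda>x. m dvd x) L = filter_mset (\<lambda>x. x = m) L" by (rule filter_mset_cong[OF refl])
      then show ?thesis by (simp add: filter_eq_replicate_mset)
    qed
    have "count M m = count M' m"
      using less.prems(1)[OF m0] unfolding eq[OF disjI1[OF refl]] eq[OF disjI2[OF refl]] by simp
    then have "m \<in># M" "m \<in># M'" using min by (auto simp: count_greater_zero_iff[symmetric] simp del: count_greater_zero_iff)
    then obtain L L' where L: "M = add_mset m L" "M' = add_mset m L'" by (meson multi_member_split)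
    have "L = L'"
    proof (rule less.hyps)
      show "size L + size L' < size M + size M'" by (simp add: L)
      show "0 \<notin># L" "0 \<notin># L'" using less.prems(2,3) by (auto simp: L)
      fix d :: nat assume "0 < d"
      from less.prems(1)[OF this]
      show "size (filter_mset (\<lambda>x. d dvd x) L) = size (filter_mset (\<lambda>x. d dvd x) L')"
        by (simp add: L split: if_splits)
    qed
    then show ?thesis by (simp add: L)
  qed simp
qed

lemma mset_eq_if_esig_eq:
  assumes "\<And>d. 0 < d \<Longrightarrow> esig as bs d = esig cs ds d"
    and "0 \<notin> set (as @ bs @ cs @ ds)"
  shows "mset as + mset ds = mset bs + mset cs"
proof (rule multiset_eq_if_dvd_counts)
  fix d :: nat assume "0 < d"
  from assms(1)[OF this]
  have "int (length (filter (\<lambda>x. d dvd x) (as @ ds))) = int (length (filter (\<lambda>x. d dvd x) (bs @ cs)))"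
    by (simp add: esig_def)
  then have "size (mset (filter (\<lambda>x. d dvd x) (as @ ds))) = size (mset (filter (\<lambda>x. d dvd x) (bs @ cs)))"
    unfolding size_mset by (simp only: of_nat_eq_iff)
  then show "size (filter_mset (\<lambda>x. d dvd x) (mset as + mset ds)) = size (filter_mset (\<lambda>x. d dvd x) (mset bs + mset cs))"
    by (simp add: mset_filter)
qed (use assms(2) in auto)

lemma mset_eq_if_disjoint:
  assumes eq: "A + D = B + C" and "set_mset A \<inter> set_mset B = {}" "set_mset C \<inter> set_mset D = {}"
  shows "A = C \<and> B = D"
proof -
  have "count A x = count C x \<and> count B x = count D x" for x
  proof -
    have "count A x + count D x = count B x + count C x" using arg_cong[OF eq, of "\<lambda>M. count M x"] by simp
    moreover have "count A x = 0 \<or> count B x = 0" "count C x = 0 \<or> count D x = 0"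
      using assms(2,3) by (auto simp: count_eq_zero_iff)
    ultimately show ?thesis by auto
  qed
  then show ?thesis by (auto intro: multiset_eqI)
qed

lemma selections_complete:
  "filter P ds \<in> set (selections (map (\<lambda>d. (d, f d)) ds) (\<Sum>d\<leftarrow>filter P ds. f d))"
  by (induction ds) auto

lemma compatibleI:
  assumes "\<And>x. x \<in> set xs \<Longrightarrow> g x \<le> f x \<and> f x \<le> Suc (g x)"
  shows "compatible (map f xs) (map g xs)"
  using assms by (induction xs) auto

lemma check_all: "0 < n \<Longrightarrow> n \<le> 8 \<Longrightarrow> check n"
proof -
  assume "0 < n" "n \<le> 8"
  then have "n = 1 \<or> n = 2 \<or> n = 3 \<or> n = 4 \<or> n = 5 \<or> n = 6 \<or> n = 7 \<or> n = 8" by presburger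
  then show ?thesis using check_1 check_2 check_3 check_4 check_5 check_6 check_7 check_8 by blast
qed

context small_ratio begin

lemma esig_1: "e 1 = -1" by (simp add: esig_def len)

text \<open>For n = \<open>card JA\<close> the sets \<open>oA\<close> and \<open>oB\<close> without
  1 are candidates of weights n and n - 1, and \<open>step_test\<close> makes their vectors
  compatible.\<close>

lemma signature_member: "(oA, oB) \<in> set signatures"
proof -
  define P where "P c = filter (\<lambda>d. e d = c) (tl small_orders)" for c
  have so: "small_orders = 1 # tl small_orders" by (simp add: small_orders_def)
  have A: "oA = P 1" unfolding oA_def P_def by (subst so) (simp add: esig_1[simplified])
  have B: "oB = 1 # P (-1)" unfolding oB_def P_def by (subst so) (simp add: esig_1[simplified])
  have t1: "tcount 1 p q = 0" if "p < q" for p q using that by (simp add: tcount_def)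
  have t11: "tcount 1 1 1 = 1" by (simp add: tcount_def)
  have sB: "(\<Sum>d\<leftarrow>oB. tcount d p q) = tcount 1 p q + (\<Sum>d\<leftarrow>P (-1). tcount d p q)" for p q
    by (simp add: B)
  define n where "n = card JA"
  have n0: "0 < n" unfolding n_def using card_J zero_J finite_J by (auto simp: card_gt_0_iff)
  have wA: "(\<Sum>d\<leftarrow>P 1. tcount d 1 1) = n" using weight_oA unfolding A n_def .
  have wB: "(\<Sum>d\<leftarrow>P (-1). tcount d 1 1) = n - 1" using weight_oB sB[of 1 1] t11 unfolding n_def by linarith
  have cand: "(P c, vec (P c)) \<in> set (candidates (\<Sum>d\<leftarrow>P c. tcount d 1 1))" for c
    using selections_complete[of "\<lambda>d. e d = c" "tl small_orders" "\<lambda>d. tcount d 1 1"]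
    unfolding candidates_def P_def orders_eq by simp
  have compat: "compatible (vec (P 1)) (vec (P (-1)))"
    unfolding vec_def
  proof (rule compatibleI)
    fix x assume x: "x \<in> set test_points"
    have "list_all (\<lambda>x. fst x < snd x) test_points" by (simp add: test_points_def)
    then have "fst x < snd x" using x by (simp add: list_all_iff)
    moreover obtain p q where pq: "x = (p, q)" by (cases x)
    ultimately have *: "0 < q" "p < q" by simp_all
    from step_test[OF *] sB[of p q] t1[OF *(2)]
    show "(case x of (p, q) \<Rightarrow> \<Sum>d\<leftarrow>P (-1). tcount d p q) \<le> (case x of (p, q) \<Rightarrow> \<Sum>d\<leftarrow>P 1. tcount d p q) \<and>
      (case x of (p, q) \<Rightarrow> \<Sum>d\<leftarrow>P 1. tcount d p q) \<le> Suc (case x of (p, q) \<Rightarrow> \<Sum>d\<leftarrow>P (-1). tcount d p q)"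
      unfolding pq prod.case A[symmetric] by linarith
  qed
  have disj: "list_all (\<lambda>d. d \<notin> set (P (-1))) (P 1)" by (auto simp: list_all_iff P_def)
  have "check n" using n0 small by (intro check_all) (simp_all add: n_def)
  from this[unfolded check_def list_all_iff, rule_format, OF cand[of 1, unfolded wA] cand[of "-1", unfolded wB]]
  show ?thesis using compat disj unfolding A B by (simp add: list_all_iff)
qed

text \<open>The cyclotomic exponents determine the parameters up to cancellation, so a tabulated
  tuple with the same signature yields the multiset identity.\<close>

lemma exists_parameter:
  obtains cs ds where "(cs, ds) \<in> set parameters" "mset as + mset ds = mset bs + mset cs"
proof -
  have "(oA, oB) \<in> set (map (\<lambda>(as, bs). signature as bs) parameters)"
    using signature_member unfolding signatures_eq .
  then obtain cs ds where p: "(cs, ds) \<in> set parameters" and sig: "(oA, oB) = signature cs ds" by auto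
  have bounded: "bounded_parameter (cs, ds)" using parameters_bounded p by (simp add: list_all_iff)
  then have b: "\<forall>y\<in>set (cs @ ds). 0 < y \<and> y \<le> 30" by (simp add: bounded_parameter_def list_all_iff)
  have zero: "esig cs ds d = 0" if d: "0 < d" "d \<notin> set small_orders" for d
  proof (cases "d \<le> 30")
    case True
    have "list_all (\<lambda>d. d \<in> set small_orders \<or> d \<in> set large_orders) (down 30)"
      by (simp add: small_orders_def large_orders_def down_numeral)
    moreover have "d \<in> set (down 30)" unfolding down_rev using True d(1) by simp
    ultimately have "d \<in> set large_orders" using d(2) unfolding list_all_iff by blast
    then show ?thesis using bounded by (simp add: bounded_parameter_def list_all_iff)
  next
    case False
    have "\<not> d dvd y" if "y \<in> set (cs @ ds)" for y
    proof
      assume "d dvd y"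
      from bspec[OF b that] dvd_imp_le[OF this] False show False by simp
    qed
    then have "filter (\<lambda>y. d dvd y) cs = []" "filter (\<lambda>y. d dvd y) ds = []" by (auto simp: filter_empty_conv)
    then show ?thesis by (simp add: esig_def)
  qed
  have in_sig: "(esig cs ds d = c \<longleftrightarrow> e d = c)" if "d \<in> set small_orders" "c = 1 \<or> c = -1" for d c
  proof -
    have "filter (\<lambda>d. e d = 1) small_orders = filter (\<lambda>d. esig cs ds d = 1) small_orders"
      "filter (\<lambda>d. e d = -1) small_orders = filter (\<lambda>d. esig cs ds d = -1) small_orders"
      using sig by (simp_all add: oA_def oB_def signature_def)
    from arg_cong[OF this(1), of set] arg_cong[OF this(2), of set] show ?thesis
      using that by (auto simp: set_eq_iff)
  qed
  have eq: "e d = esig cs ds d" if d: "0 < d" for d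
  proof (cases "d \<in> set small_orders")
    case True
    have "esig cs ds d \<in> {-1, 0, 1}" using bounded True by (simp add: bounded_parameter_def list_all_iff)
    then show ?thesis using esig_cases[of d] in_sig[OF True, of 1] in_sig[OF True, of "-1"] by auto
  next
    case False
    then show ?thesis using zero[OF d False] esig_small[of d] by auto
  qed
  have "0 \<notin> set (as @ bs @ cs @ ds)" using as_pos bs_pos b by auto
  from mset_eq_if_esig_eq[OF eq this] show ?thesis by (rule that[OF p])
qed

text \<open>Disjointness of \<open>as\<close> and \<open>bs\<close> turns the identity up to
  cancellation into equality when the tabulated tuple is itself reduced, as the sporadic ones are.
  Entries of the family tables may cancel, and \<open>family\<close> allows for that.\<close>

theorem small_rank:
  assumes disj: "set as \<inter> set bs = {}" and gcd: "Gcd (set as \<union> set bs) = 1"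
  shows "family (mset as) (mset bs) \<or>
    (\<exists>(as', bs')\<in>sporadic_parameters. mset as = mset as' \<and> mset bs = mset bs')"
proof -
  obtain cs ds where p: "(cs, ds) \<in> set parameters" and eq: "mset as + mset ds = mset bs + mset cs"
    by (rule exists_parameter)
  consider "(cs, ds) \<in> set sporadic_list" | "(cs, ds) \<in> set imprimitive_list"
    | "(cs, ds) \<in> set family_1" | "(cs, ds) \<in> set family_2" | "(cs, ds) \<in> set family_3"
    using p by (auto simp: parameters_def)
  then show ?thesis
  proof cases
    case 1
    have "list_all (\<lambda>x. list_all (\<lambda>y. y \<notin> set (snd x)) (fst x)) sporadic_list"
      by (simp add: sporadic_list_def)
    then have "set_mset (mset cs) \<inter> set_mset (mset ds) = {}" using 1 by (auto simp: list_all_iff)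
    then have "mset as = mset cs \<and> mset bs = mset ds"
      using disj by (intro mset_eq_if_disjoint[OF eq]) auto
    moreover have "set sporadic_list = sporadic_parameters"
      unfolding sporadic_list_def sporadic_parameters_def by (simp only: list.set)
    then have "(cs, ds) \<in> sporadic_parameters" using 1 by simp
    ultimately show ?thesis by blast
  next
    case 2
    have "list_all (\<lambda>x. list_ex (\<lambda>g. list_all (\<lambda>y. g dvd y) (fst x @ snd x)) [2, 3, 5, 7]) imprimitive_list"
      by (simp add: imprimitive_list_def)
    from bspec[OF this[unfolded list_all_iff] 2]
    obtain g where g: "g \<in> set [2, 3, 5, 7]" "\<forall>y\<in>set cs \<union> set ds. g dvd y"
      unfolding list_ex_iff list_all_iff by auto
    \<comment> \<open>A common factor of the tabulated tuple would divide the gcd of the given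
      parameters.\<close>
    have "g = 1" by (rule coprime_transfer[OF eq disj gcd]) (rule bspec[OF g(2)])
    with g(1) have False by auto
    then show ?thesis ..
  next
    case 3
    then obtain a b where "(a, b) \<in> set pairs_1" "cs = [a + b]" "ds = [a, b]" by (auto simp: family_1(1))
    moreover then have "0 < a" "0 < b" using family_1(2) by (auto simp: list_all_iff)
    ultimately show ?thesis using eq by (intro disjI1 family_1I[of a b]) simp_all
  next
    case 4
    then obtain a b where "(a, b) \<in> set pairs_2" "cs = [2 * a, b]" "ds = [a, 2 * b, a - b]"
      by (auto simp: family_2(1))
    moreover then have "0 < b" "b < a" using family_2(2) by (auto simp: list_all_iff)
    ultimately show ?thesis using eq by (intro disjI1 family_2I[of b a]) simp_all
  next
    case 5
    then obtain a b where "(a, b) \<in> set pairs_3" "cs = [2 * a, 2 * b]" "ds = [a, b, a + b]"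
      by (auto simp: family_3(1))
    moreover then have "0 < a" "0 < b" using family_3(2) by (auto simp: list_all_iff)
    ultimately show ?thesis using eq by (intro disjI1 family_3I[of a b]) simp_all
  qed
qed

end

theorem theorem1p2:
  fixes K :: nat and as bs :: "nat list"
  assumes "K \<ge> 1"
    and "length as = K" and "length bs = K + 1"
    and "\<forall>a\<in>set as. a > 0" and "\<forall>b\<in>set bs. b > 0"
    and "\<forall>k<K. \<forall>l<K + 1. as ! k \<noteq> bs ! l"
    and "sum_list as = sum_list bs"
    and "Gcd (set as \<union> set bs) = 1"
  shows "(\<forall>n. factorial_ratio as bs n \<in> \<int>) \<longleftrightarrow>
    (\<exists>a b :: nat. a > 0 \<and> b > 0 \<and>
      ((coprime a b \<and>
        (\<forall>n. factorial_ratio as bs n =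
           fact ((a + b) * n) / (fact (a * n) * fact (b * n)))) \<or>
       (coprime a b \<and> a > b \<and>
        (\<forall>n. factorial_ratio as bs n =
           fact (2 * a * n) * fact (b * n) /
           (fact (a * n) * fact (2 * b * n) * fact ((a - b) * n)))) \<or>
       (coprime a b \<and>
        (\<forall>n. factorial_ratio as bs n =
           fact (2 * a * n) * fact (2 * b * n) /
           (fact (a * n) * fact (b * n) * fact ((a + b) * n)))))) \<or>
    (\<exists>(as', bs')\<in>sporadic_parameters. mset as = mset as' \<and> mset bs = mset bs')"
    (is "?int \<longleftrightarrow> ?forms \<or> ?sporadic")
proof
  assume int: ?int
  have disj: "set as \<inter> set bs = {}"
  proof (rule equals0I)
    fix x assume "x \<in> set as \<inter> set bs"
    then have "x \<in> set as" "x \<in> set bs" by blast+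
    then obtain i j where i: "i < K" "as ! i = x" and j: "j < K + 1" "bs ! j = x"
      unfolding in_set_conv_nth assms(2,3) by blast
    show False using assms(6)[rule_format, OF i(1) j(1)] unfolding i(2) j(2) by (rule notE[OF _ refl])
  qed
  \<comment> \<open>The lcm serves as a common multiple; it is non-zero because all parameters are
    positive.\<close>
  define N where "N = Lcm (set as \<union> set bs)"
  have "ratio as bs N"
  proof
    have "0 \<notin> set as \<union> set bs" using assms(4,5) by auto
    then have "N \<noteq> 0" unfolding N_def by (subst Lcm_0_iff) simp_all
    then show "0 < N" by simp
    show "a dvd N" if "a \<in> set as" for a using that by (simp add: N_def dvd_Lcm)
    show "b dvd N" if "b \<in> set bs" for b using that by (simp add: N_def dvd_Lcm)
    show "length bs = Suc (length as)" "sum_list as = sum_list bs" using assms(2,3,7) by simp_all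
    show "(\<Sum>b\<leftarrow>bs. b * j div N) \<le> (\<Sum>a\<leftarrow>as. a * j div N)" if "j < N" for j
      using int that by (intro Landau_necessary) auto
  qed
  then interpret ratio as bs N .
  have "family (mset as) (mset bs) \<or> ?sporadic"
  proof (cases "card JA \<le> 8")
    case True
    then interpret small_ratio as bs N by unfold_locales
    show ?thesis using disj assms(8) by (rule small_rank)
  next
    case False
    then have "one_cycle quot \<or> two_cycles quot" by (intro large_rank_cycles disj assms(8)) simp
    then show ?thesis using one_cycle_family two_cycles_family by blast
  qed
  then show "?forms \<or> ?sporadic"
  proof
    assume "family (mset as) (mset bs)"
    from family_forms[OF this disj assms(8)] show ?thesis by (rule disjI1)
  qed (rule disjI2)
next
  assume "?forms \<or> ?sporadic"
  then show ?int
  proof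
    assume ?forms
    then obtain a b :: nat where
      "(\<forall>n. factorial_ratio as bs n = fact ((a + b) * n) / (fact (a * n) * fact (b * n))) \<or>
       b < a \<and> (\<forall>n. factorial_ratio as bs n =
         fact (2 * a * n) * fact (b * n) / (fact (a * n) * fact (2 * b * n) * fact ((a - b) * n))) \<or>
       (\<forall>n. factorial_ratio as bs n =
         fact (2 * a * n) * fact (2 * b * n) / (fact (a * n) * fact (b * n) * fact ((a + b) * n)))"
      by blast
    moreover have
      "fact ((a + b) * n) / (fact (a * n) * fact (b * n)) = factorial_ratio [a + b] [a, b] n"
      "fact (2 * a * n) * fact (b * n) / (fact (a * n) * fact (2 * b * n) * fact ((a - b) * n)) =
        factorial_ratio [2 * a, b] [a, 2 * b, a - b] n"
      "fact (2 * a * n) * fact (2 * b * n) / (fact (a * n) * fact (b * n) * fact ((a + b) * n)) =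
        factorial_ratio [2 * a, 2 * b] [a, b, a + b] n" for n
      by (simp_all add: factorial_ratio_def mult.assoc)
    ultimately show ?int by (auto simp only: form_1_Ints form_2_Ints form_3_Ints)
  next
    assume ?sporadic
    then obtain as' bs' where "(as', bs') \<in> sporadic_parameters" "mset as = mset as'" "mset bs = mset bs'" by blast
    then show ?int using sporadic_Ints factorial_ratio_cong by metis
  qed
qed

end
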